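(* Let $G$ be a probability distribution on $[0,\infty)$, let $\boldsymbol X=(X_0,X_1,\dots)$ be a homogeneous Markov chain on $[0,\infty)$ with transition kernel $K\in D(G)$, let $y(t)$ be a uniform extremal boundary for $K$, and let $\tau(t)$ and the extremal component $\boldsymbol X^{(t)}$ be defined using $y$. Assume $X_0\sim H$, where $H$ is a distribution on $[0,\infty)$ with a regularly varying tail, i.e. for some scaling function $b(t)\to\infty$ and some $\alpha>0$, $$t\,H(b(t)\,\cdot)\stackrel{v}{\longrightarrow}\nu_\alpha(\cdot)\quad\text{in }\mathbb M_+(0,\infty]\qquad(t\to\infty),$$ where $\nu_\alpha(x,\infty]=x^{-\alpha}$. Define the measure $\nu^*$ on $\mathbb E_m=(0,\infty]\times[0,\infty]^m$ by $$\nu^*(dx_0,d\boldsymbol x_m)=\nu_\alpha(dx_0)\,\mathsf P_{x_0}\big[(T^*_1,\dots,T^*_m)\in d\boldsymbol x_m\big],$$ where $T^*_n=T^*_0\xi_1\cdots\xi_n$ with $\xi_i$ iid $\sim G$ independent of $T^*_0$. Then for $m=1,2,\dots$ the following hold as $t\to\infty$: (a) In $\mathbb M_+((0,\infty]^m\times[0,\infty])$, $$t\,\mathsf P\big[b(t)^{-1}(X_0,X_1,\dots,X_m)\in\cdot\,\cap(0,\infty]^m\times[0,\infty]\big]\stackrel{v}{\longrightarrow}\nu^*\big(\cdot\cap(0,\infty]^m\times[0,\infty]\big).$$ (b) In $\mathbb M_+(\mathbb E_m)$, $\;t\,\mathsf P\big[b(t)^{-1}(X_0^{(b(t))},X_1^{(b(t))},\dots,X_m^{(b(t))})\in\cdot\,\big]\stackrel{v}{\longrightarrow}\nu^*(\cdot).$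 (c) If either $G(\{0\})=0$, or the zero function is an extremal boundary for $K$, or $K$ satisfies the regularity condition, then in $\mathbb M_+(\mathbb E_m)$, $\;t\,\mathsf P\big[b(t)^{-1}(X_0,X_1,\dots,X_m)\in\cdot\,\big]\stackrel{v}{\longrightarrow}\nu^*(\cdot).$ (d) In $\mathbb M_+(0,\infty]$, $\;t\,\mathsf P\big[X_0/b(t)\in dx_0,\ \tau(b(t))\ge m\big]\stackrel{v}{\longrightarrow}(1-G(\{0\}))^{m-1}\,\nu_\alpha(dx_0).$
   Context: A Markov transition kernel $K:[0,\infty)\times\mathcal B[0,\infty)\to[0,1]$ is in the domain of attraction of $G$, written $K\in D(G)$, if $K(t,t\,\cdot)\Rightarrow G(\cdot)$ on $[0,\infty]$ as $t\to\infty$ (weak convergence; $tA=\{ta:a\in A\}$). $K\in D(G)$ satisfies the regularity condition if $K(tu_t,t\,\cdot)\Rightarrow\epsilon_0$ (point mass at $0$) on $[0,\infty]$ as $t\to\infty$ for every non-negative function $u_t\to0$. An extremal boundary for $K\in D(G)$ is a non-negative function $y(t)$ on $[0,\infty)$ with $\lim_{t\to\infty}y(t)=0$ and $K(t,t[0,y(t)])\to G(\{0\})$; it is a uniform extremal boundary if moreover $K(tu_t,t[0,y(t)])\to G(\{0\})$ as $t\to\infty$ for every non-negative function $u_t\to u>0$. $\tau(t)=\inf\{n\ge0:X_n\le t\,y(t)\}$; the extremal component of $\boldsymbol X$ relative to $t>0$ is $X^{(t)}_n=X_n\mathbf 1_{\{n<\tau(t)\}}$, $n\ge0$. $\mathsf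 P_{x_0}$ denotes conditional probability given initial state $x_0$. $\mathbb M_+(\mathbb E)$ is the space of non-negative Radon measures on the locally compact space $\mathbb E$; $\mu_t\stackrel{v}{\to}\mu$ means $\int f\,d\mu_t\to\int f\,d\mu$ for all non-negative continuous $f$ with compact support in $\mathbb E$. *)

theory Defs
  imports "HOL-Probability.Probability"
begin

abbreviation half_line :: "real measure" where
  "half_line \<equiv> restrict_space borel {0..}"

definition weak_conv :: "('t \<Rightarrow> 'a::topological_space measure) \<Rightarrow> 'a measure \<Rightarrow> 't filter \<Rightarrow> bool" where
  "weak_conv \<mu> \<nu> F \<longleftrightarrow>
     (\<forall>f :: 'a \<Rightarrow> real. continuous_on UNIV f \<and> bounded (range f) \<longrightarrow>
        ((\<lambda>t. \<integral>x. f x \<partial>\<mu> t) \<longlongrightarrow> (\<integral>x. f x \<partial>\<nu>)) F)"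

definition borel_of :: "'a topology \<Rightarrow> 'a measure" where
  "borel_of E = sigma (topspace E) {U. openin E U}"

text \<open>All spaces used below are locally compact, Hausdorff and second countable; on such
  spaces every Borel measure that is finite on compact sets is inner and outer regular.\<close>

definition radon_on :: "'a topology \<Rightarrow> 'a measure \<Rightarrow> bool" where
  "radon_on E \<mu> \<longleftrightarrow>
     sets \<mu> = sets (borel_of E) \<and> (\<forall>C. compactin E C \<longrightarrow> emeasure \<mu> C < \<infinity>)"

text \<open>\<open>vague_conv E \<mu> \<nu> F\<close>: the measures \<open>\<mu> t\<close> converge to \<open>\<nu>\<close> along \<open>F\<close> in the space of
  Radon measures on \<open>E\<close>. Vanishing off some compact set is the same as having compact support,
  because \<open>E\<close> is Hausdorff.\<close>

definition vague_conv :: "'a topology \<Rightarrow> ('t \<Rightarrow> 'a measure) \<Rightarrow> 'a measure \<Rightarrow> 't filter \<Rightarrow> bool" where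
  "vague_conv E \<mu> \<nu> F \<longleftrightarrow>
     (\<forall>\<^sub>F t in F. radon_on E (\<mu> t)) \<and> radon_on E \<nu> \<and>
     (\<forall>f :: 'a \<Rightarrow> real.
        continuous_map E euclideanreal f \<and> (\<forall>x\<in>topspace E. 0 \<le> f x) \<and>
        (\<exists>C. compactin E C \<and> (\<forall>x\<in>topspace E - C. f x = 0)) \<longrightarrow>
        ((\<lambda>t. \<integral>x. f x \<partial>\<mu> t) \<longlongrightarrow> (\<integral>x. f x \<partial>\<nu>)) F)"

text \<open>The measure \<open>M[f \<in> \<cdot> \<inter> E]\<close> on \<open>E\<close>: mass that \<open>f\<close> puts outside \<open>E\<close> is discarded.\<close>

definition law_on :: "'a topology \<Rightarrow> 'w measure \<Rightarrow> ('w \<Rightarrow> 'a) \<Rightarrow> 'a measure" where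
  "law_on E M f = distr (restrict_space M (f -` topspace E \<inter> space M)) (borel_of E) f"

text \<open>The type \<^typ>\<open>ennreal\<close> is \<open>[0,\<infinity>]\<close> with its order topology. Points of the product
  spaces are extensional functions on \<open>{..m}\<close>.\<close>

definition pos_top :: "ennreal topology" where \<comment> \<open>\<open>(0,\<infinity>]\<close>\<close>
  "pos_top = top_of_set {0<..}"

definition first_pos_top :: "nat \<Rightarrow> (nat \<Rightarrow> ennreal) topology" where \<comment> \<open>\<open>(0,\<infinity>] \<times> [0,\<infinity>]^m\<close>\<close>
  "first_pos_top m = product_topology (\<lambda>i. if i = 0 then pos_top else euclidean) {..m}"

definition last_free_top :: "nat \<Rightarrow> (nat \<Rightarrow> ennreal) topology" where \<comment> \<open>\<open>(0,\<infinity>]^m \<times> [0,\<infinity>]\<close>\<close>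
  "last_free_top m = product_topology (\<lambda>i. if i < m then pos_top else euclidean) {..m}"

text \<open>For \<open>t > 0\<close>, \<open>rescale \<mu> t\<close> is the measure \<open>A \<mapsto> \<mu> (t A)\<close> on \<open>[0,\<infinity>]\<close>.\<close>

definition rescale :: "real measure \<Rightarrow> real \<Rightarrow> ennreal measure" where
  "rescale \<mu> t = distr \<mu> borel (\<lambda>x. ennreal (x / t))"

definition attracted :: "(real \<Rightarrow> real measure) \<Rightarrow> real measure \<Rightarrow> bool" where
  "attracted K G \<longleftrightarrow> weak_conv (\<lambda>t. rescale (K t) t) (distr G borel ennreal) at_top"

definition regularity_condition :: "(real \<Rightarrow> real measure) \<Rightarrow> bool" where
  "regularity_condition K \<longleftrightarrow>
     (\<forall>u. (\<forall>t. 0 \<le> u t) \<and> (u \<longlongrightarrow> 0) at_top \<longrightarrow>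
        weak_conv (\<lambda>t. rescale (K (t * u t)) t) (return borel 0) at_top)"

definition extremal_boundary ::
  "(real \<Rightarrow> real measure) \<Rightarrow> real measure \<Rightarrow> (real \<Rightarrow> real) \<Rightarrow> bool" where
  "extremal_boundary K G y \<longleftrightarrow>
     (\<forall>t\<ge>0. 0 \<le> y t) \<and> (y \<longlongrightarrow> 0) at_top \<and>
     ((\<lambda>t. measure (K t) ((*) t ` {0..y t})) \<longlongrightarrow> measure G {0}) at_top"

definition uniform_extremal_boundary ::
  "(real \<Rightarrow> real measure) \<Rightarrow> real measure \<Rightarrow> (real \<Rightarrow> real) \<Rightarrow> bool" where
  "uniform_extremal_boundary K G y \<longleftrightarrow>
     extremal_boundary K G y \<and>
     (\<forall>u c. (\<forall>t. 0 \<le> u t) \<and> 0 < c \<and> (u \<longlongrightarrow> c) at_top \<longrightarrow>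
        ((\<lambda>t. measure (K (t * u t)) ((*) t ` {0..y t})) \<longlongrightarrow> measure G {0}) at_top)"

definition past :: "'w measure \<Rightarrow> (nat \<Rightarrow> 'w \<Rightarrow> real) \<Rightarrow> nat \<Rightarrow> 'w measure" where
  "past M X n = vimage_algebra (space M) (\<lambda>\<omega>. \<lambda>i\<in>{..n}. X i \<omega>) (Pi\<^sub>M {..n} (\<lambda>_. half_line))"

definition markov_chain ::
  "'w measure \<Rightarrow> (real \<Rightarrow> real measure) \<Rightarrow> (nat \<Rightarrow> 'w \<Rightarrow> real) \<Rightarrow> bool" where
  "markov_chain M K X \<longleftrightarrow>
     (\<forall>n. X n \<in> measurable M half_line) \<and>
     (\<forall>n. \<forall>A\<in>sets half_line.
        AE \<omega> in M. real_cond_exp M (past M X n) (\<lambda>\<omega>. indicator A (X (Suc n) \<omega>)) \<omega>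
                   = measure (K (X n \<omega>)) A)"

text \<open>The infimum of the empty set of extended naturals is \<open>\<infinity>\<close>.\<close>

definition hitting_time ::
  "(real \<Rightarrow> real) \<Rightarrow> (nat \<Rightarrow> 'w \<Rightarrow> real) \<Rightarrow> real \<Rightarrow> 'w \<Rightarrow> enat" where
  "hitting_time y X t \<omega> = Inf {enat n |n. X n \<omega> \<le> t * y t}"

definition extremal_component ::
  "(real \<Rightarrow> real) \<Rightarrow> (nat \<Rightarrow> 'w \<Rightarrow> real) \<Rightarrow> real \<Rightarrow> nat \<Rightarrow> 'w \<Rightarrow> real" where
  "extremal_component y X t n \<omega> = (if enat n < hitting_time y X t \<omega> then X n \<omega> else 0)"

definition scaled_path :: "nat \<Rightarrow> real \<Rightarrow> (nat \<Rightarrow> 'w \<Rightarrow> real) \<Rightarrow> 'w \<Rightarrow> nat \<Rightarrow> ennreal" where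
  "scaled_path m c Z \<omega> = (\<lambda>i\<in>{..m}. ennreal (Z i \<omega> / c))"

text \<open>The law of \<open>(T 0, T 1, \<dots>, T m)\<close> where \<open>T 0 = x\<close> and \<open>T n = x \<xi>\<^sub>1 \<cdots> \<xi>\<^sub>n\<close> with \<open>\<xi>\<close> iid
  of law \<open>G\<close>.\<close>

definition tail_chain_law :: "real measure \<Rightarrow> nat \<Rightarrow> ennreal \<Rightarrow> (nat \<Rightarrow> ennreal) measure" where
  "tail_chain_law G m x =
     distr (Pi\<^sub>M {1..m} (\<lambda>_. G)) (borel_of (first_pos_top m))
       (\<lambda>\<xi>. \<lambda>n\<in>{..m}. x * ennreal (\<Prod>i\<in>{1..n}. \<xi> i))"

text \<open>\<open>bind\<close> integrates the probability kernel \<open>x \<mapsto> P\<^sub>x\<close> against the infinite measure \<open>\<nu>\<close>;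
  since \<open>T 0 = x\<close> under \<open>P\<^sub>x\<close>, this is the measure \<open>\<nu>(dx\<^sub>0) P[(T\<^sub>1,\<dots>,T\<^sub>m) \<in> dx | T\<^sub>0 = x\<^sub>0]\<close>.
  The point \<open>x\<^sub>0 = \<infinity>\<close>, where \<open>\<infinity> * 0 = 0\<close> in \<^typ>\<open>ennreal\<close>, carries no \<open>\<nu>\<close>-mass.\<close>

definition nu_star :: "ennreal measure \<Rightarrow> real measure \<Rightarrow> nat \<Rightarrow> (nat \<Rightarrow> ennreal) measure" where
  "nu_star \<nu> G m = \<nu> \<bind> tail_chain_law G m"

end

theory Submission
  imports Defs
begin

text \<open>
  By the Markov property the last coordinate of a path can be integrated out against the kernel, so
  by induction on \<open>m\<close> everything reduces to a one-step statement: if \<open>f\<^sub>n\<close> converges continuously to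
  \<open>f\<close> away from zero, \<open>c\<^sub>n \<longlonglongrightarrow> \<infinity>\<close> and \<open>u\<^sub>n \<longlonglongrightarrow> u > 0\<close>, then the integral of \<open>f\<^sub>n (x / c\<^sub>n)\<close> against
  \<open>K (c\<^sub>n u\<^sub>n)\<close> tends to the integral of \<open>f (u \<xi>)\<close> against \<open>G\<close>. As \<open>K (s, s \<cdot>) \<Rightarrow> G\<close> for \<open>s = c\<^sub>n u\<^sub>n\<close>, Skorohod's
  theorem gives almost surely convergent versions, and the claim is dominated convergence, except
  on the event that the limit is \<open>0\<close>. There each part supplies its own argument: the functional
  vanishes unless all coordinates but the last are bounded away from zero (a); what falls below the
  extremal boundary is replaced by \<open>0\<close>, and asymptotically nothing stays small above it (b, d);
  or \<open>0\<close> has no mass, is hit exactly, or is approached only by chains that stay negligible (c).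
\<close>

text \<open>Attraction controls \<open>K\<close> only from states of the order of the scale. Once a
  chain has dropped to a smaller order, the limit records just 0, while the next step is
  unconstrained and may even lead back to the order of the scale. Hence weak convergence of the
  whole path cannot be expected in general, and functionals are tested only along the path sequences
  that the assumptions of each part really produce. The starting point of each kernel moves with the
  index, and integrating out a coordinate yields functionals that move as well. The induction
  therefore needs continuous convergence, that is convergence of \<open>f n (w n)\<close> along all
  admissible \<open>w\<close>, and not weak convergence against a fixed test function. This form
  also admits the discontinuous functionals of (b) and (d), where the boundary cuts the path.
  Skorohod's theorem concerns sequences, so t tends to infinity along arbitrary sequences. The
  boundary and regularity conditions speak of functions of t and have to be transferred to
  sequences.\<close>

section \<open>Convergence along sequences\<close>

text \<open>
  An extended continuous mapping theorem in which \<open>f n (ws n)\<close> needs to converge along \<open>ws \<longlonglongrightarrow> 0\<close> only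
  if \<open>ws n \<in> S n\<close>, provided asymptotically no mass near \<open>0\<close> lies outside \<open>S n\<close>. On a Skorohod coupling
  this becomes dominated convergence.
\<close>

lemma extended_continuous_mapping:
  fixes \<mu>s :: "nat \<Rightarrow> real measure" and f :: "nat \<Rightarrow> real \<Rightarrow> real" and g :: "real \<Rightarrow> real"
  assumes rds: "\<And>n. real_distribution (\<mu>s n)" and rd: "real_distribution \<mu>"
    and wc: "weak_conv_m \<mu>s \<mu>"
    and f[measurable]: "\<And>n. f n \<in> borel_measurable borel" and g[measurable]: "g \<in> borel_measurable borel"
    and B: "\<And>n x. \<bar>f n x\<bar> \<le> B"
    and S[measurable]: "\<And>n. S n \<in> sets borel" and S0: "\<And>n. 0 \<in> S n"
    and nonneg: "AE w in \<mu>. 0 \<le> w"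
    and away: "AE w in \<mu>. w \<noteq> 0 \<longrightarrow> (\<forall>ws. ws \<longlonglongrightarrow> w \<longrightarrow> (\<lambda>n. f n (ws n)) \<longlonglongrightarrow> g w)"
    and zero: "\<And>ws. measure \<mu> {0} \<noteq> 0 \<Longrightarrow> ws \<longlonglongrightarrow> 0 \<Longrightarrow> (\<And>n. ws n \<in> S n) \<Longrightarrow> (\<lambda>n. f n (ws n)) \<longlonglongrightarrow> g 0"
    and small: "measure \<mu> {0} = 0 \<or> (\<forall>n. S n = UNIV) \<or>
      (\<exists>z. z \<longlonglongrightarrow> 0 \<and> (\<forall>n. S n = {..z n}) \<and> (\<lambda>n. measure (\<mu>s n) (S n)) \<longlonglongrightarrow> measure \<mu> {0})"
  shows "(\<lambda>n. \<integral>x. f n x \<partial>\<mu>s n) \<longlonglongrightarrow> (\<integral>x. g x \<partial>\<mu>)"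
proof -
  obtain \<Omega> :: "real measure" and Ys Y where \<Omega>: "prob_space \<Omega>"
    and Ys[measurable]: "\<And>n. Ys n \<in> borel_measurable \<Omega>" and dYs: "\<And>n. distr \<Omega> borel (Ys n) = \<mu>s n"
    and Y': "Y \<in> measurable \<Omega> lborel" and dY: "distr \<Omega> borel Y = \<mu>"
    and lim: "\<And>x. x \<in> space \<Omega> \<Longrightarrow> (\<lambda>n. Ys n x) \<longlonglongrightarrow> Y x"
    using Skorohod[OF rds rd wc] by blast
  have Y[measurable]: "Y \<in> borel_measurable \<Omega>" using Y' by simp
  interpret prob_space \<Omega> by fact
  have AEd: "AE w in \<mu>. P w \<Longrightarrow> AE x in \<Omega>. P (Y x)" for P
    using AE_distrD[OF Y, of P] unfolding dY by simp
  have m0: "measure \<mu> {0} = prob {x\<in>space \<Omega>. Y x = 0}"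
    unfolding dY[symmetric] by (subst measure_distr) (auto intro!: arg_cong[where f=prob])
  \<comment> \<open>The only place where convergence can fail: the limit is 0 but the approach
    leaves \<open>S n\<close>.\<close>
  define D where "D n = {x\<in>space \<Omega>. Y x = 0 \<and> Ys n x \<notin> S n}" for n
  have D[measurable]: "D n \<in> sets \<Omega>" for n unfolding D_def by measurable
  have D0: "(\<lambda>n. prob (D n)) \<longlonglongrightarrow> 0"
    using small
  proof (elim disjE exE conjE)
    assume "measure \<mu> {0} = 0"
    moreover have "prob (D n) \<le> prob {x\<in>space \<Omega>. Y x = 0}" for n
      by (rule finite_measure_mono) (auto simp: D_def)
    ultimately have "prob (D n) = 0" for n
      using measure_nonneg[of \<Omega> "D n"] unfolding m0 by (metis order_antisym)
    then show ?thesis by simp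
  next
    assume "\<forall>n. S n = UNIV"
    then show ?thesis by (simp add: D_def)
  next
    fix z assume z: "z \<longlonglongrightarrow> 0" "\<forall>n. S n = {..z n}"
      and mS: "(\<lambda>n. measure (\<mu>s n) (S n)) \<longlonglongrightarrow> measure \<mu> {0}"
    \<comment> \<open>\<open>T n\<close> is the opposite mismatch. There the limit is positive and
      the thresholds \<open>z n\<close> tend to 0, so its probability vanishes. Since
      \<open>S n\<close> and the point 0 have asymptotically equal mass, the probability of
      \<open>D n\<close> vanishes too.\<close>
    define T where "T n = {x\<in>space \<Omega>. Y x \<noteq> 0 \<and> Ys n x \<in> S n}" for n
    have T[measurable]: "T n \<in> sets \<Omega>" for n unfolding T_def by measurable
    have "(\<lambda>n. \<integral>x. indicator (T n) x \<partial>\<Omega>) \<longlonglongrightarrow> (\<integral>x. (0::real) \<partial>\<Omega>)"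
    proof (rule integral_dominated_convergence[where w="\<lambda>_. 1"])
      show "AE x in \<Omega>. (\<lambda>n. indicator (T n) x) \<longlonglongrightarrow> (0::real)"
        using AEd[OF nonneg] AE_space
      proof eventually_elim
        case (elim x)
        show ?case
        proof (cases "Y x = 0")
          case True
          then show ?thesis by (simp add: T_def)
        next
          case False
          then have "0 < Y x" using elim by simp
          have "(\<lambda>n. Ys n x - z n) \<longlonglongrightarrow> Y x - 0" using lim z elim by (intro tendsto_diff) auto
          then have "eventually (\<lambda>n. 0 < Ys n x - z n) sequentially"
            using \<open>0 < Y x\<close> by (auto dest: order_tendstoD(1))
          then have "eventually (\<lambda>n. indicator (T n) x = (0::real)) sequentially"
            by eventually_elim (simp add: T_def z)
          then show ?thesis by (rule tendsto_eventually)
        qed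
      qed
    qed auto
    then have T0: "(\<lambda>n. prob (T n)) \<longlonglongrightarrow> 0" by simp
    have "prob (D n) = measure \<mu> {0} - measure (\<mu>s n) (S n) + prob (T n)" for n
    proof -
      let ?U = "{x\<in>space \<Omega>. Y x = 0 \<and> Ys n x \<in> S n}"
      have "measure \<mu> {0} = prob (D n \<union> ?U)" unfolding m0 D_def by (auto intro!: arg_cong[where f=prob])
      also have "\<dots> = prob (D n) + prob ?U"
        by (rule finite_measure_Union) (auto simp: D_def)
      finally have 1: "measure \<mu> {0} = prob (D n) + prob ?U" .
      have "measure (\<mu>s n) (S n) = prob (T n \<union> ?U)"
        unfolding dYs[symmetric] by (subst measure_distr) (auto simp: T_def intro!: arg_cong[where f=prob])
      also have "\<dots> = prob (T n) + prob ?U"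
        by (rule finite_measure_Union) (auto simp: T_def)
      finally show ?thesis using 1 by simp
    qed
    moreover have "(\<lambda>n. measure \<mu> {0} - measure (\<mu>s n) (S n) + prob (T n)) \<longlonglongrightarrow> measure \<mu> {0} - measure \<mu> {0} + 0"
      by (intro tendsto_intros mS T0)
    ultimately show ?thesis by simp
  qed
  \<comment> \<open>On \<open>D n\<close> the version is moved to 0, a point of \<open>S n\<close>,
    so that \<open>zero\<close> applies wherever the limit is 0. The integral changes by at most
    \<open>2 * B * prob (D n)\<close>.\<close>
  define Z where "Z n x = (if x \<in> D n then 0 else Ys n x)" for n x
  have Z[measurable]: "Z n \<in> borel_measurable \<Omega>" for n unfolding Z_def by measurable
  have "(\<lambda>n. \<integral>x. f n (Z n x) \<partial>\<Omega>) \<longlonglongrightarrow> (\<integral>x. g (Y x) \<partial>\<Omega>)"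
  proof (rule integral_dominated_convergence[where w="\<lambda>_. B"])
    have "AE x in \<Omega>. measure \<mu> {0} = 0 \<longrightarrow> Y x \<noteq> 0"
      unfolding m0 using prob_eq_0[of "{x\<in>space \<Omega>. Y x = 0}"] AE_space by (cases "prob {x\<in>space \<Omega>. Y x = 0} = 0") auto
    then show "AE x in \<Omega>. (\<lambda>n. f n (Z n x)) \<longlonglongrightarrow> g (Y x)"
      using AEd[OF away] AE_space
    proof eventually_elim
      case (elim x)
      show ?case
      proof (cases "Y x = 0")
        case True
        have "(\<lambda>n. Z n x) \<longlonglongrightarrow> 0"
          by (rule Lim_null_comparison[OF _ tendsto_norm_zero[of "\<lambda>n. Ys n x"]])
             (use lim[OF elim(3)] True in \<open>auto simp: Z_def\<close>)
        moreover have "Z n x \<in> S n" for n using True elim S0 by (auto simp: Z_def D_def)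
        ultimately show ?thesis using zero True elim by auto
      next
        case False
        then have "Z n x = Ys n x" for n by (simp add: Z_def D_def)
        then show ?thesis using elim lim False by auto
      qed
    qed
  qed (use B in auto)
  moreover have "(\<lambda>n. (\<integral>x. f n (Ys n x) \<partial>\<Omega>) - (\<integral>x. f n (Z n x) \<partial>\<Omega>)) \<longlonglongrightarrow> 0"
  proof (rule Lim_null_comparison)
    show "(\<lambda>n. 2 * B * prob (D n)) \<longlonglongrightarrow> 0" using tendsto_mult_right_zero[OF D0] by simp
    have i: "integrable \<Omega> (\<lambda>x. f n (Ys n x))" "integrable \<Omega> (\<lambda>x. f n (Z n x))" for n
      by (rule integrable_const_bound[where B=B]; use B in auto)+
    have "\<bar>(\<integral>x. f n (Ys n x) \<partial>\<Omega>) - (\<integral>x. f n (Z n x) \<partial>\<Omega>)\<bar> \<le> 2 * B * prob (D n)" for n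
    proof -
      have "\<bar>(\<integral>x. f n (Ys n x) \<partial>\<Omega>) - (\<integral>x. f n (Z n x) \<partial>\<Omega>)\<bar> = \<bar>\<integral>x. f n (Ys n x) - f n (Z n x) \<partial>\<Omega>\<bar>"
        using i by simp
      also have "\<dots> \<le> (\<integral>x. \<bar>f n (Ys n x) - f n (Z n x)\<bar> \<partial>\<Omega>)" by (rule integral_abs_bound)
      also have "\<dots> \<le> (\<integral>x. 2 * B * indicator (D n) x \<partial>\<Omega>)"
      proof (rule integral_mono)
        show "integrable \<Omega> (\<lambda>x. \<bar>f n (Ys n x) - f n (Z n x)\<bar>)" using i by auto
        show "\<bar>f n (Ys n x) - f n (Z n x)\<bar> \<le> 2 * B * indicator (D n) x" for x
          using B[of n "Ys n x"] B[of n "Z n x"] by (auto simp: Z_def indicator_def)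
      qed (simp add: less_top[symmetric])
      finally show ?thesis by simp
    qed
    then show "\<forall>\<^sub>F n in sequentially. norm ((\<integral>x. f n (Ys n x) \<partial>\<Omega>) - (\<integral>x. f n (Z n x) \<partial>\<Omega>)) \<le> 2 * B * prob (D n)"
      by simp
  qed
  ultimately have "(\<lambda>n. (\<integral>x. f n (Z n x) \<partial>\<Omega>) + ((\<integral>x. f n (Ys n x) \<partial>\<Omega>) - (\<integral>x. f n (Z n x) \<partial>\<Omega>))) \<longlonglongrightarrow> (\<integral>x. g (Y x) \<partial>\<Omega>) + 0"
    by (rule tendsto_add)
  then have "(\<lambda>n. \<integral>x. f n (Ys n x) \<partial>\<Omega>) \<longlonglongrightarrow> (\<integral>x. g (Y x) \<partial>\<Omega>)" by simp
  moreover have "(\<integral>x. f n x \<partial>\<mu>s n) = (\<integral>x. f n (Ys n x) \<partial>\<Omega>)" for n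
    unfolding dYs[symmetric] by (rule integral_distr) auto
  moreover have "(\<integral>x. g x \<partial>\<mu>) = (\<integral>x. g (Y x) \<partial>\<Omega>)"
    unfolding dY[symmetric] by (rule integral_distr) auto
  ultimately show ?thesis by simp
qed

text \<open>
  The sequence \<open>s\<close> may repeat values, so \<open>v\<close> need not be of the form \<open>u \<circ> s\<close>. It suffices that \<open>u\<close> picks
  up a violation of the limit at every point where \<open>v\<close> has one.
\<close>

lemma tendsto_sequence_of_functions:
  fixes \<Phi> :: "real \<Rightarrow> real \<Rightarrow> real"
  assumes fn: "\<And>u. (\<forall>t. 0 \<le> u t) \<Longrightarrow> (u \<longlongrightarrow> c) at_top \<Longrightarrow> ((\<lambda>t. \<Phi> t (u t)) \<longlongrightarrow> L) at_top"
    and s: "filterlim s at_top sequentially" and v: "v \<longlonglongrightarrow> c" and v0: "\<And>n. 0 \<le> v n" and c: "0 \<le> c"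
  shows "(\<lambda>n. \<Phi> (s n) (v n)) \<longlonglongrightarrow> L"
proof (rule tendstoI)
  fix e :: real assume e: "0 < e"
  define bad where "bad t n \<longleftrightarrow> s n = t \<and> \<not> dist (\<Phi> t (v n)) L < e" for t n
  define u where "u t = (if \<exists>n. bad t n then v (SOME n. bad t n) else c)" for t
  have "(u \<longlongrightarrow> c) at_top"
  proof (rule tendstoI)
    fix d :: real assume "0 < d"
    then obtain N where N: "\<And>n. n \<ge> N \<Longrightarrow> dist (v n) c < d"
      using tendstoD[OF v] unfolding eventually_sequentially by blast
    \<comment> \<open>The indices below \<open>N\<close> occupy finitely many times, so past their
      maximum \<open>T\<close> the chosen index is at least \<open>N\<close>.\<close>
    have "finite (s ` {..<N})" by simp
    then obtain T where T: "\<And>n. n < N \<Longrightarrow> s n \<le> T"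
      by (metis bdd_above_finite bdd_above_def imageI lessThan_iff)
    have "dist (u t) c < d" if "t > T" for t
    proof (cases "\<exists>n. bad t n")
      case True
      then have "bad t (SOME n. bad t n)" by (rule someI_ex)
      then have "s (SOME n. bad t n) = t" by (simp add: bad_def)
      then have "\<not> (SOME n. bad t n) < N" using T that by force
      then show ?thesis using N True by (simp add: u_def)
    qed (simp add: u_def \<open>0 < d\<close>)
    then show "\<forall>\<^sub>F t in at_top. dist (u t) c < d" 
      by (rule eventually_mono[OF eventually_gt_at_top[of T]])
  qed
  moreover have "\<forall>t. 0 \<le> u t" using v0 c by (simp add: u_def)
  ultimately have "((\<lambda>t. \<Phi> t (u t)) \<longlongrightarrow> L) at_top" using fn by blast
  then have "(\<lambda>n. \<Phi> (s n) (u (s n))) \<longlonglongrightarrow> L" using s by (rule filterlim_compose)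
  then have "\<forall>\<^sub>F n in sequentially. dist (\<Phi> (s n) (u (s n))) L < e" using e by (rule tendstoD)
  then show "\<forall>\<^sub>F n in sequentially. dist (\<Phi> (s n) (v n)) L < e"
  proof eventually_elim
    case (elim n)
    show ?case
    proof (rule ccontr)
      assume "\<not> ?thesis"
      then have ex: "\<exists>k. bad (s n) k" by (auto simp: bad_def)
      then have "bad (s n) (SOME k. bad (s n) k)" by (rule someI_ex)
      then have "\<not> dist (\<Phi> (s n) (v (SOME k. bad (s n) k))) L < e" unfolding bad_def by blast
      then show False using elim ex by (simp add: u_def)
    qed
  qed
qed

text \<open>\<open>enn2real\<close> jumps to 0 at infinity. Clipping at the finite level
  \<open>N\<close> first makes it continuous, which turns test functions on the line into test
  functions on [0,\<infinity>].\<close>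

lemma continuous_extension_to_infinity:
  fixes h :: "real \<Rightarrow> real"
  assumes h: "continuous_on {0..} h" and N: "0 \<le> N"
  shows "continuous_on UNIV (\<lambda>e::ennreal. h (enn2real (min e (ennreal N))))"
proof -
  have "continuous_on UNIV (\<lambda>e::ennreal. enn2real (min e (ennreal N)))"
    unfolding continuous_on_def
  proof
    fix e :: ennreal
    have fin: "min e (ennreal N) < top" by (simp add: min_less_iff_disj)
    have "((\<lambda>e::ennreal. min e (ennreal N)) \<longlongrightarrow> min e (ennreal N)) (at e)"
      by (intro tendsto_intros)
    then show "((\<lambda>e. enn2real (min e (ennreal N))) \<longlongrightarrow> enn2real (min e (ennreal N))) (at e)"
      using fin by (intro tendsto_enn2real) auto
  qed
  then show ?thesis
    by (rule continuous_on_compose2[OF h]) auto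
qed

text \<open>Weak convergence on the line may be tested on the ramps \<open>cts_step x y\<close>.
  These are eventually constant, hence extend continuously to infinity and are covered by the
  convergence on [0,\<infinity>].\<close>

lemma weak_conv_m_of_ennreal:
  fixes N :: "nat \<Rightarrow> 'a measure" and X :: "nat \<Rightarrow> 'a \<Rightarrow> real"
  assumes N: "\<And>n. prob_space (N n)" and X[measurable]: "\<And>n. X n \<in> borel_measurable (N n)"
    and X0: "\<And>n x. x \<in> space (N n) \<Longrightarrow> 0 \<le> X n x"
    and \<mu>: "real_distribution \<mu>" "AE x in \<mu>. 0 \<le> x"
    and conv: "\<And>h :: ennreal \<Rightarrow> real. continuous_on UNIV h \<Longrightarrow> (\<And>e. 0 \<le> h e) \<Longrightarrow> (\<And>e. h e \<le> 1) \<Longrightarrow>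
      (\<lambda>n. \<integral>x. h (ennreal (X n x)) \<partial>N n) \<longlonglongrightarrow> (\<integral>x. h (ennreal x) \<partial>\<mu>)"
  shows "weak_conv_m (\<lambda>n. distr (N n) borel (X n)) \<mu>"
proof (rule integral_cts_step_conv_imp_weak_conv)
  show "real_distribution (distr (N n) borel (X n))" for n
    by (simp add: N prob_space.real_distribution_distr)
  show "real_distribution \<mu>" by fact
  fix x y :: real assume xy: "x < y"
  have [measurable]: "cts_step x y \<in> borel_measurable borel" unfolding cts_step_def[abs_def] by simp
  \<comment> \<open>Beyond \<open>y\<close> the ramp is constant, so clipping there loses nothing.
    For negative \<open>y\<close> the half-line sees only that constant, and the level 0
    serves.\<close>
  define h where "h e = cts_step x y (enn2real (min e (ennreal (max 0 y))))" for e
  have "continuous_on {0..} (cts_step x y)"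
    by (rule continuous_on_subset[OF uniformly_continuous_imp_continuous[OF cts_step_uniformly_continuous[OF xy]]]) simp
  then have "continuous_on UNIV h" unfolding h_def by (rule continuous_extension_to_infinity) simp
  then have "(\<lambda>n. \<integral>x. h (ennreal (X n x)) \<partial>N n) \<longlonglongrightarrow> (\<integral>x. h (ennreal x) \<partial>\<mu>)"
    by (rule conv) (use xy in \<open>auto simp: h_def cts_step_def field_simps\<close>)
  moreover have h: "h (ennreal v) = cts_step x y v" if "0 \<le> v" for v
  proof -
    have "enn2real (min (ennreal v) (ennreal (max 0 y))) = min v (max 0 y)"
      using that by (cases "v \<le> max 0 y") (auto simp: min_def ennreal_le_iff2 max_def split: if_splits)
    then show ?thesis using that xy by (auto simp: h_def cts_step_def)
  qed
  moreover have "(\<integral>x. h (ennreal (X n x)) \<partial>N n) = (\<integral>z. cts_step x y z \<partial>distr (N n) borel (X n))" for n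
    by (subst integral_distr) (auto intro!: Bochner_Integration.integral_cong simp: h X0)
  moreover have "(\<integral>z. h (ennreal z) \<partial>\<mu>) = (\<integral>z. cts_step x y z \<partial>\<mu>)"
  proof (rule integral_cong_AE)
    interpret real_distribution \<mu> by fact
    have [measurable]: "h \<in> borel_measurable borel" using \<open>continuous_on UNIV h\<close> by (rule borel_measurable_continuous_onI)
    show "(\<lambda>z. h (ennreal z)) \<in> borel_measurable \<mu>" "cts_step x y \<in> borel_measurable \<mu>" by measurable
    show "AE z in \<mu>. h (ennreal z) = cts_step x y z" using \<mu>(2) by eventually_elim (rule h)
  qed
  ultimately show "(\<lambda>n. \<integral>z. cts_step x y z \<partial>distr (N n) borel (X n)) \<longlonglongrightarrow> (\<integral>z. cts_step x y z \<partial>\<mu>)"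
    by simp
qed

section \<open>Path functionals of a Markov chain\<close>

lemma integral_abs_le_bound:
  assumes "prob_space N" "\<And>x. \<bar>f x :: real\<bar> \<le> B"
  shows "\<bar>\<integral>x. f x \<partial>N\<bar> \<le> B"
proof -
  interpret N: prob_space N by fact
  show ?thesis
  proof (cases "integrable N f")
    case True
    have "\<bar>\<integral>x. f x \<partial>N\<bar> \<le> (\<integral>x. \<bar>f x\<bar> \<partial>N)" by (rule integral_abs_bound)
    also have "\<dots> \<le> (\<integral>x. B \<partial>N)" using True assms by (intro integral_mono) auto
    finally show ?thesis by (simp add: N.prob_space)
  next
    case False
    \<comment> \<open>The integral defaults to 0 here, and \<open>B\<close> is nonnegative because
      it bounds an absolute value.\<close>
    then show ?thesis using assms(2)[of undefined] by (simp add: not_integrable_integral_eq)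
  qed
qed

text \<open>Carrying \<open>x\<close> along turns the parameter-dependent integrand into one fixed
  function on the product space, integrated against the measurable kernel that sends
  \<open>x\<close> to the law of \<open>(x, y)\<close> with \<open>y\<close> drawn from
  \<open>L x\<close>.\<close>

lemma borel_measurable_kernel_integral:
  fixes f :: "'a \<Rightarrow> 'b \<Rightarrow> real"
  assumes f[measurable]: "(\<lambda>(x, y). f x y) \<in> borel_measurable (M \<Otimes>\<^sub>M N)"
    and L[measurable]: "L \<in> measurable M (subprob_algebra N)"
  shows "(\<lambda>x. \<integral>y. f x y \<partial>L x) \<in> borel_measurable M"
proof -
  note measurable_distr2[measurable]
  have "(\<lambda>x. integral\<^sup>L (distr (L x) (M \<Otimes>\<^sub>M N) (\<lambda>y. (x, y))) (\<lambda>(x, y). f x y)) \<in> borel_measurable M"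
    by measurable
  then show ?thesis
  proof (rule measurable_cong[THEN iffD1, rotated])
    fix x assume x: "x \<in> space M"
    have "sets (L x) = sets N" using L x by (rule subprob_measurableD)
    then have "Pair x \<in> measurable (L x) (M \<Otimes>\<^sub>M N)"
      using measurable_Pair1'[OF x, of N] measurable_cong_sets[of "L x" N] by blast
    from integral_distr[OF this f]
    show "integral\<^sup>L (distr (L x) (M \<Otimes>\<^sub>M N) (\<lambda>y. (x, y))) (\<lambda>(x, y). f x y) = (\<integral>y. f x y \<partial>L x)"
      by (simp only: prod.case)
  qed
qed

text \<open>The Markov property is given only for conditional probabilities of single sets. It
  determines the joint law of past and next state on rectangles, which form an intersection-stable
  generator, and hence the integral of every bounded measurable function.\<close>

lemma (in prob_space) markov_chain_integral:
  fixes K :: "real \<Rightarrow> real measure" and X :: "nat \<Rightarrow> 'a \<Rightarrow> real"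
    and g :: "(nat \<Rightarrow> real) \<times> real \<Rightarrow> real"
  assumes K: "K \<in> measurable half_line (prob_algebra half_line)"
    and X: "markov_chain M K X"
    and g[measurable]: "g \<in> borel_measurable (Pi\<^sub>M {..m} (\<lambda>_. half_line) \<Otimes>\<^sub>M half_line)"
    and B: "\<And>p. \<bar>g p\<bar> \<le> B"
  shows "(\<integral>\<omega>. g (\<lambda>i\<in>{..m}. X i \<omega>, X (Suc m) \<omega>) \<partial>M) = (\<integral>\<omega>. (\<integral>z. g (\<lambda>i\<in>{..m}. X i \<omega>, z) \<partial>K (X m \<omega>)) \<partial>M)"
proof -
  let ?P = "Pi\<^sub>M {..m} (\<lambda>_. half_line :: real measure)" and ?Q = "Pi\<^sub>M {..m} (\<lambda>_. half_line) \<Otimes>\<^sub>M (half_line :: real measure)"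
  define U where "U \<omega> = (\<lambda>i\<in>{..m}. X i \<omega>)" for \<omega>
  have X_meas[measurable]: "X n \<in> measurable M half_line" for n using X by (simp add: markov_chain_def)
  have U[measurable]: "U \<in> measurable M ?P" unfolding U_def[abs_def] by measurable
  have K_sub[measurable]: "K \<in> measurable half_line (subprob_algebra half_line)"
    using K by (rule measurable_prob_algebraD)
  have K_X: "prob_space (K (X n \<omega>))" "sets (K (X n \<omega>)) = sets half_line" if "\<omega> \<in> space M" for n \<omega>
    using measurable_space[OF K measurable_space[OF X_meas that]] by (auto simp: space_prob_algebra)
  have pair_U: "Pair (U \<omega>) \<in> measurable (K (X m \<omega>)) ?Q" if \<omega>: "\<omega> \<in> space M" for \<omega>
    using measurable_Pair1'[OF measurable_space[OF U \<omega>], of half_line]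
    by (simp add: measurable_cong_sets[OF K_X(2)[OF \<omega>] refl])
  \<comment> \<open>The joint law of the past and one kernel step, with the past frozen at
    \<open>U \<omega>\<close>; \<open>M \<bind> L\<close> is the law predicted by the
    kernel.\<close>
  define L where "L \<omega> = distr (K (X m \<omega>)) ?Q (Pair (U \<omega>))" for \<omega>
  have L[measurable]: "L \<in> measurable M (subprob_algebra ?Q)"
    unfolding L_def[abs_def] by (rule measurable_distr2[where M=half_line]) measurable
  have UX[measurable]: "(\<lambda>\<omega>. (U \<omega>, X (Suc m) \<omega>)) \<in> measurable M ?Q" by measurable
  have pastU: "U \<in> measurable (past M X m) ?P"
    unfolding past_def U_def[symmetric] using measurable_space[OF U]
    by (intro measurable_vimage_algebra1) auto
  have "distr M ?Q (\<lambda>\<omega>. (U \<omega>, X (Suc m) \<omega>)) = M \<bind> L"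
  proof (rule measure_eqI_generator_eq[OF Int_stable_pair_measure_generator[of ?P half_line], where \<Omega>="space ?P \<times> space half_line"
        and A="\<lambda>_. space ?P \<times> space half_line"])
    show "{a \<times> b |a b. a \<in> sets ?P \<and> b \<in> sets half_line} \<subseteq> Pow (space ?P \<times> space half_line)"
      by (rule pair_measure_closed)
    show "sets (distr M ?Q (\<lambda>\<omega>. (U \<omega>, X (Suc m) \<omega>))) = sigma_sets (space ?P \<times> space half_line) {a \<times> b |a b. a \<in> sets ?P \<and> b \<in> sets half_line}"
      by (simp add: sets_pair_measure)
    show "sets (M \<bind> L) = sigma_sets (space ?P \<times> space half_line) {a \<times> b |a b. a \<in> sets ?P \<and> b \<in> sets half_line}"
      by (subst sets_bind[where N="?Q"]) (auto simp: sets_pair_measure not_empty L_def)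
    show "range (\<lambda>_. space ?P \<times> space half_line) \<subseteq> {a \<times> b |a b. a \<in> sets ?P \<and> b \<in> sets half_line}"
      using sets.top[of ?P] sets.top[of "half_line :: real measure"] by blast
    show "(\<Union>_. space ?P \<times> space half_line) = space ?P \<times> space half_line" by simp
    show "emeasure (distr M ?Q (\<lambda>\<omega>. (U \<omega>, X (Suc m) \<omega>))) (space ?P \<times> space half_line) \<noteq> \<infinity>"
      using finite_measure.emeasure_finite[OF finite_measure_distr[OF UX]] by simp
    fix C assume "C \<in> {a \<times> b |a b. a \<in> sets ?P \<and> b \<in> sets half_line}"
    then obtain a b where C: "C = a \<times> b" and a[measurable]: "a \<in> sets ?P" and b[measurable]: "b \<in> sets half_line" by blast
    have C'[measurable]: "C \<in> sets ?Q" unfolding C by measurable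
    interpret S: finite_measure_subalgebra M "past M X m"
    proof
      show "subalgebra M (past M X m)"
        unfolding subalgebra_def past_def U_def[symmetric] using sets_image_in_sets[OF refl U] by simp
    qed
    \<comment> \<open>\<open>U\<close> generates the past, so \<open>A\<close> is a past event, over
      which the conditional expectation may be integrated.\<close>
    define A where "A = U -` a \<inter> space M"
    have A: "A \<in> sets (past M X m)"
      using measurable_sets[OF pastU a] by (simp add: A_def past_def)
    have [measurable]: "A \<in> sets M" unfolding A_def by measurable
    have AEc: "AE \<omega> in M. real_cond_exp M (past M X m) (\<lambda>\<omega>. indicator b (X (Suc m) \<omega>)) \<omega> = measure (K (X m \<omega>)) b"
      using X b by (simp add: markov_chain_def)
    have Kb: "(\<lambda>\<omega>. measure (K (X m \<omega>)) b) \<in> borel_measurable M" by measurable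
    have "emeasure (distr M ?Q (\<lambda>\<omega>. (U \<omega>, X (Suc m) \<omega>))) C = emeasure M (A \<inter> (X (Suc m) -` b \<inter> space M))"
      by (subst emeasure_distr) (auto simp: C A_def intro!: arg_cong[where f="emeasure M"])
    also have "\<dots> = ennreal (\<integral>\<omega>. indicator (A \<inter> (X (Suc m) -` b \<inter> space M)) \<omega> \<partial>M)"
      by (simp add: emeasure_eq_measure Int_absorb2)
    also have "(\<integral>\<omega>. indicator (A \<inter> (X (Suc m) -` b \<inter> space M)) \<omega> \<partial>M) = (\<integral>\<omega>\<in>A. indicator b (X (Suc m) \<omega>) \<partial>M)"
      unfolding set_lebesgue_integral_def by (intro Bochner_Integration.integral_cong) (auto simp: indicator_def)
    also have "\<dots> = (\<integral>\<omega>\<in>A. real_cond_exp M (past M X m) (\<lambda>\<omega>. indicator b (X (Suc m) \<omega>)) \<omega> \<partial>M)"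
      by (rule S.real_cond_exp_intA[OF _ A]) (rule integrable_const_bound[where B=1]; simp)
    also have "\<dots> = (\<integral>\<omega>\<in>A. measure (K (X m \<omega>)) b \<partial>M)"
      unfolding set_lebesgue_integral_def
      using AEc Kb by (intro integral_cong_AE) (auto intro: measurable_from_subalg[OF S.subalg])
    also have "ennreal \<dots> = (\<integral>\<^sup>+\<omega>. ennreal (indicator A \<omega> *\<^sub>R measure (K (X m \<omega>)) b) \<partial>M)"
      unfolding set_lebesgue_integral_def
      by (rule nn_integral_eq_integral[symmetric])
        (auto intro!: integrable_const_bound[where B=1] AE_I2 simp: indicator_def prob_space.prob_le_1 K_X)
    also have "\<dots> = (\<integral>\<^sup>+\<omega>. emeasure (L \<omega>) C \<partial>M)"
    proof (rule nn_integral_cong)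
      fix \<omega> assume \<omega>: "\<omega> \<in> space M"
      interpret k: prob_space "K (X m \<omega>)" using \<omega> by (rule K_X)
      have [measurable_cong]: "sets (K (X m \<omega>)) = sets half_line" using \<omega> by (rule K_X)
      have sp: "space (K (X m \<omega>)) = {0..}" using sets_eq_imp_space_eq[OF K_X(2)[OF \<omega>, of m]] by (simp add: space_restrict_space)
      have "emeasure (L \<omega>) C = emeasure (K (X m \<omega>)) (Pair (U \<omega>) -` C \<inter> space (K (X m \<omega>)))"
        unfolding L_def by (intro emeasure_distr pair_U \<omega> C')
      also have "Pair (U \<omega>) -` C \<inter> space (K (X m \<omega>)) = (if \<omega> \<in> A then b else {})"
        using \<omega> sets.sets_into_space[OF b] by (auto simp: C A_def sp space_restrict_space)
      finally show "ennreal (indicator A \<omega> *\<^sub>R measure (K (X m \<omega>)) b) = emeasure (L \<omega>) C"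
        by (simp add: k.emeasure_eq_measure)
    qed
    also have "\<dots> = emeasure (M \<bind> L) C"
      by (rule emeasure_bind[symmetric, OF not_empty L C'])
    finally show "emeasure (distr M ?Q (\<lambda>\<omega>. (U \<omega>, X (Suc m) \<omega>))) C = emeasure (M \<bind> L) C" .
  qed
  then have "(\<integral>p. g p \<partial>distr M ?Q (\<lambda>\<omega>. (U \<omega>, X (Suc m) \<omega>))) = (\<integral>p. g p \<partial>(M \<bind> L))" by simp
  also have "\<dots> = (\<integral>N. (\<integral>p. g p \<partial>N) \<partial>distr M (subprob_algebra ?Q) L)"
    unfolding bind_nonempty''[OF L not_empty]
  proof (rule integral_join[where B'=1])
    show "finite_measure (distr M (subprob_algebra ?Q) L)" using L by (rule finite_measure_distr)
    show "AE M' in distr M (subprob_algebra ?Q) L. emeasure M' (space M') \<le> ennreal 1"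
      by (rule AE_I2) (auto simp: space_subprob_algebra intro: subprob_space.subprob_emeasure_le_1)
  qed (use B in auto)
  also have "\<dots> = (\<integral>\<omega>. (\<integral>p. g p \<partial>L \<omega>) \<partial>M)" by (rule integral_distr) measurable
  also have "\<dots> = (\<integral>\<omega>. (\<integral>z. g (U \<omega>, z) \<partial>K (X m \<omega>)) \<partial>M)"
  proof (rule Bochner_Integration.integral_cong[OF refl])
    fix \<omega> assume \<omega>: "\<omega> \<in> space M"
    show "(\<integral>p. g p \<partial>L \<omega>) = (\<integral>z. g (U \<omega>, z) \<partial>K (X m \<omega>))"
      unfolding L_def by (intro integral_distr pair_U \<omega> g)
  qed
  also have "(\<integral>p. g p \<partial>distr M ?Q (\<lambda>\<omega>. (U \<omega>, X (Suc m) \<omega>))) = (\<integral>\<omega>. g (U \<omega>, X (Suc m) \<omega>) \<partial>M)"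
    by (rule integral_distr) measurable
  finally show ?thesis unfolding U_def .
qed

text \<open>
  A path \<open>p\<close> charged by the tail chain is positive up to some time and \<open>0\<close> from then on, because
  \<open>0\<close> is absorbing for the tail chain. \<open>path_conv Z W m P p\<close> is the mode in which paths \<open>P n\<close>
  approach such a \<open>p\<close>: positive coordinates converge, the coordinate at which \<open>p\<close> first vanishes
  obeys \<open>Z\<close>, and the later ones obey \<open>W\<close>. The four claims differ only in the choice of \<open>Z\<close> and
  \<open>W\<close> and of the functionals.
\<close>

fun path_conv :: "((nat \<Rightarrow> real) \<Rightarrow> bool) \<Rightarrow> ((nat \<Rightarrow> real) \<Rightarrow> bool) \<Rightarrow> nat \<Rightarrow> (nat \<Rightarrow> nat \<Rightarrow> real) \<Rightarrow> (nat \<Rightarrow> real) \<Rightarrow> bool" where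
  "path_conv Z W 0 P p \<longleftrightarrow> 0 < p 0 \<and> (\<lambda>n. P n 0) \<longlonglongrightarrow> p 0"
| "path_conv Z W (Suc m) P p \<longleftrightarrow> path_conv Z W m P p \<and>
     (if 0 < p m
      then 0 < p (Suc m) \<and> (\<lambda>n. P n (Suc m)) \<longlonglongrightarrow> p (Suc m) \<or> p (Suc m) = 0 \<and> Z (\<lambda>n. P n (Suc m))
      else p (Suc m) = 0 \<and> W (\<lambda>n. P n (Suc m)))"

lemma path_conv_cong:
  "(\<And>n i. i \<le> m \<Longrightarrow> P n i = P' n i) \<Longrightarrow> (\<And>i. i \<le> m \<Longrightarrow> p i = p' i) \<Longrightarrow>
    path_conv Z W m P p \<longleftrightarrow> path_conv Z W m P' p'"
  by (induction m) auto

definition tail_path :: "nat \<Rightarrow> real \<Rightarrow> (nat \<Rightarrow> real) \<Rightarrow> nat \<Rightarrow> real" where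
  "tail_path m x \<xi> = (\<lambda>n\<in>{..m}. x * (\<Prod>i\<in>{1..n}. \<xi> i))"

text \<open>The integral against \<open>nu_star\<close> written on real paths and as an iterated
  integral, so that the last step can be split off. \<open>enn2real\<close> sends the point infinity
  to 0, which is harmless where \<open>\<nu>\<close> does not charge it.\<close>

definition tail_integral :: "ennreal measure \<Rightarrow> real measure \<Rightarrow> nat \<Rightarrow> ((nat \<Rightarrow> real) \<Rightarrow> real) \<Rightarrow> real" where
  "tail_integral \<nu> G m F = (\<integral>e. (\<integral>\<xi>. F (tail_path m (enn2real e) \<xi>) \<partial>Pi\<^sub>M {1..m} (\<lambda>_. G)) \<partial>\<nu>)"

section \<open>Measurability of maps into the half-line\<close>

lemma divide_measurable_half_line[measurable]:
  "0 < c \<Longrightarrow> f \<in> measurable N half_line \<Longrightarrow> (\<lambda>x. f x / c :: real) \<in> measurable N half_line"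
  by (auto simp: measurable_restrict_space2_iff Pi_iff)

lemma mult_measurable_half_line[measurable]:
  assumes "f \<in> measurable N half_line" "g \<in> measurable N half_line"
  shows "(\<lambda>x. f x * g x :: real) \<in> measurable N half_line"
  using assms by (auto simp: measurable_restrict_space2_iff Pi_iff)

lemma prod_measurable_half_line[measurable]:
  assumes "\<And>i. i \<in> I \<Longrightarrow> f i \<in> measurable N half_line"
  shows "(\<lambda>x. \<Prod>i\<in>I. f i x :: real) \<in> measurable N half_line"
  using assms by (auto simp: measurable_restrict_space2_iff Pi_iff intro!: prod_nonneg borel_measurable_prod)

lemma borel_imp_half_line[measurable (raw)]:
  "f \<in> measurable N half_line \<Longrightarrow> f \<in> borel_measurable N" for f :: "'a \<Rightarrow> real"
  by (simp add: measurable_restrict_space2_iff)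

text \<open>
  \<open>start\<close>, \<open>enter\<close> and \<open>stay\<close> pass to the limit in the initial law, in one step from a positive state,
  and in one step from a state that has become negligible.
\<close>

locale scaled_chain = prob_space M for M :: "'w measure" +
  fixes G :: "real measure" and K :: "real \<Rightarrow> real measure" and X :: "nat \<Rightarrow> 'w \<Rightarrow> real"
    and \<nu> :: "ennreal measure" and t c :: "nat \<Rightarrow> real"
    and Z W :: "(nat \<Rightarrow> real) \<Rightarrow> bool"
  assumes G: "G \<in> space (prob_algebra half_line)"
    and K: "K \<in> measurable half_line (prob_algebra half_line)"
    and X: "markov_chain M K X"
    and c: "\<And>n. 0 < c n"
    and start: "\<And>(f :: nat \<Rightarrow> real \<Rightarrow> real) g B d. (\<And>n. f n \<in> borel_measurable half_line) \<Longrightarrow> g \<in> borel_measurable half_line \<Longrightarrow>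
      (\<And>n x. \<bar>f n x\<bar> \<le> B) \<Longrightarrow> 0 < d \<Longrightarrow> (\<And>n x. x < d \<Longrightarrow> f n x = 0) \<Longrightarrow> (\<And>x. x < d \<Longrightarrow> g x = 0) \<Longrightarrow>
      (\<And>w w'. (\<And>n. 0 \<le> w n) \<Longrightarrow> w \<longlonglongrightarrow> w' \<Longrightarrow> 0 < w' \<Longrightarrow> (\<lambda>n. f n (w n)) \<longlonglongrightarrow> g w') \<Longrightarrow>
      (\<lambda>n. t n * (\<integral>\<omega>. f n (X 0 \<omega> / c n) \<partial>M)) \<longlonglongrightarrow> (\<integral>e. g (enn2real e) \<partial>\<nu>)"
    and enter: "\<And>(f :: nat \<Rightarrow> real \<Rightarrow> real) g B u u'. (\<And>n. f n \<in> borel_measurable half_line) \<Longrightarrow> g \<in> borel_measurable half_line \<Longrightarrow>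
      (\<And>n x. \<bar>f n x\<bar> \<le> B) \<Longrightarrow> (\<And>n. 0 \<le> u n) \<Longrightarrow> u \<longlonglongrightarrow> u' \<Longrightarrow> 0 < u' \<Longrightarrow>
      (\<And>w w'. (\<And>n. 0 \<le> w n) \<Longrightarrow> w \<longlonglongrightarrow> w' \<Longrightarrow> 0 < w' \<Longrightarrow> (\<lambda>n. f n (w n)) \<longlonglongrightarrow> g w') \<Longrightarrow>
      (\<And>w. (\<And>n. 0 \<le> w n) \<Longrightarrow> Z w \<Longrightarrow> (\<lambda>n. f n (w n)) \<longlonglongrightarrow> g 0) \<Longrightarrow>
      (\<lambda>n. \<integral>x. f n (x / c n) \<partial>K (c n * u n)) \<longlonglongrightarrow> (\<integral>\<xi>. g (u' * \<xi>) \<partial>G)"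
    and stay: "\<And>(f :: nat \<Rightarrow> real \<Rightarrow> real) B u L. (\<And>n. f n \<in> borel_measurable half_line) \<Longrightarrow>
      (\<And>n x. \<bar>f n x\<bar> \<le> B) \<Longrightarrow> (\<And>n. 0 \<le> u n) \<Longrightarrow> Z u \<or> W u \<Longrightarrow>
      (\<And>w. (\<And>n. 0 \<le> w n) \<Longrightarrow> W w \<Longrightarrow> (\<lambda>n. f n (w n)) \<longlonglongrightarrow> L) \<Longrightarrow>
      (\<lambda>n. \<integral>x. f n (x / c n) \<partial>K (c n * u n)) \<longlonglongrightarrow> L"
begin

abbreviation paths :: "nat \<Rightarrow> (nat \<Rightarrow> real) measure" where
  "paths m \<equiv> Pi\<^sub>M {..m} (\<lambda>_. half_line)"

lemma path_conv_last:
  assumes "path_conv Z W m P p" "\<And>n. P n \<in> space (paths m)"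
  shows "0 < p m \<and> (\<lambda>n. P n m) \<longlonglongrightarrow> p m \<or> p m = 0 \<and> (Z (\<lambda>n. P n m) \<or> W (\<lambda>n. P n m))"
  using assms(1) by (cases m) (auto split: if_splits)

lemma in_pathsD: "p \<in> space (paths m) \<Longrightarrow> i \<le> m \<Longrightarrow> 0 \<le> p i"
  by (auto simp: space_PiM space_restrict_space PiE_iff)

lemma fun_upd_paths: "p \<in> space (paths m) \<Longrightarrow> 0 \<le> x \<Longrightarrow> p(Suc m := x) \<in> space (paths (Suc m))"
  by (auto simp: space_PiM space_restrict_space PiE_iff extensional_def)

text \<open>
  Induction on \<open>m\<close>, integrating out the last coordinate. The functional has to vary with \<open>n\<close>, since
  integrating it against the scaled kernel produces such a family.
\<close>

lemma scaled_path_integral_tendsto: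
  fixes F :: "nat \<Rightarrow> (nat \<Rightarrow> real) \<Rightarrow> real" and F' :: "(nat \<Rightarrow> real) \<Rightarrow> real"
  assumes "\<And>n. F n \<in> borel_measurable (paths m)" "F' \<in> borel_measurable (paths m)"
    and "\<And>n p. \<bar>F n p\<bar> \<le> B" "\<And>p. \<bar>F' p\<bar> \<le> B"
    and "0 < d" "\<And>n p. p 0 < d \<Longrightarrow> F n p = 0" "\<And>p. p 0 < d \<Longrightarrow> F' p = 0"
    and "\<And>P p. (\<And>n. P n \<in> space (paths m)) \<Longrightarrow> p \<in> space (paths m) \<Longrightarrow> path_conv Z W m P p \<Longrightarrow>
      (\<lambda>n. F n (P n)) \<longlonglongrightarrow> F' p"
  shows "(\<lambda>n. t n * (\<integral>\<omega>. F n (\<lambda>i\<in>{..m}. X i \<omega> / c n) \<partial>M)) \<longlonglongrightarrow> tail_integral \<nu> G m F'"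
  using assms
proof (induction m arbitrary: F F')
  case 0
  note [measurable] = "0.prems"(1,2)
  let ?r = "\<lambda>x. \<lambda>i\<in>{..0::nat}. x :: real"
  have r: "?r \<in> measurable half_line (paths 0)" by measurable
  have "(\<lambda>n. t n * (\<integral>\<omega>. F n (?r (X 0 \<omega> / c n)) \<partial>M)) \<longlonglongrightarrow> (\<integral>e. F' (?r (enn2real e)) \<partial>\<nu>)"
  proof (rule start[where B=B])
    show "(\<lambda>x. F n (?r x)) \<in> borel_measurable half_line" for n
      by (rule measurable_compose[OF r "0.prems"(1)])
    show "(\<lambda>x. F' (?r x)) \<in> borel_measurable half_line"
      by (rule measurable_compose[OF r "0.prems"(2)])
    fix w w' assume w: "\<And>n. 0 \<le> w n" "w \<longlonglongrightarrow> w'" "0 < (w'::real)"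
    then show "(\<lambda>n. F n (?r (w n))) \<longlonglongrightarrow> F' (?r w')"
      by (intro "0.prems"(8)) (auto simp: space_PiM space_restrict_space split: if_splits)
  qed (use "0.prems" in auto)
  moreover have "?r (X 0 \<omega> / c n) = (\<lambda>i\<in>{..0}. X i \<omega> / c n)" for \<omega> n by auto
  moreover have "tail_integral \<nu> G 0 F' = (\<integral>e. F' (?r (enn2real e)) \<partial>\<nu>)"
  proof -
    interpret E: prob_space "Pi\<^sub>M {} (\<lambda>_::nat. G)" by (rule prob_space_PiM) auto
    have "tail_path 0 x \<xi> = ?r x" for x \<xi> by (auto simp: tail_path_def)
    then show ?thesis by (simp add: tail_integral_def E.prob_space)
  qed
  ultimately show ?case by (simp only:)
next
  case (Suc m)
  note F[measurable] = Suc.prems(1) and F'[measurable] = Suc.prems(2)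
  have X_meas[measurable]: "X n \<in> measurable M half_line" for n using X by (simp add: markov_chain_def)
  have K_sub[measurable]: "K \<in> measurable half_line (subprob_algebra half_line)"
    using K by (rule measurable_prob_algebraD)
  have G_prob: "prob_space G" and G_sets[measurable_cong]: "sets G = sets half_line"
    using G by (auto simp: space_prob_algebra)
  have G_space: "space G = {0..}" using sets_eq_imp_space_eq[OF G_sets] by (simp add: space_restrict_space)
  have K_prob: "prob_space (K x)" and K_sets: "sets (K x) = sets half_line" if "0 \<le> x" for x
    using measurable_space[OF K, of x] that by (auto simp: space_prob_algebra space_restrict_space)
  have upd[measurable]: "(\<lambda>x. (f x)(Suc m := g x)) \<in> measurable N (paths (Suc m))"
    if [measurable]: "f \<in> measurable N (paths m)" "g \<in> measurable N half_line" for f g and N :: "'z measure"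
    using measurable_compose[OF measurable_Pair[OF that] measurable_add_dim[where i="Suc m" and I="{..m}" and M="\<lambda>_. half_line"]]
    by (simp add: atMost_Suc)
  \<comment> \<open>\<open>\<bar>p m\<bar>\<close> keeps the state of the kernel nonnegative for
    every \<open>p\<close>, including those outside the path space, because the bound on the
    functional is demanded for all \<open>p\<close>.\<close>
  define H where "H n p = (\<integral>z. F n (p(Suc m := z / c n)) \<partial>K (c n * \<bar>p m\<bar>))" for n p
  define H' where "H' p = (\<integral>\<xi>. F' (p(Suc m := p m * \<xi>)) \<partial>G)" for p
  have "(\<lambda>n. t n * (\<integral>\<omega>. H n (\<lambda>i\<in>{..m}. X i \<omega> / c n) \<partial>M)) \<longlonglongrightarrow> tail_integral \<nu> G m H'"
  proof (rule Suc.IH)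
    fix n
    have [measurable]: "(\<lambda>p. c n * \<bar>p m\<bar>) \<in> measurable (paths m) half_line"
      using c[of n] by (auto simp: measurable_restrict_space2_iff Pi_iff)
    show "H n \<in> borel_measurable (paths m)"
      unfolding H_def[abs_def] using c[of n]
      by (intro borel_measurable_kernel_integral[where N=half_line]) measurable
    show "\<bar>H n p\<bar> \<le> B" for p
      unfolding H_def using c[of n] Suc.prems(3) by (intro integral_abs_le_bound K_prob) auto
    show "H n p = 0" if "p 0 < d" for p using that Suc.prems(6) by (simp add: H_def)
  next
    show "H' \<in> borel_measurable (paths m)"
      unfolding H'_def[abs_def]
    proof (intro borel_measurable_kernel_integral[where N=half_line])
      show "(\<lambda>p. G) \<in> measurable (paths m) (subprob_algebra half_line)"
        using G by (auto simp: space_prob_algebra space_subprob_algebra prob_space_imp_subprob_space)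
    qed measurable
    show "\<bar>H' p\<bar> \<le> B" for p
      unfolding H'_def using Suc.prems(4) by (intro integral_abs_le_bound G_prob)
    show "H' p = 0" if "p 0 < d" for p using that Suc.prems(7) by (simp add: H'_def)
  next
    fix P p assume P: "\<And>n. P n \<in> space (paths m)" and p: "p \<in> space (paths m)" and conv: "path_conv Z W m P p"
    have Pm: "0 \<le> P n m" for n using P by (rule in_pathsD) simp
    define f where "f n w = F n ((P n)(Suc m := w))" for n w
    have [measurable]: "(\<lambda>_. P n) \<in> measurable half_line (paths m)" "(\<lambda>_. p) \<in> measurable half_line (paths m)" for n
      using P p by auto
    have f_meas: "f n \<in> borel_measurable half_line" for n unfolding f_def[abs_def] by measurable
    have H_eq: "H n (P n) = (\<integral>z. f n (z / c n) \<partial>K (c n * P n m))" for n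
      using Pm by (simp add: H_def f_def)
    have f_lim: "(\<lambda>n. f n (w n)) \<longlonglongrightarrow> F' (p(Suc m := w'))"
      if "\<And>n. 0 \<le> w n" "0 \<le> w'" "if 0 < p m then 0 < w' \<and> w \<longlonglongrightarrow> w' \<or> w' = 0 \<and> Z w else w' = 0 \<and> W w" for w w'
    proof -
      have "path_conv Z W m (\<lambda>n. (P n)(Suc m := w n)) (p(Suc m := w')) \<longleftrightarrow> path_conv Z W m P p"
        by (rule path_conv_cong) auto
      then have "path_conv Z W (Suc m) (\<lambda>n. (P n)(Suc m := w n)) (p(Suc m := w'))"
        using conv that(3) by simp
      then show ?thesis
        unfolding f_def using fun_upd_paths[OF P that(1)] fun_upd_paths[OF p that(2)] by (intro Suc.prems(8))
    qed
    show "(\<lambda>n. H n (P n)) \<longlonglongrightarrow> H' p"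
      using path_conv_last[OF conv P]
    proof (elim disjE conjE)
      assume pm: "0 < p m" "(\<lambda>n. P n m) \<longlonglongrightarrow> p m"
      have "(\<lambda>n. \<integral>z. f n (z / c n) \<partial>K (c n * P n m)) \<longlonglongrightarrow> (\<integral>\<xi>. F' (p(Suc m := p m * \<xi>)) \<partial>G)"
      proof (rule enter[where B=B and g="\<lambda>w. F' (p(Suc m := w))"])
        show "(\<lambda>w. F' (p(Suc m := w))) \<in> borel_measurable half_line" by measurable
      qed (use pm f_meas Pm f_lim Suc.prems(3) in \<open>auto simp: f_def\<close>)
      then show ?thesis by (simp add: H_eq H'_def)
    next
      have *: ?thesis if pm: "p m = 0" and ZW: "Z (\<lambda>n. P n m) \<or> W (\<lambda>n. P n m)"
      proof -
        interpret G: prob_space G by fact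
        \<comment> \<open>The tail chain stays at 0: with \<open>p m = 0\<close> the integrand of
          \<open>H' p\<close> is the constant \<open>F' (p(Suc m := 0))\<close>.\<close>
        have "(\<lambda>n. \<integral>z. f n (z / c n) \<partial>K (c n * P n m)) \<longlonglongrightarrow> F' (p(Suc m := 0))"
          by (rule stay[where B=B]) (use pm ZW f_meas Pm f_lim Suc.prems(3) in \<open>auto simp: f_def\<close>)
        then show ?thesis by (simp add: H_eq H'_def pm G.prob_space)
      qed
      { assume "p m = 0" "Z (\<lambda>n. P n m)" then show ?thesis using * by blast }
      { assume "p m = 0" "W (\<lambda>n. P n m)" then show ?thesis using * by blast }
    qed
  qed (use Suc.prems in auto)
  moreover have "(\<integral>\<omega>. F n (\<lambda>i\<in>{..Suc m}. X i \<omega> / c n) \<partial>M) = (\<integral>\<omega>. H n (\<lambda>i\<in>{..m}. X i \<omega> / c n) \<partial>M)" for n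
  proof -
    \<comment> \<open>The Markov identity concerns the unscaled chain, so the division by
      \<open>c n\<close> is made part of the functional.\<close>
    let ?g = "\<lambda>(q, z). F n (\<lambda>i\<in>{..Suc m}. (q(Suc m := z)) i / c n)"
    have cn: "0 < c n" by (rule c)
    have "?g \<in> borel_measurable (paths m \<Otimes>\<^sub>M half_line)"
    proof -
      have "(\<lambda>x. \<lambda>i\<in>{..Suc m}. ((fst x)(Suc m := snd x)) i / c n) \<in> measurable (paths m \<Otimes>\<^sub>M half_line) (paths (Suc m))"
      proof (rule measurable_restrict)
        fix i assume i: "i \<in> {..Suc m}"
        have "(\<lambda>x. ((fst x)(Suc m := snd x)) i) \<in> measurable (paths m \<Otimes>\<^sub>M half_line) half_line"
          by (rule measurable_compose[OF upd measurable_component_singleton[OF i]]) measurable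
        then show "(\<lambda>x. ((fst x)(Suc m := snd x)) i / c n) \<in> measurable (paths m \<Otimes>\<^sub>M half_line) half_line"
          by (rule divide_measurable_half_line[OF cn])
      qed
      from measurable_compose[OF this F[of n]] show ?thesis by (simp only: case_prod_beta')
    qed
    then have "(\<integral>\<omega>. ?g (\<lambda>i\<in>{..m}. X i \<omega>, X (Suc m) \<omega>) \<partial>M) = (\<integral>\<omega>. (\<integral>z. ?g (\<lambda>i\<in>{..m}. X i \<omega>, z) \<partial>K (X m \<omega>)) \<partial>M)"
      by (rule markov_chain_integral[OF K X]) (use Suc.prems(3) in \<open>auto split: prod.split\<close>)
    moreover have "?g (\<lambda>i\<in>{..m}. X i \<omega>, X (Suc m) \<omega>) = F n (\<lambda>i\<in>{..Suc m}. X i \<omega> / c n)" for \<omega>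
      by (auto intro!: arg_cong[where f="F n"])
    moreover have "(\<integral>z. ?g (\<lambda>i\<in>{..m}. X i \<omega>, z) \<partial>K (X m \<omega>)) = H n (\<lambda>i\<in>{..m}. X i \<omega> / c n)" if "\<omega> \<in> space M" for \<omega>
    proof -
      have "0 \<le> X m \<omega>" using measurable_space[OF X_meas that] by (simp add: space_restrict_space)
      then have X_eq: "c n * \<bar>(\<lambda>i\<in>{..m}. X i \<omega> / c n) m\<bar> = X m \<omega>" using cn by simp
      have eq: "(\<lambda>i\<in>{..Suc m}. ((\<lambda>i\<in>{..m}. X i \<omega>)(Suc m := z)) i / c n) = (\<lambda>i\<in>{..m}. X i \<omega> / c n)(Suc m := z / c n)" for z
        by (auto simp: fun_eq_iff)
      show ?thesis unfolding H_def prod.case eq X_eq ..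
    qed
    ultimately show ?thesis by (simp cong: Bochner_Integration.integral_cong)
  qed
  moreover have "tail_integral \<nu> G (Suc m) F' = tail_integral \<nu> G m H'"
  proof -
    interpret G: prob_space G by fact
    interpret product_sigma_finite "\<lambda>_::nat. G" by standard
    interpret P: prob_space "Pi\<^sub>M {1..Suc m} (\<lambda>_. G)" by (rule prob_space_PiM) (rule G_prob)
    have "(\<integral>\<xi>. F' (tail_path (Suc m) x \<xi>) \<partial>Pi\<^sub>M {1..Suc m} (\<lambda>_. G)) = (\<integral>\<xi>. H' (tail_path m x \<xi>) \<partial>Pi\<^sub>M {1..m} (\<lambda>_. G))"
      if x: "0 \<le> x" for x
    proof -
      have [measurable]: "(\<lambda>_. x) \<in> measurable N half_line" for N :: "'z measure" using x by (simp add: space_restrict_space)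
      have PG: "measurable (Pi\<^sub>M {1..Suc m} (\<lambda>_. G)) N = measurable (Pi\<^sub>M {1..Suc m} (\<lambda>_. half_line)) N" for N :: "'z measure"
        by (intro measurable_cong_sets sets_PiM_cong refl) (rule G_sets)
      have tp: "tail_path (Suc m) x \<in> measurable (Pi\<^sub>M {1..Suc m} (\<lambda>_. G)) (paths (Suc m))"
        unfolding tail_path_def[abs_def] PG
        by (intro measurable_restrict mult_measurable_half_line prod_measurable_half_line) auto
      have "integrable (Pi\<^sub>M {1..Suc m} (\<lambda>_. G)) (\<lambda>\<xi>. F' (tail_path (Suc m) x \<xi>))"
        using measurable_compose[OF tp F'] Suc.prems(4) by (intro P.integrable_const_bound[where B=B]) auto
      then have "(\<integral>\<xi>. F' (tail_path (Suc m) x \<xi>) \<partial>Pi\<^sub>M {1..Suc m} (\<lambda>_. G)) =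
        (\<integral>\<xi>. \<integral>z. F' (tail_path (Suc m) x (\<xi>(Suc m := z))) \<partial>G \<partial>Pi\<^sub>M {1..m} (\<lambda>_. G))"
        using product_integral_insert[of "{1..m}" "Suc m" "\<lambda>\<xi>. F' (tail_path (Suc m) x \<xi>)"]
        by (simp add: atLeastAtMostSuc_conv)
      moreover have "tail_path (Suc m) x (\<xi>(Suc m := z)) = (tail_path m x \<xi>)(Suc m := tail_path m x \<xi> m * z)" for \<xi> z
      proof -
        have "(\<Prod>i\<in>{1..n}. (\<xi>(Suc m := z)) i) = (\<Prod>i\<in>{1..n}. \<xi> i)" if "n \<le> m" for n
          using that by (intro prod.cong) auto
        then show ?thesis by (auto simp: tail_path_def fun_eq_iff le_Suc_eq)
      qed
      ultimately show ?thesis by (simp add: H'_def)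
    qed
    then show ?thesis by (simp add: tail_integral_def)
  qed
  ultimately show ?case by (simp only:)
qed

end

section \<open>Vague convergence of the initial law\<close>

lemma prob_space_density_normalized:
  fixes h :: "'a \<Rightarrow> real"
  assumes h: "integrable N h" "\<And>x. 0 \<le> h x" and a: "0 < a" "(\<integral>x. h x \<partial>N) = a"
  shows "prob_space (density N (\<lambda>x. ennreal (h x / a)))"
proof
  have [measurable]: "h \<in> borel_measurable N" using h by simp
  have "emeasure (density N (\<lambda>x. ennreal (h x / a))) (space (density N (\<lambda>x. ennreal (h x / a)))) = (\<integral>\<^sup>+x. ennreal (h x / a) \<partial>N)"
    by (simp add: emeasure_density cong: nn_integral_cong)
  also have "\<dots> = ennreal (\<integral>x. h x / a \<partial>N)"
    using h a by (intro nn_integral_eq_integral) auto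
  also have "\<dots> = 1" using a by simp
  finally show "emeasure (density N (\<lambda>x. ennreal (h x / a))) (space (density N (\<lambda>x. ennreal (h x / a)))) = 1" .
qed

lemma enn2real_half_line[measurable]: "enn2real \<in> measurable borel half_line"
  by (simp add: measurable_restrict_space2_iff)

lemma max_half_line[measurable]: "(\<lambda>w. max 0 w :: real) \<in> measurable borel half_line"
  by (auto simp: measurable_restrict_space2_iff)

text \<open>
  The infinite limit measure is reduced to weak convergence by normalizing with a continuous density \<open>hk\<close>
  that is \<open>1\<close> above \<open>d\<close> and \<open>0\<close> near the origin.
\<close>

lemma (in prob_space) vague_imp_tail_integral_tendsto:
  fixes \<nu> :: "ennreal measure" and Y :: "'a \<Rightarrow> real" and f :: "nat \<Rightarrow> real \<Rightarrow> real"
  assumes Y[measurable]: "Y \<in> measurable M half_line" and c: "\<And>n. 0 < c n"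
    and \<nu>_meas: "(\<lambda>e. e) \<in> measurable \<nu> borel"
    and \<nu>_fin: "\<And>d. 0 < d \<Longrightarrow> emeasure \<nu> {e\<in>space \<nu>. ennreal d \<le> e} < \<infinity>"
    and \<nu>_pos: "\<And>d. 0 < d \<Longrightarrow> 0 < emeasure \<nu> {e\<in>space \<nu>. ennreal d \<le> e}"
    and \<nu>_top: "AE e in \<nu>. e < top"
    and vague: "\<And>h :: ennreal \<Rightarrow> real. continuous_on UNIV h \<Longrightarrow> (\<And>e. 0 \<le> h e) \<Longrightarrow>
      (\<exists>d>0. \<forall>e<ennreal d. h e = 0) \<Longrightarrow>
      (\<lambda>n. t n * (\<integral>\<omega>. h (ennreal (Y \<omega> / c n)) \<partial>M)) \<longlonglongrightarrow> (\<integral>e. h e \<partial>\<nu>)"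
    and f[measurable]: "\<And>n. f n \<in> borel_measurable half_line" and g[measurable]: "g \<in> borel_measurable half_line"
    and B: "\<And>n x. \<bar>f n x\<bar> \<le> B" and d: "0 < d"
    and f0: "\<And>n x. x < d \<Longrightarrow> f n x = 0" and g0: "\<And>x. x < d \<Longrightarrow> g x = 0"
    and fg: "\<And>w w'. (\<And>n. 0 \<le> w n) \<Longrightarrow> w \<longlonglongrightarrow> w' \<Longrightarrow> 0 < w' \<Longrightarrow> (\<lambda>n. f n (w n)) \<longlonglongrightarrow> g w'"
  shows "(\<lambda>n. t n * (\<integral>\<omega>. f n (Y \<omega> / c n) \<partial>M)) \<longlonglongrightarrow> (\<integral>e. g (enn2real e) \<partial>\<nu>)"
proof -
  note \<nu>_meas[measurable]
  \<comment> \<open>The linear ramp from 0 at \<open>d / 2\<close> to 1 at \<open>d\<close>.\<close>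
  define k where "k w = max 0 (min 1 (2 * w / d - 1))" for w :: real
  define hk where "hk e = k (enn2real (min e (ennreal d)))" for e :: ennreal
  have k: "0 \<le> k w" "k w \<le> 1" for w by (auto simp: k_def)
  have k1: "k w = 1" if "d \<le> w" for w using that d by (auto simp: k_def field_simps)
  have k0: "k w = 0" if "w < d / 2" for w using that d by (auto simp: k_def field_simps)
  have "continuous_on {0..} k" unfolding k_def by (intro continuous_intros) (use d in auto)
  then have hk_cont: "continuous_on UNIV hk" unfolding hk_def using d by (intro continuous_extension_to_infinity) auto
  have [measurable]: "k \<in> borel_measurable borel" unfolding k_def by measurable
  have [measurable]: "hk \<in> borel_measurable borel" using hk_cont by (rule borel_measurable_continuous_onI)
  have hk_bd: "0 \<le> hk e" "hk e \<le> 1" for e by (simp_all add: hk_def k)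
  have hk0: "hk e = 0" if "e < ennreal (d / 2)" for e
  proof -
    have "e \<le> ennreal d" using that d by (metis ennreal_leI field_sum_of_halves less_add_same_cancel1 less_imp_le half_gt_zero order_trans)
    moreover have "enn2real e < d / 2" using that d by (cases e) (auto simp: ennreal_less_iff)
    ultimately show ?thesis by (simp add: hk_def k0 min_def)
  qed
  have hk1: "hk e = 1" if "ennreal d \<le> e" for e
    using that d by (simp add: hk_def k1 min_def)
  have hk_k: "hk (ennreal w) = k w" if "0 \<le> w" for w
  proof (cases "w \<le> d")
    case True
    then show ?thesis using that by (simp add: hk_def min_def ennreal_leI)
  next
    case False
    then have "ennreal d \<le> ennreal w" by (intro ennreal_leI) simp
    then show ?thesis using False by (simp add: hk1 k1)
  qed
  have Y_nonneg: "0 \<le> Y \<omega>" if "\<omega> \<in> space M" for \<omega> using measurable_space[OF Y that] by (simp add: space_restrict_space)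
  have Yc[measurable]: "(\<lambda>\<omega>. Y \<omega> / c n) \<in> measurable M half_line" for n using c by measurable
  have Yc0: "0 \<le> Y \<omega> / c n" if "\<omega> \<in> space M" for \<omega> n using Y_nonneg[OF that] c[of n] by simp
  define a where "a n = (\<integral>\<omega>. k (Y \<omega> / c n) \<partial>M)" for n
  define a' where "a' = (\<integral>e. hk e \<partial>\<nu>)"
  have hk_int: "integrable \<nu> hk"
  proof (rule Bochner_Integration.integrable_bound)
    show "integrable \<nu> (\<lambda>e. indicator {e\<in>space \<nu>. ennreal (d / 2) \<le> e} e :: real)"
      using \<nu>_fin[of "d / 2"] d by (intro integrable_real_indicator) auto
    show "AE e in \<nu>. norm (hk e) \<le> norm (indicator {e\<in>space \<nu>. ennreal (d / 2) \<le> e} e :: real)"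
      by (rule AE_I2) (auto simp: hk_bd indicator_def not_le hk0)
  qed simp
  have a'_pos: "0 < a'"
  proof -
    let ?A = "{e\<in>space \<nu>. ennreal d \<le> e}"
    have "0 < measure \<nu> ?A"
      using \<nu>_fin[OF d] \<nu>_pos[OF d] by (simp add: measure_def enn2real_positive_iff)
    also have "measure \<nu> ?A = (\<integral>e. indicator ?A e \<partial>\<nu>)" using \<nu>_fin[OF d] by simp
    also have "\<dots> \<le> a'" unfolding a'_def
      using \<nu>_fin[OF d] hk_int by (intro integral_mono integrable_real_indicator) (auto simp: indicator_def hk1 hk_bd)
    finally show ?thesis .
  qed
  have ta: "(\<lambda>n. t n * a n) \<longlonglongrightarrow> a'"
  proof -
    have "(\<lambda>n. t n * (\<integral>\<omega>. hk (ennreal (Y \<omega> / c n)) \<partial>M)) \<longlonglongrightarrow> a'"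
      unfolding a'_def using d hk0 by (intro vague hk_cont hk_bd) (auto intro!: exI[of _ "d / 2"])
    moreover have "(\<integral>\<omega>. hk (ennreal (Y \<omega> / c n)) \<partial>M) = a n" for n
      unfolding a_def by (intro Bochner_Integration.integral_cong) (auto simp: hk_k Yc0)
    ultimately show ?thesis by simp
  qed
  have a_nonneg: "0 \<le> a n" for n unfolding a_def by (intro Bochner_Integration.integral_nonneg k)
  have ev: "\<forall>\<^sub>F n in sequentially. 0 < a n"
    using order_tendstoD(1)[OF ta a'_pos]
    by eventually_elim (metis a_nonneg less_eq_real_def mult_zero_right order_less_irrefl)
  have k_int: "integrable M (\<lambda>\<omega>. k (Y \<omega> / c n))" for n
    by (rule integrable_const_bound[where B=1]) (auto simp: k)
  \<comment> \<open>The normalizing mass may vanish for early \<open>n\<close>; \<open>M\<close> is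
    only a filler there, as \<open>0 < a n\<close> eventually.\<close>
  define N where "N n = (if 0 < a n then density M (\<lambda>\<omega>. ennreal (k (Y \<omega> / c n) / a n)) else M)" for n
  have N_sets[measurable_cong]: "sets (N n) = sets M" for n by (simp add: N_def)
  have N_space: "space (N n) = space M" for n by (rule sets_eq_imp_space_eq) (rule N_sets)
  have N_prob: "prob_space (N n)" for n
  proof (cases "0 < a n")
    case True
    have "prob_space (density M (\<lambda>\<omega>. ennreal (k (Y \<omega> / c n) / a n)))"
      using True by (intro prob_space_density_normalized k_int k(1)) (simp_all add: a_def)
    then show ?thesis by (simp only: N_def True if_True)
  qed (simp add: N_def prob_space_axioms)
  have N_int: "(\<integral>\<omega>. q \<omega> \<partial>N n) = (\<integral>\<omega>. k (Y \<omega> / c n) * q \<omega> \<partial>M) / a n" if "0 < a n" "q \<in> borel_measurable M" for n q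
  proof -
    have "(\<integral>\<omega>. q \<omega> \<partial>N n) = (\<integral>\<omega>. (k (Y \<omega> / c n) / a n) *\<^sub>R q \<omega> \<partial>M)"
      unfolding N_def if_P[OF that(1)] using that by (intro integral_density) (auto simp: k)
    then show ?thesis by simp
  qed
  define \<mu> where "\<mu> = distr (density \<nu> (\<lambda>e. ennreal (hk e / a'))) borel enn2real"
  have \<mu>_prob: "prob_space (density \<nu> (\<lambda>e. ennreal (hk e / a')))"
    using hk_int hk_bd a'_pos by (intro prob_space_density_normalized) (auto simp: a'_def)
  have \<mu>_rd: "real_distribution \<mu>"
    unfolding \<mu>_def by (rule prob_space.real_distribution_distr[OF \<mu>_prob]) measurable
  have \<mu>_int: "(\<integral>x. q x \<partial>\<mu>) = (\<integral>e. hk e * q (enn2real e) \<partial>\<nu>) / a'" if [measurable]: "q \<in> borel_measurable borel" for q :: "real \<Rightarrow> real"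
  proof -
    have "(\<integral>x. q x \<partial>\<mu>) = (\<integral>e. q (enn2real e) \<partial>density \<nu> (\<lambda>e. ennreal (hk e / a')))"
      unfolding \<mu>_def by (intro integral_distr) measurable
    also have "\<dots> = (\<integral>e. (hk e / a') *\<^sub>R q (enn2real e) \<partial>\<nu>)"
      using a'_pos hk_bd by (intro integral_density) auto
    finally show ?thesis by simp
  qed
  have wc: "weak_conv_m (\<lambda>n. distr (N n) borel (\<lambda>\<omega>. Y \<omega> / c n)) \<mu>"
  proof (rule weak_conv_m_of_ennreal[OF N_prob _ _ \<mu>_rd])
    show "AE x in \<mu>. 0 \<le> x"
      unfolding \<mu>_def by (subst AE_distr_iff) auto
    fix h :: "ennreal \<Rightarrow> real" assume h: "continuous_on UNIV h" "\<And>e. 0 \<le> h e"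
    have [measurable]: "h \<in> borel_measurable borel" using h(1) by (rule borel_measurable_continuous_onI)
    have "(\<lambda>n. t n * (\<integral>\<omega>. hk (ennreal (Y \<omega> / c n)) * h (ennreal (Y \<omega> / c n)) \<partial>M)) \<longlonglongrightarrow> (\<integral>e. hk e * h e \<partial>\<nu>)"
      using d hk0 h hk_cont hk_bd
      by (intro vague continuous_on_mult) (auto intro!: exI[of _ "d / 2"])
    then have conv1: "(\<lambda>n. t n * (\<integral>\<omega>. hk (ennreal (Y \<omega> / c n)) * h (ennreal (Y \<omega> / c n)) \<partial>M) / (t n * a n)) \<longlonglongrightarrow> (\<integral>e. hk e * h e \<partial>\<nu>) / a'"
      using ta a'_pos by (intro tendsto_divide) auto
    have \<mu>_h: "(\<integral>x. h (ennreal x) \<partial>\<mu>) = (\<integral>e. hk e * h e \<partial>\<nu>) / a'"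
    proof -
      \<comment> \<open>The passage through the real line loses the point infinity, which has no
        \<open>\<nu>\<close>-mass.\<close>
      have "(\<integral>e. hk e * h (ennreal (enn2real e)) \<partial>\<nu>) = (\<integral>e. hk e * h e \<partial>\<nu>)"
        using \<nu>_top by (intro integral_cong_AE) (auto elim!: eventually_mono simp: ennreal_enn2real)
      then show ?thesis by (subst \<mu>_int) auto
    qed
    have eq: "\<forall>\<^sub>F n in sequentially. t n * (\<integral>\<omega>. hk (ennreal (Y \<omega> / c n)) * h (ennreal (Y \<omega> / c n)) \<partial>M) / (t n * a n)
        = (\<integral>\<omega>. h (ennreal (Y \<omega> / c n)) \<partial>N n)"
      using ev order_tendstoD(1)[OF ta a'_pos]
    proof eventually_elim
      case (elim n)
      then have "t n \<noteq> 0" by auto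
      moreover have "(\<integral>\<omega>. hk (ennreal (Y \<omega> / c n)) * h (ennreal (Y \<omega> / c n)) \<partial>M) = (\<integral>\<omega>. k (Y \<omega> / c n) * h (ennreal (Y \<omega> / c n)) \<partial>M)"
        by (intro Bochner_Integration.integral_cong) (auto simp: hk_k Yc0)
      ultimately show ?case using elim by (subst N_int) auto
    qed
    show "(\<lambda>n. \<integral>\<omega>. h (ennreal (Y \<omega> / c n)) \<partial>N n) \<longlonglongrightarrow> (\<integral>x. h (ennreal x) \<partial>\<mu>)"
      unfolding \<mu>_h by (rule Lim_transform_eventually[OF conv1 eq])
  qed (auto simp: N_space Yc0)
  \<comment> \<open>\<open>max 0\<close> extends functions on the half-line to the real line. Near 0
    both \<open>f n\<close> and \<open>g\<close> vanish, so convergence at the limit point 0 holds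
    with \<open>S\<close> the whole line.\<close>
  have "(\<lambda>n. \<integral>x. f n (max 0 x) \<partial>distr (N n) borel (\<lambda>\<omega>. Y \<omega> / c n)) \<longlonglongrightarrow> (\<integral>x. g (max 0 x) \<partial>\<mu>)"
  proof (rule extended_continuous_mapping[OF _ \<mu>_rd wc _ _ _ _ _ _ _ _ disjI2[OF disjI1], where S="\<lambda>_. UNIV" and B=B])
    show "real_distribution (distr (N n) borel (\<lambda>\<omega>. Y \<omega> / c n))" for n
      by (rule prob_space.real_distribution_distr[OF N_prob]) measurable
    show nn: "AE x in \<mu>. 0 \<le> x"
      unfolding \<mu>_def by (subst AE_distr_iff) auto
    show "AE w in \<mu>. w \<noteq> 0 \<longrightarrow> (\<forall>ws. ws \<longlonglongrightarrow> w \<longrightarrow> (\<lambda>n. f n (max 0 (ws n))) \<longlonglongrightarrow> g (max 0 w))"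
      using nn
    proof eventually_elim
      case (elim w)
      show ?case
      proof (intro impI allI)
        fix ws assume "w \<noteq> 0" "ws \<longlonglongrightarrow> w"
        then show "(\<lambda>n. f n (max 0 (ws n))) \<longlonglongrightarrow> g (max 0 w)"
          using elim tendsto_max[OF tendsto_const[of 0] \<open>ws \<longlonglongrightarrow> w\<close>] by (intro fg) auto
      qed
    qed
    fix ws :: "nat \<Rightarrow> real" assume "ws \<longlonglongrightarrow> 0"
    then have "\<forall>\<^sub>F n in sequentially. ws n < d" using d by (rule order_tendstoD(2))
    then have "\<forall>\<^sub>F n in sequentially. f n (max 0 (ws n)) = g (max 0 0)"
      by eventually_elim (use d in \<open>simp add: f0 g0\<close>)
    then show "(\<lambda>n. f n (max 0 (ws n))) \<longlonglongrightarrow> g (max 0 0)" by (rule tendsto_eventually)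
  qed (auto simp: B)
  then have conv1: "(\<lambda>n. (t n * a n) * (\<integral>x. f n (max 0 x) \<partial>distr (N n) borel (\<lambda>\<omega>. Y \<omega> / c n))) \<longlonglongrightarrow> a' * (\<integral>x. g (max 0 x) \<partial>\<mu>)"
    by (intro tendsto_mult ta)
  have lim_eq: "a' * (\<integral>x. g (max 0 x) \<partial>\<mu>) = (\<integral>e. g (enn2real e) \<partial>\<nu>)"
  proof -
    \<comment> \<open>The density equals 1 wherever \<open>g\<close> can be nonzero, so it drops out
      and only the normalization remains.\<close>
    have hkg: "hk e * g (max 0 (enn2real e)) = g (enn2real e)" for e
    proof (cases "ennreal d \<le> e")
      case False
      then have "enn2real e < d" using d by (cases e) (auto simp: not_le ennreal_less_iff)
      then show ?thesis using d by (simp add: g0)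
    qed (simp add: hk1 max_def)
    have "(\<integral>x. g (max 0 x) \<partial>\<mu>) = (\<integral>e. g (enn2real e) \<partial>\<nu>) / a'"
      unfolding \<mu>_int[OF measurable_compose[OF max_half_line g]] hkg ..
    then show ?thesis using a'_pos by simp
  qed
  have "\<forall>\<^sub>F n in sequentially. (t n * a n) * (\<integral>x. f n (max 0 x) \<partial>distr (N n) borel (\<lambda>\<omega>. Y \<omega> / c n)) = t n * (\<integral>\<omega>. f n (Y \<omega> / c n) \<partial>M)"
    using ev
  proof eventually_elim
    case (elim n)
    have "(\<integral>x. f n (max 0 x) \<partial>distr (N n) borel (\<lambda>\<omega>. Y \<omega> / c n)) = (\<integral>\<omega>. f n (max 0 (Y \<omega> / c n)) \<partial>N n)"
      by (intro integral_distr) measurable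
    also have "\<dots> = (\<integral>\<omega>. k (Y \<omega> / c n) * f n (max 0 (Y \<omega> / c n)) \<partial>M) / a n"
      using elim by (intro N_int) measurable
    also have "(\<integral>\<omega>. k (Y \<omega> / c n) * f n (max 0 (Y \<omega> / c n)) \<partial>M) = (\<integral>\<omega>. f n (Y \<omega> / c n) \<partial>M)"
    proof (intro Bochner_Integration.integral_cong refl)
      fix \<omega> assume "\<omega> \<in> space M"
      then have "max 0 (Y \<omega> / c n) = Y \<omega> / c n" using Yc0 by (simp add: max_def)
      then show "k (Y \<omega> / c n) * f n (max 0 (Y \<omega> / c n)) = f n (Y \<omega> / c n)"
        by (cases "d \<le> Y \<omega> / c n") (auto simp: k1 f0)
    qed
    finally show ?case using elim by simp
  qed
  from Lim_transform_eventually[OF conv1 this] show ?thesis unfolding lim_eq .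
qed

section \<open>One step of an attracted kernel\<close>

lemma kernel_half_line:
  assumes "K \<in> measurable half_line (prob_algebra half_line)" "0 \<le> (x::real)"
  shows "prob_space (K x)" "sets (K x) = sets (half_line :: real measure)" "space (K x) = {0..}"
proof -
  show "prob_space (K x)" and s: "sets (K x) = sets half_line"
    using measurable_space[OF assms(1), of x] assms(2) by (auto simp: space_prob_algebra space_restrict_space)
  show "space (K x) = {0..}" using sets_eq_imp_space_eq[OF s] by (simp add: space_restrict_space)
qed

lemma half_line_measurable:
  assumes "sets N = sets (half_line :: real measure)" "f \<in> measurable half_line L"
  shows "f \<in> measurable N L"
  using assms(2) measurable_cong_sets[OF assms(1) refl] by blast

lemma weak_convD:
  fixes h :: "'a::topological_space \<Rightarrow> real"
  assumes "weak_conv \<mu> \<nu> F" "continuous_on UNIV h" "\<And>e. 0 \<le> h e" "\<And>e. h e \<le> 1"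
  shows "((\<lambda>t. \<integral>e. h e \<partial>\<mu> t) \<longlongrightarrow> (\<integral>e. h e \<partial>\<nu>)) F"
proof -
  have "bounded (range h)" unfolding bounded_iff using assms(3,4) by (intro exI[of _ 1]) auto
  then show ?thesis using assms(1,2) by (simp add: weak_conv_def)
qed

lemma integral_rescale:
  fixes h :: "ennreal \<Rightarrow> real"
  assumes "sets N = sets (half_line :: real measure)" "continuous_on UNIV h"
  shows "(\<integral>e. h e \<partial>rescale N s) = (\<integral>x. h (ennreal (x / s)) \<partial>N)"
  unfolding rescale_def
proof (rule integral_distr)
  show "(\<lambda>x. ennreal (x / s)) \<in> measurable N borel"
    by (rule half_line_measurable[OF assms(1)]) measurable
  show "h \<in> borel_measurable borel" using assms(2) by (rule borel_measurable_continuous_onI)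
qed

text \<open>With \<open>s = c n * u n\<close> one has \<open>x / c n = u n * (x / s)\<close>, and
  \<open>s\<close> tends to infinity. Attraction thus gives the weak limit of \<open>x / s\<close>,
  and the moving factor \<open>u n\<close> is absorbed into the functions. The alternatives in
  \<open>zero\<close> are three ways to control the atom at 0: it is absent, every approach to 0 is
  admissible, or asymptotically its whole mass lies below a vanishing threshold.\<close>

lemma attracted_kernel_tendsto:
  fixes G :: "real measure" and f :: "nat \<Rightarrow> real \<Rightarrow> real"
  assumes G: "G \<in> space (prob_algebra half_line)"
    and K: "K \<in> measurable half_line (prob_algebra half_line)"
    and KG: "attracted K G" and c: "filterlim c at_top sequentially" "\<And>n. 0 < c n"
    and f[measurable]: "\<And>n. f n \<in> borel_measurable half_line" and g[measurable]: "g \<in> borel_measurable half_line"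
    and B: "\<And>n x. \<bar>f n x\<bar> \<le> B" and u: "\<And>n. 0 \<le> u n" "u \<longlonglongrightarrow> u'" "0 < u'"
    and fg: "\<And>w w'. (\<And>n. 0 \<le> w n) \<Longrightarrow> w \<longlonglongrightarrow> w' \<Longrightarrow> 0 < w' \<Longrightarrow> (\<lambda>n. f n (w n)) \<longlonglongrightarrow> g w'"
    and zero: "measure G {0} = 0 \<or>
      (\<forall>w. (\<forall>n. 0 \<le> w n) \<longrightarrow> w \<longlonglongrightarrow> 0 \<longrightarrow> (\<lambda>n. f n (w n)) \<longlonglongrightarrow> g 0) \<or>
      (\<exists>z. (\<forall>n. 0 \<le> z n) \<and> z \<longlonglongrightarrow> 0 \<and> (\<lambda>n. measure (K (c n * u n)) {0..c n * z n}) \<longlonglongrightarrow> measure G {0} \<and>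
        (\<forall>w. (\<forall>n. 0 \<le> w n \<and> w n \<le> z n) \<longrightarrow> (\<lambda>n. f n (w n)) \<longlonglongrightarrow> g 0))"
  shows "(\<lambda>n. \<integral>x. f n (x / c n) \<partial>K (c n * u n)) \<longlonglongrightarrow> (\<integral>\<xi>. g (u' * \<xi>) \<partial>G)"
proof -
  have G_prob: "prob_space G" and G_sets: "sets G = sets half_line" using G by (auto simp: space_prob_algebra)
  have G_space: "space G = {0..}" using sets_eq_imp_space_eq[OF G_sets] by (simp add: space_restrict_space)
  \<comment> \<open>\<open>v\<close> repairs the finitely many terms where \<open>u\<close> may be
    0, so that \<open>s n\<close> is always positive.\<close>
  define v where "v n = (if 0 < u n then u n else u')" for n
  have v_pos: "0 < v n" for n using u(3) by (simp add: v_def)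
  have ev: "\<forall>\<^sub>F n in sequentially. u n = v n"
    using order_tendstoD(1)[OF u(2,3)] by eventually_elim (simp add: v_def)
  have v_lim: "v \<longlonglongrightarrow> u'" by (rule Lim_transform_eventually[OF u(2) ev])
  define s where "s n = c n * v n" for n
  have s_pos: "0 < s n" for n using c(2) v_pos by (simp add: s_def)
  have s_lim: "filterlim s at_top sequentially"
    unfolding s_def using filterlim_tendsto_pos_mult_at_top[OF v_lim u(3) c(1)] by (simp add: mult.commute)
  have Ks: "prob_space (K (s n))" "sets (K (s n)) = sets half_line" "space (K (s n)) = {0..}" for n
    using kernel_half_line[OF K, of "s n"] s_pos[of n] by auto
  have Ks_meas: "q \<in> measurable half_line L \<Longrightarrow> q \<in> measurable (K (s n)) L" for q n and L :: "'z measure"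
    by (rule half_line_measurable[OF Ks(2)])
  have G_meas: "q \<in> measurable half_line L \<Longrightarrow> q \<in> measurable G L" for q and L :: "'z measure"
    by (rule half_line_measurable[OF G_sets])
  have xs: "(\<lambda>x. x / s n) \<in> borel_measurable (K (s n))" for n by (rule Ks_meas) measurable
  have xG: "(\<lambda>x. x) \<in> borel_measurable G" by (rule G_meas) measurable
  define \<mu> where "\<mu> = distr G borel (\<lambda>x. x)"
  have \<mu>_rd: "real_distribution \<mu>" unfolding \<mu>_def by (rule prob_space.real_distribution_distr[OF G_prob xG])
  have \<mu>_nn: "AE x in \<mu>. 0 \<le> x"
    unfolding \<mu>_def by (subst AE_distr_iff[OF xG]) (auto intro!: AE_I2 simp: G_space)
  have \<mu>0: "measure \<mu> {0} = measure G {0}"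
    unfolding \<mu>_def by (subst measure_distr[OF xG]) (auto simp: G_space intro!: arg_cong[where f="measure G"])
  have wc: "weak_conv_m (\<lambda>n. distr (K (s n)) borel (\<lambda>x. x / s n)) \<mu>"
  proof (rule weak_conv_m_of_ennreal[OF Ks(1) xs _ \<mu>_rd \<mu>_nn])
    show "0 \<le> x / s n" if "x \<in> space (K (s n))" for n x using that s_pos[of n] by (simp add: Ks(3))
    fix h :: "ennreal \<Rightarrow> real" assume h: "continuous_on UNIV h" "\<And>e. 0 \<le> h e" "\<And>e. h e \<le> 1"
    have h_meas: "h \<in> borel_measurable borel" using h(1) by (rule borel_measurable_continuous_onI)
    have "((\<lambda>t. \<integral>e. h e \<partial>rescale (K t) t) \<longlongrightarrow> (\<integral>e. h e \<partial>distr G borel ennreal)) at_top"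
      by (rule weak_convD[OF KG[unfolded attracted_def] h])
    then have "(\<lambda>n. \<integral>e. h e \<partial>rescale (K (s n)) (s n)) \<longlonglongrightarrow> (\<integral>e. h e \<partial>distr G borel ennreal)"
      using s_lim by (rule filterlim_compose)
    moreover have "(\<integral>e. h e \<partial>distr G borel ennreal) = (\<integral>x. h (ennreal x) \<partial>G)"
      by (rule integral_distr[OF _ h_meas]) (rule G_meas, measurable)
    moreover have "(\<integral>x. h (ennreal x) \<partial>\<mu>) = (\<integral>x. h (ennreal x) \<partial>G)"
      unfolding \<mu>_def by (rule integral_distr[OF xG measurable_compose[OF measurable_ennreal h_meas]])
    ultimately show "(\<lambda>n. \<integral>x. h (ennreal (x / s n)) \<partial>K (s n)) \<longlonglongrightarrow> (\<integral>x. h (ennreal x) \<partial>\<mu>)"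
      by (simp only: integral_rescale[OF Ks(2) h(1)])
  qed
  have mx: "(\<lambda>n. max 0 (v n * ws n)) \<longlonglongrightarrow> max 0 (u' * w)" if "ws \<longlonglongrightarrow> w" for ws w
    by (intro tendsto_max tendsto_mult tendsto_const v_lim that)
  have scale_meas: "(\<lambda>w. q (max 0 (x * w))) \<in> borel_measurable borel" if "q \<in> borel_measurable half_line" for q :: "real \<Rightarrow> real" and x
    by (rule measurable_compose[OF _ that]) (auto simp: measurable_restrict_space2_iff)
  note emc = extended_continuous_mapping[where \<mu>s="\<lambda>n. distr (K (s n)) borel (\<lambda>x. x / s n)" and f="\<lambda>n w. f n (max 0 (v n * w))"
      and g="\<lambda>w. g (max 0 (u' * w))" and B=B, OF prob_space.real_distribution_distr[OF Ks(1) xs] \<mu>_rd wc scale_meas[OF f] scale_meas[OF g] B _ _ \<mu>_nn]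
  have away: "AE w in \<mu>. w \<noteq> 0 \<longrightarrow> (\<forall>ws. ws \<longlonglongrightarrow> w \<longrightarrow> (\<lambda>n. f n (max 0 (v n * ws n))) \<longlonglongrightarrow> g (max 0 (u' * w)))"
    using \<mu>_nn
  proof eventually_elim
    case (elim w)
    show ?case
    proof (intro allI impI)
      fix ws assume w: "w \<noteq> 0" "ws \<longlonglongrightarrow> w"
      show "(\<lambda>n. f n (max 0 (v n * ws n))) \<longlonglongrightarrow> g (max 0 (u' * w))"
        using elim w u(3) by (intro fg mx) (auto simp: max_def)
    qed
  qed
  have "(\<lambda>n. \<integral>x. f n (max 0 (v n * x)) \<partial>distr (K (s n)) borel (\<lambda>x. x / s n)) \<longlonglongrightarrow> (\<integral>x. g (max 0 (u' * x)) \<partial>\<mu>)"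
    using zero
  proof (elim disjE exE conjE)
    assume "measure G {0} = 0"
    then show ?thesis
      by (intro emc[where S="\<lambda>_. UNIV", OF _ _ away]) (auto simp: \<mu>0)
  next
    assume z: "\<forall>w. (\<forall>n. 0 \<le> w n) \<longrightarrow> w \<longlonglongrightarrow> 0 \<longrightarrow> (\<lambda>n. f n (w n)) \<longlonglongrightarrow> g 0"
    show ?thesis
    proof (rule emc[where S="\<lambda>_. UNIV", OF _ _ away])
      fix ws :: "nat \<Rightarrow> real" assume "ws \<longlonglongrightarrow> 0"
      from mx[OF this] show "(\<lambda>n. f n (max 0 (v n * ws n))) \<longlonglongrightarrow> g (max 0 (u' * 0))"
        using z by simp
    qed auto
  next
    fix z assume z: "\<forall>n. 0 \<le> z n" "z \<longlonglongrightarrow> 0" and mz: "(\<lambda>n. measure (K (c n * u n)) {0..c n * z n}) \<longlonglongrightarrow> measure G {0}"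
      and zf: "\<forall>w. (\<forall>n. 0 \<le> w n \<and> w n \<le> z n) \<longrightarrow> (\<lambda>n. f n (w n)) \<longlonglongrightarrow> g 0"
    show ?thesis
    \<comment> \<open>The threshold \<open>z n\<close> is measured in units of \<open>c n\<close>;
      in units of \<open>s n = c n * v n\<close> it reads \<open>z n / v n\<close>.\<close>
    proof (rule emc[where S="\<lambda>n. {..z n / v n}", OF _ _ away])
      show "0 \<in> {..z n / v n}" for n using z v_pos[of n] by simp
      show "(\<lambda>n. f n (max 0 (v n * ws n))) \<longlonglongrightarrow> g (max 0 (u' * 0))" if "\<And>n. ws n \<in> {..z n / v n}" for ws
      proof -
        have "v n * ws n \<le> z n" for n using that[of n] v_pos[of n] by (simp add: field_simps)
        then show ?thesis using zf z by simp
      qed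
      have "measure (distr (K (s n)) borel (\<lambda>x. x / s n)) {..z n / v n} = measure (K (s n)) {0..c n * z n}" for n
      proof -
        have "measure (distr (K (s n)) borel (\<lambda>x. x / s n)) {..z n / v n} = measure (K (s n)) ((\<lambda>x. x / s n) -` {..z n / v n} \<inter> space (K (s n)))"
          by (rule measure_distr[OF xs]) simp
        also have "(\<lambda>x. x / s n) -` {..z n / v n} \<inter> space (K (s n)) = {0..c n * z n}"
          unfolding Ks(3) unfolding s_def using v_pos[of n] c(2)[of n] by (auto simp: field_simps)
        finally show ?thesis .
      qed
      moreover have "\<forall>\<^sub>F n in sequentially. measure (K (c n * u n)) {0..c n * z n} = measure (K (s n)) {0..c n * z n}"
        using ev by eventually_elim (simp add: s_def)
      ultimately have "(\<lambda>n. measure (distr (K (s n)) borel (\<lambda>x. x / s n)) {..z n / v n}) \<longlonglongrightarrow> measure \<mu> {0}"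
        using Lim_transform_eventually[OF mz] by (simp add: \<mu>0)
      moreover have "(\<lambda>n. z n / v n) \<longlonglongrightarrow> 0" using tendsto_divide[OF z(2) v_lim] u(3) by simp
      ultimately show "measure \<mu> {0} = 0 \<or> (\<forall>n. {..z n / v n} = UNIV) \<or>
        (\<exists>za. za \<longlonglongrightarrow> 0 \<and> (\<forall>n. {..z n / v n} = {..za n}) \<and>
          (\<lambda>n. measure (distr (K (s n)) borel (\<lambda>x. x / s n)) {..z n / v n}) \<longlonglongrightarrow> measure \<mu> {0})"
        by blast
    qed simp
  qed
  moreover have "(\<integral>x. f n (max 0 (v n * x)) \<partial>distr (K (s n)) borel (\<lambda>x. x / s n)) = (\<integral>x. f n (x / c n) \<partial>K (s n))" for n
  proof -
    have "(\<integral>x. f n (max 0 (v n * x)) \<partial>distr (K (s n)) borel (\<lambda>x. x / s n)) = (\<integral>x. f n (max 0 (v n * (x / s n))) \<partial>K (s n))"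
      by (rule integral_distr[OF xs scale_meas[OF f]])
    also have "\<dots> = (\<integral>x. f n (x / c n) \<partial>K (s n))"
    proof (intro Bochner_Integration.integral_cong refl)
      fix x assume "x \<in> space (K (s n))"
      then have "0 \<le> x" by (simp add: Ks(3))
      then have "max 0 (v n * (x / s n)) = x / c n"
        using v_pos[of n] c(2)[of n] by (simp add: s_def max_def)
      then show "f n (max 0 (v n * (x / s n))) = f n (x / c n)" by (rule arg_cong)
    qed
    finally show ?thesis .
  qed
  moreover have "(\<integral>x. g (max 0 (u' * x)) \<partial>\<mu>) = (\<integral>\<xi>. g (u' * \<xi>) \<partial>G)"
  proof -
    have "(\<integral>x. g (max 0 (u' * x)) \<partial>\<mu>) = (\<integral>x. g (max 0 (u' * x)) \<partial>G)"
      unfolding \<mu>_def by (rule integral_distr[OF xG scale_meas[OF g]])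
    also have "\<dots> = (\<integral>\<xi>. g (u' * \<xi>) \<partial>G)"
    proof (intro Bochner_Integration.integral_cong refl)
      fix x assume "x \<in> space G"
      then have "max 0 (u' * x) = u' * x" using u(3) by (simp add: G_space max_def)
      then show "g (max 0 (u' * x)) = g (u' * x)" by (rule arg_cong)
    qed
    finally show ?thesis .
  qed
  ultimately have lim: "(\<lambda>n. \<integral>x. f n (x / c n) \<partial>K (s n)) \<longlonglongrightarrow> (\<integral>\<xi>. g (u' * \<xi>) \<partial>G)" by (simp only:)
  have "\<forall>\<^sub>F n in sequentially. (\<integral>x. f n (x / c n) \<partial>K (s n)) = (\<integral>x. f n (x / c n) \<partial>K (c n * u n))"
    using ev by eventually_elim (simp add: s_def)
  from Lim_transform_eventually[OF lim this] show ?thesis .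
qed

text \<open>A convergence along all sequences is uniform, so the laws \<open>N n\<close> are irrelevant.\<close>

lemma integral_tendsto_of_all_sequences:
  fixes f :: "nat \<Rightarrow> real \<Rightarrow> real"
  assumes N: "\<And>n. prob_space (N n)" "\<And>n. sets (N n) = sets half_line" and c: "\<And>n. 0 < c n"
    and f: "\<And>n. f n \<in> borel_measurable half_line" and B: "\<And>n x. \<bar>f n x\<bar> \<le> B"
    and lim: "\<And>w. (\<And>n. 0 \<le> w n) \<Longrightarrow> (\<lambda>n. f n (w n)) \<longlonglongrightarrow> L"
  shows "(\<lambda>n. \<integral>x. f n (x / c n) \<partial>N n) \<longlonglongrightarrow> L"
proof -
  define I where "I n = (\<integral>x. f n (x / c n) \<partial>N n)" for n
  \<comment> \<open>A mean deviation cannot exceed every pointwise deviation. The factor 2 leaves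
    room for a supremum that is not attained.\<close>
  have "\<exists>w\<ge>0. \<bar>I n - L\<bar> / 2 \<le> \<bar>f n w - L\<bar>" for n
  proof (rule ccontr)
    assume "\<not> ?thesis"
    then have less: "\<bar>f n w - L\<bar> < \<bar>I n - L\<bar> / 2" if "0 \<le> w" for w using that by (meson not_le)
    interpret prob_space "N n" by (rule N)
    have sp: "space (N n) = {0..}" using sets_eq_imp_space_eq[OF N(2)] by (simp add: space_restrict_space)
    have "(\<lambda>x. f n (x / c n)) \<in> borel_measurable (N n)"
      using c[of n] by (intro half_line_measurable[OF N(2)] measurable_compose[OF _ f]) measurable
    then have "integrable (N n) (\<lambda>x. f n (x / c n))" using B by (intro integrable_const_bound[where B=B]) auto
    then have "I n - L = (\<integral>x. f n (x / c n) - L \<partial>N n)" by (simp add: I_def prob_space)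
    also have "\<dots> = (\<integral>x. f n (max 0 (x / c n)) - L \<partial>N n)"
    proof (intro Bochner_Integration.integral_cong refl)
      fix x assume "x \<in> space (N n)"
      then have "max 0 (x / c n) = x / c n" using c[of n] by (simp add: sp max_def)
      then show "f n (x / c n) - L = f n (max 0 (x / c n)) - L" by simp
    qed
    finally have "\<bar>I n - L\<bar> \<le> \<bar>I n - L\<bar> / 2"
      using integral_abs_le_bound[OF N(1), of "\<lambda>x. f n (max 0 (x / c n)) - L" "\<bar>I n - L\<bar> / 2" n] less[THEN less_imp_le]
      by auto
    then show False using less[of 0] by auto
  qed
  then obtain w where w: "\<And>n. 0 \<le> w n" "\<And>n. \<bar>I n - L\<bar> / 2 \<le> \<bar>f n (w n) - L\<bar>" by metis
  have "(\<lambda>n. 2 * \<bar>f n (w n) - L\<bar>) \<longlonglongrightarrow> 2 * \<bar>L - L\<bar>"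
    by (intro tendsto_intros lim w(1))
  then have "(\<lambda>n. 2 * \<bar>f n (w n) - L\<bar>) \<longlonglongrightarrow> 0" by simp
  then have "(\<lambda>n. I n - L) \<longlonglongrightarrow> 0"
    by (rule Lim_null_comparison[rotated]) (use w(2) in \<open>auto simp: field_simps\<close>)
  then show ?thesis unfolding I_def by (rule LIM_zero_cancel)
qed

text \<open>Here the unscaled law does not move, so convergence along \<open>x / c n\<close> for
  each fixed state \<open>x\<close> is enough for dominated convergence.\<close>

lemma integral_tendsto_fixed_law:
  fixes f :: "nat \<Rightarrow> real \<Rightarrow> real"
  assumes N: "prob_space N" "sets N = sets half_line" and c: "\<And>n. 0 < c n"
    and f: "\<And>n. f n \<in> borel_measurable half_line" and B: "\<And>n x. \<bar>f n x\<bar> \<le> B"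
    and lim: "\<And>x. 0 \<le> x \<Longrightarrow> (\<lambda>n. f n (x / c n)) \<longlonglongrightarrow> L"
  shows "(\<lambda>n. \<integral>x. f n (x / c n) \<partial>N) \<longlonglongrightarrow> L"
proof -
  interpret prob_space N by fact
  have sp: "space N = {0..}" using sets_eq_imp_space_eq[OF N(2)] by (simp add: space_restrict_space)
  have "(\<lambda>n. \<integral>x. f n (x / c n) \<partial>N) \<longlonglongrightarrow> (\<integral>x. L \<partial>N)"
  proof (rule integral_dominated_convergence[where w="\<lambda>_. B"])
    show "(\<lambda>x. f n (x / c n)) \<in> borel_measurable N" for n
      using c[of n] by (intro half_line_measurable[OF N(2)] measurable_compose[OF _ f]) measurable
    show "AE x in N. (\<lambda>n. f n (x / c n)) \<longlonglongrightarrow> L" by (rule AE_I2) (simp add: sp lim)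
  qed (use B in auto)
  then show ?thesis by (simp add: prob_space)
qed

text \<open>The limit law is the point mass at 0, so the integrand has to converge only along null
  sequences. The regularity condition is transferred from functions of t to the pair
  \<open>c\<close>, \<open>u\<close> by \<open>tendsto_sequence_of_functions\<close>.\<close>

lemma regular_kernel_tendsto:
  fixes f :: "nat \<Rightarrow> real \<Rightarrow> real"
  assumes K: "K \<in> measurable half_line (prob_algebra half_line)" and reg: "regularity_condition K"
    and c: "filterlim c at_top sequentially" "\<And>n. 0 < c n"
    and f: "\<And>n. f n \<in> borel_measurable half_line" and B: "\<And>n x. \<bar>f n x\<bar> \<le> B"
    and u: "\<And>n. 0 \<le> u n" "u \<longlonglongrightarrow> 0"
    and lim: "\<And>w. (\<And>n. 0 \<le> w n) \<Longrightarrow> w \<longlonglongrightarrow> 0 \<Longrightarrow> (\<lambda>n. f n (w n)) \<longlonglongrightarrow> L"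
  shows "(\<lambda>n. \<integral>x. f n (x / c n) \<partial>K (c n * u n)) \<longlonglongrightarrow> L"
proof -
  have nn: "0 \<le> c n * u n" for n using c(2)[of n] u(1)[of n] by simp
  note Kn = kernel_half_line[OF K nn]
  have xs: "(\<lambda>x. x / c n) \<in> borel_measurable (K (c n * u n))" for n
    by (rule half_line_measurable[OF Kn(2)]) measurable
  define \<mu> :: "real measure" where "\<mu> = return borel 0"
  have \<mu>_rd: "real_distribution \<mu>"
    unfolding \<mu>_def by (intro real_distribution.intro real_distribution_axioms.intro prob_space_return) auto
  have \<mu>_nn: "AE x in \<mu>. 0 \<le> x" unfolding \<mu>_def by (subst AE_return) auto
  have wc: "weak_conv_m (\<lambda>n. distr (K (c n * u n)) borel (\<lambda>x. x / c n)) \<mu>"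
  proof (rule weak_conv_m_of_ennreal[OF Kn(1) xs _ \<mu>_rd \<mu>_nn])
    show "0 \<le> x / c n" if "x \<in> space (K (c n * u n))" for n x using that c(2)[of n] by (simp add: Kn(3))
    fix h :: "ennreal \<Rightarrow> real" assume h: "continuous_on UNIV h" "\<And>e. 0 \<le> h e" "\<And>e. h e \<le> 1"
    have h_meas[measurable]: "h \<in> borel_measurable borel" using h(1) by (rule borel_measurable_continuous_onI)
    have "(\<lambda>n. \<integral>e. h e \<partial>rescale (K (c n * u n)) (c n)) \<longlonglongrightarrow> (\<integral>e. h e \<partial>return borel 0)"
    proof (rule tendsto_sequence_of_functions[where \<Phi>="\<lambda>t v. \<integral>e. h e \<partial>rescale (K (t * v)) t" and c=0, OF _ c(1) u(2,1)])
      fix u :: "real \<Rightarrow> real" assume "\<forall>t. 0 \<le> u t" "(u \<longlongrightarrow> 0) at_top"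
      then have "weak_conv (\<lambda>t. rescale (K (t * u t)) t) (return borel 0) at_top"
        using reg by (simp add: regularity_condition_def)
      then show "((\<lambda>t. \<integral>e. h e \<partial>rescale (K (t * u t)) t) \<longlongrightarrow> (\<integral>e. h e \<partial>return borel 0)) at_top"
        using h by (rule weak_convD)
    qed simp
    moreover have "(\<integral>e. h e \<partial>return borel 0) = (\<integral>x. h (ennreal x) \<partial>\<mu>)"
      unfolding \<mu>_def by (subst (1 2) integral_return) auto
    ultimately show "(\<lambda>n. \<integral>x. h (ennreal (x / c n)) \<partial>K (c n * u n)) \<longlonglongrightarrow> (\<integral>x. h (ennreal x) \<partial>\<mu>)"
      by (simp only: integral_rescale[OF Kn(2) h(1)])
  qed
  have scale_meas: "(\<lambda>w. f n (max 0 w)) \<in> borel_measurable borel" for n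
    by (rule measurable_compose[OF max_half_line f])
  have "(\<lambda>n. \<integral>x. f n (max 0 x) \<partial>distr (K (c n * u n)) borel (\<lambda>x. x / c n)) \<longlonglongrightarrow> (\<integral>x. L \<partial>\<mu>)"
  proof (rule extended_continuous_mapping[OF _ \<mu>_rd wc scale_meas _ B, where S="\<lambda>_. UNIV"])
    show "real_distribution (distr (K (c n * u n)) borel (\<lambda>x. x / c n))" for n
      by (rule prob_space.real_distribution_distr[OF Kn(1) xs])
    show "AE w in \<mu>. w \<noteq> 0 \<longrightarrow> (\<forall>ws. ws \<longlonglongrightarrow> w \<longrightarrow> (\<lambda>n. f n (max 0 (ws n))) \<longlonglongrightarrow> L)"
    proof -
      have "AE w in \<mu>. w = 0" unfolding \<mu>_def by (subst AE_return) auto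
      then show ?thesis by eventually_elim simp
    qed
    fix ws :: "nat \<Rightarrow> real" assume "ws \<longlonglongrightarrow> 0"
    from tendsto_max[OF tendsto_const[of 0] this] show "(\<lambda>n. f n (max 0 (ws n))) \<longlonglongrightarrow> L"
      by (intro lim) auto
  qed (auto intro: \<mu>_nn)
  moreover have "(\<integral>x. f n (max 0 x) \<partial>distr (K (c n * u n)) borel (\<lambda>x. x / c n)) = (\<integral>x. f n (x / c n) \<partial>K (c n * u n))" for n
  proof -
    have "(\<integral>x. f n (max 0 x) \<partial>distr (K (c n * u n)) borel (\<lambda>x. x / c n)) = (\<integral>x. f n (max 0 (x / c n)) \<partial>K (c n * u n))"
      by (rule integral_distr[OF xs scale_meas])
    also have "\<dots> = (\<integral>x. f n (x / c n) \<partial>K (c n * u n))"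
    proof (intro Bochner_Integration.integral_cong refl)
      fix x assume "x \<in> space (K (c n * u n))"
      then have "max 0 (x / c n) = x / c n" using c(2)[of n] by (simp add: Kn(3) max_def)
      then show "f n (max 0 (x / c n)) = f n (x / c n)" by (rule arg_cong)
    qed
    finally show ?thesis .
  qed
  moreover have "(\<integral>x. L \<partial>\<mu>) = L"
    using prob_space.prob_space[of \<mu>] \<mu>_rd by (simp add: real_distribution_def)
  ultimately show ?thesis by (simp only:)
qed

section \<open>Borel measures on topologies\<close>

lemma space_borel_of[simp]: "space (borel_of E) = topspace E"
  unfolding borel_of_def by (rule space_measure_of) (auto dest: openin_subset)

lemma openin_borel_of: "openin E U \<Longrightarrow> U \<in> sets (borel_of E)"
  unfolding borel_of_def by (subst sets_measure_of) (auto dest: openin_subset)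

lemma continuous_map_borel_of:
  assumes "continuous_map E euclidean f"
  shows "f \<in> borel_measurable (borel_of E)"
proof (rule borel_measurableI)
  fix S :: "'b set" assume "open S"
  then have "openin E {x \<in> topspace E. f x \<in> S}"
    using assms by (intro openin_continuous_map_preimage) auto
  then have "{x \<in> topspace E. f x \<in> S} \<in> sets (borel_of E)" by (rule openin_borel_of)
  moreover have "{x \<in> topspace E. f x \<in> S} = f -` S \<inter> space (borel_of E)" by auto
  ultimately show "f -` S \<inter> space (borel_of E) \<in> sets (borel_of E)" by simp
qed

text \<open>\<open>h\<close> may take values outside \<open>E\<close>. Asking only for preimages of
  open sets fits \<open>law_on\<close>, which discards that mass.\<close>

definition topologically_measurable :: "'a topology \<Rightarrow> 'w measure \<Rightarrow> ('w \<Rightarrow> 'a) \<Rightarrow> bool" where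
  "topologically_measurable E M h \<longleftrightarrow> (\<forall>U. openin E U \<longrightarrow> h -` U \<inter> space M \<in> sets M)"

lemma topologically_measurable_restrict:
  assumes h: "topologically_measurable E M h"
  shows "h \<in> measurable (restrict_space M (h -` topspace E \<inter> space M)) (borel_of E)"
  unfolding borel_of_def
proof (rule measurable_measure_of)
  show "{U. openin E U} \<subseteq> Pow (topspace E)" by (auto dest: openin_subset)
  show "h \<in> space (restrict_space M (h -` topspace E \<inter> space M)) \<rightarrow> topspace E"
    by (auto simp: space_restrict_space)
  fix U assume "U \<in> {U. openin E U}"
  then have U: "openin E U" by simp
  have "h -` U \<inter> space (restrict_space M (h -` topspace E \<inter> space M)) = h -` U \<inter> space M"
    using openin_subset[OF U] by (auto simp: space_restrict_space)
  moreover have "h -` U \<inter> space M \<in> sets M" "h -` topspace E \<inter> space M \<in> sets M"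
    using h U by (auto simp: topologically_measurable_def)
  ultimately show "h -` U \<inter> space (restrict_space M (h -` topspace E \<inter> space M)) \<in> sets (restrict_space M (h -` topspace E \<inter> space M))"
    using openin_subset[OF U] by (subst sets_restrict_space_iff) (auto simp: space_restrict_space)
qed

lemma topologically_measurable_total:
  assumes "topologically_measurable E M h" "\<And>\<omega>. \<omega> \<in> space M \<Longrightarrow> h \<omega> \<in> topspace E"
  shows "h \<in> measurable M (borel_of E)"
  unfolding borel_of_def
  by (rule measurable_measure_of) (use assms in \<open>auto simp: topologically_measurable_def dest: openin_subset\<close>)

lemma sets_law_on[simp]: "sets (law_on E M h) = sets (borel_of E)"
  by (simp add: law_on_def)

lemma radon_on_scaled_law:
  assumes M: "finite_measure M" and h: "topologically_measurable E M h"
  shows "radon_on E (scale_measure (ennreal s) (law_on E M h))"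
  unfolding radon_on_def
proof (intro conjI allI impI)
  fix C
  have "h -` topspace E \<inter> space M \<in> sets M" using h by (simp add: topologically_measurable_def)
  then have "finite_measure (law_on E M h)"
    unfolding law_on_def by (intro finite_measure.finite_measure_distr finite_measure_restrict_space M topologically_measurable_restrict h)
  then show "emeasure (scale_measure (ennreal s) (law_on E M h)) C < \<infinity>"
    using finite_measure.emeasure_finite[of "law_on E M h" C] by (simp add: ennreal_mult_eq_top_iff less_top[symmetric])
qed simp

text \<open>Replaces the restriction inside \<open>law_on\<close> by an integrand defined
  everywhere. For compactly supported continuous functions on an open subspace it also preserves
  continuity, see \<open>zero_extend_tendsto\<close>.\<close>

definition zero_extend :: "'a topology \<Rightarrow> ('a \<Rightarrow> real) \<Rightarrow> 'a \<Rightarrow> real" where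
  "zero_extend E f x = (if x \<in> topspace E then f x else 0)"

lemma zero_extend_measurable:
  assumes h: "topologically_measurable E M h" and f: "f \<in> borel_measurable (borel_of E)"
  shows "(\<lambda>\<omega>. zero_extend E f (h \<omega>)) \<in> borel_measurable M"
proof -
  let ?A = "h -` topspace E \<inter> space M"
  have A: "?A \<in> sets M" using h by (simp add: topologically_measurable_def)
  have "(\<lambda>\<omega>. f (h \<omega>)) \<in> borel_measurable (restrict_space M ?A)"
    by (rule measurable_compose[OF topologically_measurable_restrict[OF h] f])
  then have "(\<lambda>\<omega>. indicator ?A \<omega> *\<^sub>R f (h \<omega>)) \<in> borel_measurable M"
    using A by (subst (asm) borel_measurable_restrict_space_iff) auto
  then show ?thesis
    by (rule measurable_cong[THEN iffD1, rotated]) (auto simp: zero_extend_def)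
qed

lemma integral_law_on:
  assumes h: "topologically_measurable E M h" and f: "f \<in> borel_measurable (borel_of E)"
  shows "(\<integral>x. f x \<partial>law_on E M h) = (\<integral>\<omega>. zero_extend E f (h \<omega>) \<partial>M)"
proof -
  let ?A = "h -` topspace E \<inter> space M"
  have A: "?A \<in> sets M" using h by (simp add: topologically_measurable_def)
  have "(\<integral>x. f x \<partial>law_on E M h) = (\<integral>\<omega>. f (h \<omega>) \<partial>restrict_space M ?A)"
    unfolding law_on_def by (rule integral_distr[OF topologically_measurable_restrict[OF h] f])
  also have "\<dots> = (\<integral>\<omega>. indicator ?A \<omega> *\<^sub>R f (h \<omega>) \<partial>M)"
    using A by (intro integral_restrict_space) auto
  also have "\<dots> = (\<integral>\<omega>. zero_extend E f (h \<omega>) \<partial>M)"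
    by (intro Bochner_Integration.integral_cong) (auto simp: zero_extend_def)
  finally show ?thesis .
qed

text \<open>Both sides are read off the nonnegative integral, which treats non-integrable
  \<open>f\<close> in the same way.\<close>

lemma integral_scale_measure_nonneg:
  assumes f: "f \<in> borel_measurable N" "\<And>x. x \<in> space N \<Longrightarrow> 0 \<le> f x" and s: "0 \<le> s"
  shows "(\<integral>x. f x \<partial>scale_measure (ennreal s) N) = s * (\<integral>x. f x \<partial>N)"
proof -
  have f': "f \<in> borel_measurable (scale_measure (ennreal s) N)" using f(1) by (simp add: measurable_def space_scale_measure)
  have "(\<integral>x. f x \<partial>scale_measure (ennreal s) N) = enn2real (\<integral>\<^sup>+x. ennreal (f x) \<partial>scale_measure (ennreal s) N)"
    using f f' by (intro integral_eq_nn_integral AE_I2) (auto simp: space_scale_measure)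
  also have "\<dots> = enn2real (ennreal s * (\<integral>\<^sup>+x. ennreal (f x) \<partial>N))"
    using f(1) by (subst nn_integral_scale_measure) auto
  also have "\<dots> = s * enn2real (\<integral>\<^sup>+x. ennreal (f x) \<partial>N)" using s by (simp add: enn2real_mult)
  also have "\<dots> = s * (\<integral>x. f x \<partial>N)" using f by (subst integral_eq_nn_integral) (auto intro: AE_I2)
  finally show ?thesis .
qed

lemma integral_scaled_law_on:
  assumes h: "topologically_measurable E M h" and f: "f \<in> borel_measurable (borel_of E)"
    and f0: "\<And>x. x \<in> topspace E \<Longrightarrow> 0 \<le> f x" and s: "0 \<le> s"
  shows "(\<integral>x. f x \<partial>scale_measure (ennreal s) (law_on E M h)) = s * (\<integral>\<omega>. zero_extend E f (h \<omega>) \<partial>M)"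
proof -
  have "f \<in> borel_measurable (law_on E M h)" using f measurable_cong_sets[OF sets_law_on refl] by blast
  moreover have "space (law_on E M h) = topspace E" by (simp add: law_on_def)
  ultimately show ?thesis
    using f0 s by (subst integral_scale_measure_nonneg) (auto simp: integral_law_on[OF h f])
qed

lemma zero_extend_bounded:
  assumes f: "continuous_map E euclideanreal f" and C: "compactin E C" and f0: "\<And>x. x \<in> topspace E - C \<Longrightarrow> f x = 0"
  obtains B where "\<And>x. \<bar>zero_extend E f x\<bar> \<le> B"
proof -
  have "compact (f ` C)" using image_compactin[OF C f] by simp
  then obtain B where "\<And>y. y \<in> f ` C \<Longrightarrow> norm y \<le> B" using compact_imp_bounded bounded_iff by metis
  then have "\<bar>zero_extend E f x\<bar> \<le> max 0 B" for x
    using f0[of x] by (cases "x \<in> C") (auto simp: zero_extend_def le_max_iff_disj)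
  then show ?thesis by (rule that)
qed

text \<open>A limit inside the open set \<open>S\<close> is a limit in the subspace, where
  \<open>f\<close> is continuous. A limit outside \<open>S\<close> lies off the compact support,
  which is closed in the Hausdorff space \<open>T\<close>, so the extension eventually
  vanishes.\<close>

lemma zero_extend_tendsto:
  assumes T: "Hausdorff_space T" and S: "openin T S"
    and f: "continuous_map (subtopology T S) euclideanreal f" and C: "compactin (subtopology T S) C"
    and f0: "\<And>x. x \<in> topspace (subtopology T S) - C \<Longrightarrow> f x = 0" and lim: "limitin T q l F"
  shows "((\<lambda>n. zero_extend (subtopology T S) f (q n)) \<longlongrightarrow> zero_extend (subtopology T S) f l) F"
proof -
  have top: "topspace (subtopology T S) = S" using openin_subset[OF S] by (auto simp: topspace_subtopology)
  have C': "compactin T C" "C \<subseteq> S" using C by (auto simp: compactin_subtopology)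
  have cl: "closedin T C" using T C'(1) by (rule compactin_imp_closedin)
  have l: "l \<in> topspace T" using lim by (simp add: limitin_def)
  show ?thesis
  proof (cases "l \<in> S")
    case True
    then have ev: "\<forall>\<^sub>F n in F. q n \<in> S" using lim S by (simp add: limitin_def)
    then have "limitin (subtopology T S) q l F" using True lim by (simp add: limitin_subtopology)
    from continuous_map_limit[OF f this] have "((\<lambda>n. f (q n)) \<longlongrightarrow> f l) F" by (simp add: o_def)
    moreover have "\<forall>\<^sub>F n in F. f (q n) = zero_extend (subtopology T S) f (q n)"
      using ev by eventually_elim (simp add: zero_extend_def top del: topspace_subtopology)
    ultimately show ?thesis using True by (auto simp: zero_extend_def top simp del: topspace_subtopology intro: Lim_transform_eventually)
  next
    case False
    have "openin T (topspace T - C)" using cl by blast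
    moreover have "l \<in> topspace T - C" using False C'(2) l by blast
    ultimately have "\<forall>\<^sub>F n in F. q n \<in> topspace T - C" using lim unfolding limitin_def by blast
    then have "\<forall>\<^sub>F n in F. zero_extend (subtopology T S) f (q n) = 0"
      by eventually_elim (use f0 in \<open>auto simp: zero_extend_def top simp del: topspace_subtopology\<close>)
    then show ?thesis using False by (simp add: zero_extend_def top tendsto_eventually del: topspace_subtopology)
  qed
qed

section \<open>The space (0,\<infinity>] and its finite products with [0,\<infinity>]\<close>

lemma compact_pos_bounded_away:
  assumes "compactin pos_top C"
  obtains d :: real where "0 < d" "\<And>e. e \<in> C \<Longrightarrow> ennreal d \<le> e"
proof (cases "C = {}")
  case True
  then show ?thesis using that[of 1] by auto
next
  case False
  have C: "compact C" "C \<subseteq> {0<..}" using assms by (auto simp: pos_top_def compactin_subtopology)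
  obtain e where e: "e \<in> C" "\<And>e'. e' \<in> C \<Longrightarrow> e \<le> e'" using compact_attains_inf[OF C(1) False] by blast
  then have "0 < e" using C(2) by auto
  \<comment> \<open>Stepping strictly below the minimum yields a finite bound even when the minimum
    is infinity.\<close>
  then obtain d' where d': "0 < d'" "d' < e" using dense by blast
  then have "d' < top" using top.not_eq_extremum by fastforce
  then obtain d where d: "d' = ennreal d" "0 \<le> d" by (cases d') auto
  have "ennreal d \<le> x" if "x \<in> C" for x using e(2)[OF that] d'(2) d by auto
  moreover have "0 < d" using d d' by auto
  ultimately show ?thesis by (rule that[rotated])
qed

lemma openin_pos_top: "openin pos_top U \<Longrightarrow> open U"
  by (auto simp: pos_top_def intro: openin_open_trans)

lemma topspace_pos_top[simp]: "topspace pos_top = {0<..}"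
  by (simp add: pos_top_def)

lemma topologically_measurable_pos_top:
  assumes "h \<in> borel_measurable M"
  shows "topologically_measurable pos_top M h"
  unfolding topologically_measurable_def using assms openin_pos_top by (blast intro: measurable_sets borel_open)

text \<open>Common form of \<open>first_pos_top\<close> and \<open>last_free_top\<close>;
  \<open>Q\<close> marks the coordinates from which 0 is removed.\<close>

definition orthant_top :: "(nat \<Rightarrow> bool) \<Rightarrow> nat \<Rightarrow> (nat \<Rightarrow> ennreal) topology" where
  "orthant_top Q m = product_topology (\<lambda>i. if Q i then pos_top else euclidean) {..m}"

abbreviation full_top :: "nat \<Rightarrow> (nat \<Rightarrow> ennreal) topology" where
  "full_top m \<equiv> product_topology (\<lambda>_. euclidean) {..m}"

abbreviation orthant :: "(nat \<Rightarrow> bool) \<Rightarrow> nat \<Rightarrow> (nat \<Rightarrow> ennreal) set" where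
  "orthant Q m \<equiv> Pi\<^sub>E {..m} (\<lambda>i. if Q i then {0<..} else UNIV)"

lemma orthant_top_eq: "orthant_top Q m = subtopology (full_top m) (orthant Q m)"
proof -
  have "(\<lambda>i. if Q i then pos_top else euclidean) = (\<lambda>i. subtopology euclidean (if Q i then {0<..} else UNIV))"
    by (auto simp: fun_eq_iff pos_top_def)
  then show ?thesis by (simp add: orthant_top_def subtopology_product_topology)
qed

lemma topspace_orthant_top: "topspace (orthant_top Q m) = orthant Q m"
  unfolding orthant_top_def topspace_product_topology by (intro PiE_cong) auto

lemma openin_full_orthant: "openin (full_top m) (orthant Q m)"
  by (subst openin_PiE) auto

lemma Hausdorff_ennreal: "Hausdorff_space (euclidean :: ennreal topology)"
  unfolding Hausdorff_space_def using hausdorff by (fastforce simp: disjnt_def)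

lemma Hausdorff_full: "Hausdorff_space (full_top m)"
  by (simp add: Hausdorff_space_product_topology Hausdorff_ennreal)

lemma openin_orthant_imp_full: "openin (orthant_top Q m) U \<Longrightarrow> openin (full_top m) U"
  unfolding orthant_top_eq using openin_full_orthant openin_trans_full by blast

lemma openin_full_preimage:
  assumes "openin (full_top m) U"
  shows "open {q. restrict q {..m} \<in> U}"
proof -
  have "continuous_map euclidean (full_top m) (\<lambda>q. restrict q {..m})"
    unfolding continuous_map_componentwise
    using continuous_on_product_coordinates by auto
  from openin_continuous_map_preimage[OF this assms] show ?thesis by simp
qed

text \<open>Coordinatewise measurability suffices in the Borel structure of the full function type.
  Extending by 0 beyond \<open>m\<close> and then restricting, a continuous operation, carries this
  over to extensional paths.\<close>

lemma topologically_measurable_orthant: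
  assumes h: "\<And>i. i \<le> m \<Longrightarrow> (\<lambda>\<omega>. h \<omega> i) \<in> borel_measurable M"
  shows "topologically_measurable (orthant_top Q m) M (\<lambda>\<omega>. \<lambda>i\<in>{..m}. h \<omega> i)"
  unfolding topologically_measurable_def
proof (intro allI impI)
  fix U assume U: "openin (orthant_top Q m) U"
  define h' where "h' \<omega> i = (if i \<le> m then h \<omega> i else 0)" for \<omega> i
  have "h' \<in> borel_measurable M"
  proof (rule measurable_coordinatewise_then_product)
    show "(\<lambda>\<omega>. h' \<omega> i) \<in> borel_measurable M" for i
      by (cases "i \<le> m") (simp_all add: h'_def h)
  qed
  then have "h' -` {q. restrict q {..m} \<in> U} \<inter> space M \<in> sets M"
    by (rule measurable_sets[OF _ borel_open[OF openin_full_preimage[OF openin_orthant_imp_full[OF U]]]])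
  moreover have "(\<lambda>i\<in>{..m}. h' \<omega> i) = (\<lambda>i\<in>{..m}. h \<omega> i)" for \<omega> by (auto simp: h'_def)
  ultimately show "(\<lambda>\<omega>. \<lambda>i\<in>{..m}. h \<omega> i) -` U \<inter> space M \<in> sets M" by (simp add: vimage_def)
qed

lemma orthant_compact_bounded_away:
  assumes C: "compactin (orthant_top Q m) C" and i: "Q i" "i \<le> m"
  obtains d :: real where "0 < d" "\<And>q. q \<in> C \<Longrightarrow> ennreal d \<le> q i"
proof -
  have "continuous_map (orthant_top Q m) pos_top (\<lambda>q. q i)"
    unfolding orthant_top_def using continuous_map_product_projection[of i "{..m}" "\<lambda>i. if Q i then pos_top else euclidean"] i by simp
  from image_compactin[OF C this] obtain d where "0 < d" "\<And>e. e \<in> (\<lambda>q. q i) ` C \<Longrightarrow> ennreal d \<le> e"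
    by (rule compact_pos_bounded_away) blast
  then show ?thesis using that by auto
qed

section \<open>The limit measure\<close>

definition path_embed :: "nat \<Rightarrow> (nat \<Rightarrow> real) \<Rightarrow> nat \<Rightarrow> ennreal" where
  "path_embed m p = (\<lambda>i\<in>{..m}. ennreal (p i))"

text \<open>A test function on extended paths, pulled back to the real paths on which
  \<open>scaled_path_integral_tendsto\<close> operates.\<close>

definition path_fun :: "(nat \<Rightarrow> bool) \<Rightarrow> nat \<Rightarrow> ((nat \<Rightarrow> ennreal) \<Rightarrow> real) \<Rightarrow> (nat \<Rightarrow> real) \<Rightarrow> real" where
  "path_fun Q m f p = zero_extend (orthant_top Q m) f (path_embed m p)"

lemma path_embed_restrict: "path_embed m (\<lambda>i\<in>{..m}. p i) = path_embed m p"
  by (auto simp: path_embed_def)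

lemma path_fun_measurable:
  assumes "f \<in> borel_measurable (borel_of (orthant_top Q m))"
  shows "path_fun Q m f \<in> borel_measurable (Pi\<^sub>M {..m} (\<lambda>_. half_line))"
proof -
  have "topologically_measurable (orthant_top Q m) (Pi\<^sub>M {..m} (\<lambda>_. half_line)) (path_embed m)"
    unfolding path_embed_def[abs_def]
  proof (rule topologically_measurable_orthant)
    fix i assume "i \<le> m"
    then have "(\<lambda>p. p i) \<in> measurable (Pi\<^sub>M {..m} (\<lambda>_. half_line)) half_line"
      by (intro measurable_component_singleton) simp
    then have "(\<lambda>p. p i :: real) \<in> borel_measurable (Pi\<^sub>M {..m} (\<lambda>_. half_line))" by (rule borel_imp_half_line)
    then show "(\<lambda>p. ennreal (p i)) \<in> borel_measurable (Pi\<^sub>M {..m} (\<lambda>_. half_line))" by simp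
  qed
  from zero_extend_measurable[OF this assms] show ?thesis by (simp add: path_fun_def[abs_def])
qed

lemma path_fun_tendsto:
  assumes f: "continuous_map (orthant_top Q m) euclideanreal f" and C: "compactin (orthant_top Q m) C"
    and f0: "\<And>q. q \<in> topspace (orthant_top Q m) - C \<Longrightarrow> f q = 0"
    and lim: "\<And>i. i \<le> m \<Longrightarrow> ((\<lambda>n. P n i) \<longlongrightarrow> p i) F"
  shows "((\<lambda>n. path_fun Q m f (P n)) \<longlongrightarrow> path_fun Q m f p) F"
proof -
  have "limitin (full_top m) (\<lambda>n. path_embed m (P n)) (path_embed m p) F"
    unfolding limitin_componentwise using lim by (auto simp: path_embed_def intro: tendsto_ennrealI)
  from zero_extend_tendsto[OF Hausdorff_full openin_full_orthant f[unfolded orthant_top_eq] C[unfolded orthant_top_eq] f0[unfolded orthant_top_eq] this]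
  show ?thesis by (simp add: path_fun_def orthant_top_eq)
qed

text \<open>A compact support stays away from 0 in every marked coordinate. The case
  \<open>i = 0\<close> supplies the cutoff for the initial state; the other marked coordinates
  suppress paths that come near 0 too early.\<close>

lemma path_fun_vanishes:
  assumes C: "compactin (orthant_top Q m) C"
    and f0: "\<And>q. q \<in> topspace (orthant_top Q m) - C \<Longrightarrow> f q = 0" and i: "Q i" "i \<le> m"
  obtains d where "0 < d" "\<And>p. p i < d \<Longrightarrow> path_fun Q m f p = 0"
proof -
  obtain d where d: "0 < d" "\<And>q. q \<in> C \<Longrightarrow> ennreal d \<le> q i"
    using C i by (rule orthant_compact_bounded_away) blast
  have "path_fun Q m f p = 0" if "p i < d" for p
  proof -
    have "path_embed m p i < ennreal d" using that d i by (simp add: path_embed_def ennreal_lessI)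
    then have "path_embed m p \<notin> C" using d(2) by (auto simp: not_le[symmetric])
    then show ?thesis using f0 by (auto simp: path_fun_def zero_extend_def)
  qed
  with d(1) show ?thesis by (rule that)
qed

lemma scaled_path_eq: "scaled_path m c X \<omega> = path_embed m (\<lambda>i\<in>{..m}. X i \<omega> / c)"
  by (auto simp: scaled_path_def path_embed_def)

lemma first_pos_top_eq: "first_pos_top m = orthant_top (\<lambda>i. i = 0) m"
  by (simp add: first_pos_top_def orthant_top_def)

lemma last_free_top_eq: "last_free_top m = orthant_top (\<lambda>i. i < m) m"
  by (simp add: last_free_top_def orthant_top_def)

locale tail_measure =
  fixes \<nu> :: "ennreal measure" and G :: "real measure"
  assumes sets_\<nu>: "sets \<nu> = sets (borel_of pos_top)"
    and \<nu>_compact: "\<And>d::real. 0 < d \<Longrightarrow> emeasure \<nu> {ennreal d..} < \<infinity>"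
    and \<nu>_top: "AE e in \<nu>. e < top"
    and G: "G \<in> space (prob_algebra half_line)"
begin

lemma space_\<nu>: "space \<nu> = {0<..}"
  using sets_eq_imp_space_eq[OF sets_\<nu>] by simp

lemma id_\<nu>: "(\<lambda>e. e) \<in> borel_measurable \<nu>"
proof -
  have "(\<lambda>e. e) \<in> borel_measurable (borel_of pos_top)"
    by (rule continuous_map_borel_of) (auto simp: pos_top_def continuous_map_from_subtopology)
  then show ?thesis using measurable_cong_sets[OF sets_\<nu> refl] by blast
qed

lemma G_prob: "prob_space G" and G_sets: "sets G = sets half_line"
  using G by (auto simp: space_prob_algebra)

lemma G_measurable: "q \<in> measurable half_line L \<Longrightarrow> q \<in> measurable G L"
  by (rule half_line_measurable[OF G_sets])

lemma G_space: "space G = {0..}"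
  using sets_eq_imp_space_eq[OF G_sets] by (simp add: space_restrict_space)

abbreviation steps :: "nat \<Rightarrow> (nat \<Rightarrow> real) measure" where
  "steps m \<equiv> Pi\<^sub>M {1..m} (\<lambda>_. G)"

lemma steps_prob: "prob_space (steps m)"
  by (rule prob_space_PiM) (rule G_prob)

definition tail_map :: "nat \<Rightarrow> ennreal \<Rightarrow> (nat \<Rightarrow> real) \<Rightarrow> nat \<Rightarrow> ennreal" where
  "tail_map m x \<xi> = (\<lambda>n\<in>{..m}. x * ennreal (\<Prod>i\<in>{1..n}. \<xi> i))"

lemma step_measurable:
  assumes "i \<in> {1..m}"
  shows "(\<lambda>\<xi>. \<xi> i) \<in> borel_measurable (steps m)"
  by (rule measurable_compose[OF measurable_component_singleton[OF assms]]) (rule G_measurable, measurable)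

text \<open>Joint measurability in the starting point and the steps is what makes
  \<open>tail_chain_law\<close> a kernel. The value lies in the space because coordinate 0 is the
  positive start times an empty product.\<close>

lemma tail_map_measurable2:
  "case_prod (tail_map m) \<in> measurable (\<nu> \<Otimes>\<^sub>M steps m) (borel_of (first_pos_top m))"
proof (rule topologically_measurable_total)
  have "topologically_measurable (first_pos_top m) (\<nu> \<Otimes>\<^sub>M steps m) (\<lambda>z. \<lambda>n\<in>{..m}. fst z * ennreal (\<Prod>i\<in>{1..n}. snd z i))"
    unfolding first_pos_top_eq
  proof (rule topologically_measurable_orthant)
    fix n assume n: "n \<le> m"
    have 1: "fst \<in> borel_measurable (\<nu> \<Otimes>\<^sub>M steps m)"
      using measurable_compose[OF measurable_fst id_\<nu>] by simp
    have "(\<lambda>z. snd z i) \<in> borel_measurable (\<nu> \<Otimes>\<^sub>M steps m)" if "i \<in> {1..n}" for i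
      using that n by (intro measurable_compose[OF measurable_snd step_measurable]) auto
    then show "(\<lambda>z. fst z * ennreal (\<Prod>i\<in>{1..n}. snd z i)) \<in> borel_measurable (\<nu> \<Otimes>\<^sub>M steps m)"
      using 1 by (intro borel_measurable_times_ennreal measurable_compose[OF _ measurable_ennreal] borel_measurable_prod)
  qed
  then show "topologically_measurable (first_pos_top m) (\<nu> \<Otimes>\<^sub>M steps m) (case_prod (tail_map m))"
    by (simp add: tail_map_def case_prod_beta')
  show "case_prod (tail_map m) z \<in> topspace (first_pos_top m)" if "z \<in> space (\<nu> \<Otimes>\<^sub>M steps m)" for z
    using that by (auto simp: first_pos_top_eq topspace_orthant_top tail_map_def space_pair_measure space_\<nu> split: if_splits)
qed

lemma tail_map_measurable:
  "x \<in> space \<nu> \<Longrightarrow> tail_map m x \<in> measurable (steps m) (borel_of (first_pos_top m))"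
  using measurable_compose[OF measurable_Pair1' tail_map_measurable2] by simp

lemma tail_chain_law_eq: "tail_chain_law G m x = distr (steps m) (borel_of (first_pos_top m)) (tail_map m x)"
  by (simp add: tail_chain_law_def tail_map_def[abs_def])

lemma tail_chain_law_measurable:
  "tail_chain_law G m \<in> measurable \<nu> (subprob_algebra (borel_of (first_pos_top m)))"
  unfolding tail_chain_law_eq[abs_def]
proof (rule measurable_distr2[OF tail_map_measurable2])
  show "(\<lambda>x. steps m) \<in> measurable \<nu> (subprob_algebra (steps m))"
    using steps_prob by (auto simp: space_subprob_algebra prob_space_imp_subprob_space)
qed

lemma space_\<nu>_ne: "space \<nu> \<noteq> {}"
proof -
  have "1 \<in> space \<nu>" by (simp add: space_\<nu>)
  then show ?thesis by blast
qed

lemma sets_nu_star: "sets (nu_star \<nu> G m) = sets (borel_of (first_pos_top m))"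
  unfolding nu_star_def by (rule sets_bind) (auto simp: tail_chain_law_def space_\<nu>_ne)

lemma space_nu_star: "space (nu_star \<nu> G m) = topspace (first_pos_top m)"
  using sets_eq_imp_space_eq[OF sets_nu_star] by simp

lemma nu_star_measurable:
  "f \<in> measurable (borel_of (first_pos_top m)) L \<Longrightarrow> f \<in> measurable (nu_star \<nu> G m) L"
  using measurable_cong_sets[OF sets_nu_star refl] by blast

lemma nn_integral_nu_star:
  assumes f: "f \<in> borel_measurable (borel_of (first_pos_top m))"
  shows "(\<integral>\<^sup>+q. f q \<partial>nu_star \<nu> G m) = (\<integral>\<^sup>+x. \<integral>\<^sup>+\<xi>. f (tail_map m x \<xi>) \<partial>steps m \<partial>\<nu>)"
proof -
  have "(\<integral>\<^sup>+q. f q \<partial>nu_star \<nu> G m) = (\<integral>\<^sup>+x. \<integral>\<^sup>+q. f q \<partial>tail_chain_law G m x \<partial>\<nu>)"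
    unfolding nu_star_def by (rule nn_integral_bind[OF f tail_chain_law_measurable])
  also have "\<dots> = (\<integral>\<^sup>+x. \<integral>\<^sup>+\<xi>. f (tail_map m x \<xi>) \<partial>steps m \<partial>\<nu>)"
    unfolding tail_chain_law_eq using f
    by (intro nn_integral_cong, subst nn_integral_distr[OF tail_map_measurable]) simp_all
  finally show ?thesis .
qed

lemma tail_map_eq:
  assumes "x < top" "\<xi> \<in> space (steps m)"
  shows "tail_map m x \<xi> = path_embed m (tail_path m (enn2real x) \<xi>)"
proof -
  have "(\<Prod>i\<in>{1..n}. \<xi> i) \<ge> 0" if "n \<le> m" for n
    using assms(2) that by (intro prod_nonneg) (auto simp: space_PiM G_space PiE_iff)
  then show ?thesis using assms(1)
    by (auto simp: tail_map_def path_embed_def tail_path_def fun_eq_iff ennreal_mult ennreal_enn2real)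
qed

text \<open>As \<open>\<nu>\<close> may be infinite and \<open>f\<close> is not assumed integrable,
  the outer integral is unfolded as a nonnegative integral. The passage to real paths is then an
  almost everywhere identity, valid off the point infinity.\<close>

lemma integral_nu_star:
  assumes f: "f \<in> borel_measurable (borel_of (first_pos_top m))"
    and f0: "\<And>q. 0 \<le> f q" and B: "\<And>q. \<bar>f q\<bar> \<le> B"
  shows "(\<integral>q. f q \<partial>nu_star \<nu> G m) = tail_integral \<nu> G m (\<lambda>p. f (path_embed m p))"
proof -
  interpret S: prob_space "steps m" by (rule steps_prob)
  let ?I = "\<lambda>x. \<integral>\<xi>. f (tail_map m x \<xi>) \<partial>steps m"
  have inner: "(\<integral>\<^sup>+\<xi>. ennreal (f (tail_map m x \<xi>)) \<partial>steps m) = ennreal (?I x)" if "x \<in> space \<nu>" for x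
  proof (rule nn_integral_eq_integral)
    show "integrable (steps m) (\<lambda>\<xi>. f (tail_map m x \<xi>))"
      using measurable_compose[OF tail_map_measurable[OF that] f] B by (intro S.integrable_const_bound[where B=B]) auto
  qed (simp add: f0)
  have I_meas: "?I \<in> borel_measurable \<nu>"
  proof (rule borel_measurable_kernel_integral[where N="steps m"])
    show "(\<lambda>(x, \<xi>). f (tail_map m x \<xi>)) \<in> borel_measurable (\<nu> \<Otimes>\<^sub>M steps m)"
      using measurable_compose[OF tail_map_measurable2 f] by (simp add: case_prod_beta')
    show "(\<lambda>x. steps m) \<in> measurable \<nu> (subprob_algebra (steps m))"
      using steps_prob by (auto simp: space_subprob_algebra prob_space_imp_subprob_space)
  qed
  have "(\<integral>q. f q \<partial>nu_star \<nu> G m) = enn2real (\<integral>\<^sup>+q. ennreal (f q) \<partial>nu_star \<nu> G m)"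
    using nu_star_measurable[OF f] f0 by (intro integral_eq_nn_integral) auto
  also have "(\<integral>\<^sup>+q. ennreal (f q) \<partial>nu_star \<nu> G m) = (\<integral>\<^sup>+x. \<integral>\<^sup>+\<xi>. ennreal (f (tail_map m x \<xi>)) \<partial>steps m \<partial>\<nu>)"
    using f by (intro nn_integral_nu_star) auto
  also have "\<dots> = (\<integral>\<^sup>+x. ennreal (?I x) \<partial>\<nu>)"
    by (intro nn_integral_cong inner)
  also have "enn2real \<dots> = (\<integral>x. ?I x \<partial>\<nu>)"
    using I_meas f0 by (intro integral_eq_nn_integral[symmetric]) (auto intro!: AE_I2 Bochner_Integration.integral_nonneg)
  also have "\<dots> = tail_integral \<nu> G m (\<lambda>p. f (path_embed m p))"
    unfolding tail_integral_def
  proof (rule Bochner_Integration.integral_cong_AE[OF I_meas])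
    show eq: "AE x in \<nu>. ?I x = (\<integral>\<xi>. f (path_embed m (tail_path m (enn2real x) \<xi>)) \<partial>steps m)"
      using \<nu>_top
    proof eventually_elim
      case (elim x)
      show ?case by (intro Bochner_Integration.integral_cong refl) (simp add: tail_map_eq[OF elim])
    qed
    show "(\<lambda>x. \<integral>\<xi>. f (path_embed m (tail_path m (enn2real x) \<xi>)) \<partial>steps m) \<in> borel_measurable \<nu>"
    proof (rule measurable_cong[THEN iffD1])
      \<comment> \<open>The inner integral at infinity, where \<open>enn2real\<close> gives 0; it
        exhibits the integrand as a two-case measurable function.\<close>
      let ?K = "\<integral>\<xi>. f (path_embed m (tail_path m 0 \<xi>)) \<partial>steps m"
      show "(if x < top then ?I x else ?K) = (\<integral>\<xi>. f (path_embed m (tail_path m (enn2real x) \<xi>)) \<partial>steps m)" for x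
        by (cases "x < top") (auto simp: tail_map_eq less_top[symmetric] intro!: Bochner_Integration.integral_cong)
      have "{x \<in> space \<nu>. x < top} \<in> sets \<nu>"
        using measurable_sets[OF id_\<nu>, of "{..<top}"] by (simp add: vimage_def Int_def conj_commute)
      then show "(\<lambda>x. if x < top then ?I x else ?K) \<in> borel_measurable \<nu>"
        using I_meas by (intro measurable_If) auto
    qed
  qed
  finally show ?thesis .
qed

text \<open>The tail chain starts at its parameter, so the event on the initial coordinate has
  exactly the mass of [d,\<infinity>] under \<open>\<nu>\<close>.\<close>

lemma nu_star_away:
  assumes d: "0 < d" and C: "C \<subseteq> {q \<in> topspace (first_pos_top m). ennreal d \<le> q 0}"
  shows "emeasure (nu_star \<nu> G m) C < \<infinity>"
proof -
  interpret S: prob_space "steps m" by (rule steps_prob)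
  let ?A = "{q \<in> topspace (first_pos_top m). ennreal d \<le> q 0}"
  have "continuous_map (first_pos_top m) euclidean (\<lambda>q. q 0)"
  proof -
    have "continuous_map (first_pos_top m) pos_top (\<lambda>q. q 0)"
      unfolding first_pos_top_def using continuous_map_product_projection[of 0 "{..m}" "\<lambda>i. if i = 0 then pos_top else euclidean"] by simp
    then show ?thesis unfolding pos_top_def by (rule continuous_map_into_fulltopology)
  qed
  from measurable_sets[OF continuous_map_borel_of[OF this], of "{ennreal d..}"]
  have A: "?A \<in> sets (borel_of (first_pos_top m))" by (simp add: vimage_def Int_def conj_commute)
  have "emeasure (nu_star \<nu> G m) C \<le> emeasure (nu_star \<nu> G m) ?A"
    using C A by (intro emeasure_mono) (auto simp: sets_nu_star)
  also have "\<dots> = (\<integral>\<^sup>+q. indicator ?A q \<partial>nu_star \<nu> G m)"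
    using A by (simp add: sets_nu_star)
  also have "\<dots> = (\<integral>\<^sup>+x. \<integral>\<^sup>+\<xi>. indicator ?A (tail_map m x \<xi>) \<partial>steps m \<partial>\<nu>)"
    using A by (intro nn_integral_nu_star) auto
  also have "\<dots> \<le> (\<integral>\<^sup>+x. \<integral>\<^sup>+\<xi>. indicator {ennreal d..} x \<partial>steps m \<partial>\<nu>)"
    by (intro nn_integral_mono) (auto simp: indicator_def tail_map_def)
  also have "\<dots> = (\<integral>\<^sup>+x. indicator {ennreal d..} x \<partial>\<nu>)"
    by (simp add: S.emeasure_space_1 del: One_nat_def)
  also have "\<dots> = emeasure \<nu> {ennreal d..}"
  proof (rule nn_integral_indicator)
    have "{ennreal d..} \<subseteq> space \<nu>" using d by (auto simp: space_\<nu> intro: less_le_trans[of _ "ennreal d"])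
    then show "{ennreal d..} \<in> sets \<nu>"
      using measurable_sets[OF id_\<nu>, of "{ennreal d..}"] by (simp add: Int_absorb2)
  qed
  also have "\<dots> < \<infinity>" using d by (rule \<nu>_compact)
  finally show ?thesis .
qed

lemma radon_on_nu_star: "radon_on (first_pos_top m) (nu_star \<nu> G m)"
  unfolding radon_on_def
proof (intro conjI allI impI sets_nu_star)
  fix C assume C: "compactin (first_pos_top m) C"
  obtain d where "0 < d" "\<And>q. q \<in> C \<Longrightarrow> ennreal d \<le> q 0"
    using C unfolding first_pos_top_eq by (rule orthant_compact_bounded_away[where i=0]) auto
  moreover have "C \<subseteq> topspace (first_pos_top m)" using C by (rule compactin_subset_topspace)
  ultimately show "emeasure (nu_star \<nu> G m) C < \<infinity>" by (intro nu_star_away) auto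
qed

text \<open>For \<open>1 \<le> m\<close> coordinate 0 is among the positive ones, so the space with
  free last coordinate is an open part of the space carrying \<open>nu_star\<close>.\<close>

lemma topologically_measurable_nu_star:
  assumes "1 \<le> m"
  shows "topologically_measurable (last_free_top m) (nu_star \<nu> G m) (\<lambda>q. q)"
  unfolding topologically_measurable_def
proof (intro allI impI)
  fix U assume U: "openin (last_free_top m) U"
  have sub: "orthant (\<lambda>i. i < m) m \<subseteq> orthant (\<lambda>i. i = 0) m"
    using assms by (auto simp: PiE_iff split: if_splits)
  have "U \<subseteq> orthant (\<lambda>i. i < m) m"
    using openin_subset[OF U] unfolding last_free_top_eq topspace_orthant_top .
  then have "U \<subseteq> orthant (\<lambda>i. i = 0) m" using sub by blast
  moreover have "openin (full_top m) U"
    using U unfolding last_free_top_eq by (rule openin_orthant_imp_full)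
  ultimately have "openin (first_pos_top m) U"
    unfolding first_pos_top_eq orthant_top_eq openin_subtopology by (intro exI[of _ U]) (auto simp: Int_absorb2)
  then have "U \<in> sets (nu_star \<nu> G m)" unfolding sets_nu_star by (rule openin_borel_of)
  then show "(\<lambda>q. q) -` U \<inter> space (nu_star \<nu> G m) \<in> sets (nu_star \<nu> G m)" by simp
qed

lemma radon_on_law_nu_star:
  assumes m: "1 \<le> m"
  shows "radon_on (last_free_top m) (law_on (last_free_top m) (nu_star \<nu> G m) (\<lambda>q. q))"
  unfolding radon_on_def
proof (intro conjI allI impI sets_law_on)
  fix C assume C: "compactin (last_free_top m) C"
  show "emeasure (law_on (last_free_top m) (nu_star \<nu> G m) (\<lambda>q. q)) C < \<infinity>"
  proof (cases "C \<in> sets (borel_of (last_free_top m))")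
    case True
    let ?A = "(\<lambda>q. q) -` topspace (last_free_top m) \<inter> space (nu_star \<nu> G m)"
    note tm = topologically_measurable_nu_star[OF m]
    have A: "?A \<in> sets (nu_star \<nu> G m)" using tm by (simp add: topologically_measurable_def)
    obtain d where d: "0 < d" "\<And>q. q \<in> C \<Longrightarrow> ennreal d \<le> q 0"
      using C unfolding last_free_top_eq by (rule orthant_compact_bounded_away[where i=0]) (use m in auto)
    have "emeasure (law_on (last_free_top m) (nu_star \<nu> G m) (\<lambda>q. q)) C
        = emeasure (restrict_space (nu_star \<nu> G m) ?A) ((\<lambda>q. q) -` C \<inter> space (restrict_space (nu_star \<nu> G m) ?A))"
      unfolding law_on_def by (rule emeasure_distr[OF topologically_measurable_restrict[OF tm] True])
    also have "\<dots> = emeasure (nu_star \<nu> G m) ((\<lambda>q. q) -` C \<inter> space (restrict_space (nu_star \<nu> G m) ?A))"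
      using A by (intro emeasure_restrict_space) (auto simp: space_restrict_space)
    also have "\<dots> < \<infinity>"
      using d by (intro nu_star_away[OF d(1)]) (auto simp: space_restrict_space space_nu_star)
    finally show ?thesis .
  qed (simp add: emeasure_notin_sets)
qed

end

section \<open>Approach of the tail chain to zero\<close>

text \<open>Reduces each of the four claims to the convergence of \<open>t\<close> times an
  expectation. Negative \<open>t\<close>, which \<open>ennreal\<close> turns into 0, are irrelevant
  at infinity.\<close>

lemma vague_conv_scaled_lawI:
  fixes E :: "'a topology"
  assumes M: "\<And>t. finite_measure (M t)" and h: "\<And>t. topologically_measurable E (M t) (h t)"
    and \<mu>: "radon_on E \<mu>"
    and lim: "\<And>f C. continuous_map E euclideanreal f \<Longrightarrow> (\<And>x. x \<in> topspace E \<Longrightarrow> 0 \<le> f x) \<Longrightarrow>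
      compactin E C \<Longrightarrow> (\<And>x. x \<in> topspace E - C \<Longrightarrow> f x = 0) \<Longrightarrow>
      ((\<lambda>t. t * (\<integral>\<omega>. zero_extend E f (h t \<omega>) \<partial>M t)) \<longlongrightarrow> (\<integral>x. f x \<partial>\<mu>)) at_top"
  shows "vague_conv E (\<lambda>t. scale_measure (ennreal t) (law_on E (M t) (h t))) \<mu> at_top"
  unfolding vague_conv_def
proof (intro conjI allI impI \<mu>)
  show "\<forall>\<^sub>F t in at_top. radon_on E (scale_measure (ennreal t) (law_on E (M t) (h t)))"
    by (intro always_eventually allI radon_on_scaled_law M h)
  fix f :: "'a \<Rightarrow> real"
  assume "continuous_map E euclideanreal f \<and> (\<forall>x\<in>topspace E. 0 \<le> f x) \<and> (\<exists>C. compactin E C \<and> (\<forall>x\<in>topspace E - C. f x = 0))"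
  then obtain C where f: "continuous_map E euclideanreal f" "\<And>x. x \<in> topspace E \<Longrightarrow> 0 \<le> f x"
    and C: "compactin E C" "\<And>x. x \<in> topspace E - C \<Longrightarrow> f x = 0" by blast
  have "\<forall>\<^sub>F t in at_top. t * (\<integral>\<omega>. zero_extend E f (h t \<omega>) \<partial>M t) = (\<integral>x. f x \<partial>scale_measure (ennreal t) (law_on E (M t) (h t)))"
    using eventually_ge_at_top[of 0]
  proof eventually_elim
    case (elim t)
    show ?case by (rule integral_scaled_law_on[OF h continuous_map_borel_of[OF f(1)] f(2) elim, symmetric])
  qed
  from Lim_transform_eventually[OF lim[OF f C] this]
  show "((\<lambda>t. \<integral>x. f x \<partial>scale_measure (ennreal t) (law_on E (M t) (h t))) \<longlongrightarrow> (\<integral>x. f x \<partial>\<mu>)) at_top" .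
qed

text \<open>Unrolls the recursion: \<open>k\<close> is the first time at which \<open>p\<close>
  vanishes, and it is positive because \<open>p 0\<close> is.\<close>

lemma path_conv_cases:
  assumes "path_conv Z W m P p"
  obtains "\<And>i. i \<le> m \<Longrightarrow> 0 < p i" "\<And>i. i \<le> m \<Longrightarrow> (\<lambda>n. P n i) \<longlonglongrightarrow> p i"
  | k where "0 < k" "k \<le> m" "\<And>i. i < k \<Longrightarrow> 0 < p i" "\<And>i. i < k \<Longrightarrow> (\<lambda>n. P n i) \<longlonglongrightarrow> p i"
      "Z (\<lambda>n. P n k)" "\<And>i. k < i \<Longrightarrow> i \<le> m \<Longrightarrow> W (\<lambda>n. P n i)" "\<And>i. k \<le> i \<Longrightarrow> i \<le> m \<Longrightarrow> p i = 0"
proof -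
  have "(\<forall>i\<le>m. 0 < p i \<and> (\<lambda>n. P n i) \<longlonglongrightarrow> p i) \<or>
    (\<exists>k. 0 < k \<and> k \<le> m \<and> (\<forall>i<k. 0 < p i \<and> (\<lambda>n. P n i) \<longlonglongrightarrow> p i) \<and> Z (\<lambda>n. P n k) \<and>
      (\<forall>i. k < i \<longrightarrow> i \<le> m \<longrightarrow> W (\<lambda>n. P n i)) \<and> (\<forall>i. k \<le> i \<longrightarrow> i \<le> m \<longrightarrow> p i = 0))"
    using assms
  proof (induction m)
    case 0
    then show ?case by simp
  next
    case (Suc m)
    then have "path_conv Z W m P p" by simp
    from Suc.IH[OF this] show ?case
    proof (elim disjE exE)
      assume *: "\<forall>i\<le>m. 0 < p i \<and> (\<lambda>n. P n i) \<longlonglongrightarrow> p i"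
      then have "0 < p (Suc m) \<and> (\<lambda>n. P n (Suc m)) \<longlonglongrightarrow> p (Suc m) \<or> p (Suc m) = 0 \<and> Z (\<lambda>n. P n (Suc m))"
        using Suc.prems by simp
      then show ?thesis
      proof
        assume "0 < p (Suc m) \<and> (\<lambda>n. P n (Suc m)) \<longlonglongrightarrow> p (Suc m)"
        then show ?thesis using * by (simp add: le_Suc_eq)
      next
        assume "p (Suc m) = 0 \<and> Z (\<lambda>n. P n (Suc m))"
        then show ?thesis using * by (intro disjI2 exI[of _ "Suc m"]) auto
      qed
    next
      fix k assume k: "0 < k \<and> k \<le> m \<and> (\<forall>i<k. 0 < p i \<and> (\<lambda>n. P n i) \<longlonglongrightarrow> p i) \<and> Z (\<lambda>n. P n k) \<and>
        (\<forall>i. k < i \<longrightarrow> i \<le> m \<longrightarrow> W (\<lambda>n. P n i)) \<and> (\<forall>i. k \<le> i \<longrightarrow> i \<le> m \<longrightarrow> p i = 0)"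
      then have "p m = 0" by simp
      then have "p (Suc m) = 0 \<and> W (\<lambda>n. P n (Suc m))" using Suc.prems by simp
      then show ?thesis using k by (intro disjI2 exI[of _ k]) (auto simp: le_Suc_eq)
    qed
  qed
  then show ?thesis
  proof (elim disjE exE)
    assume "\<forall>i\<le>m. 0 < p i \<and> (\<lambda>n. P n i) \<longlonglongrightarrow> p i"
    then show ?thesis by (intro that(1)) auto
  next
    fix k assume "0 < k \<and> k \<le> m \<and> (\<forall>i<k. 0 < p i \<and> (\<lambda>n. P n i) \<longlonglongrightarrow> p i) \<and> Z (\<lambda>n. P n k) \<and>
        (\<forall>i. k < i \<longrightarrow> i \<le> m \<longrightarrow> W (\<lambda>n. P n i)) \<and> (\<forall>i. k \<le> i \<longrightarrow> i \<le> m \<longrightarrow> p i = 0)"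
    then show ?thesis by (intro that(2)[of k]) auto
  qed
qed

lemma path_conv_tendsto:
  assumes "path_conv Z W m P p" and Z: "\<And>s. Z s \<Longrightarrow> s \<longlonglongrightarrow> 0" and W: "\<And>s. W s \<Longrightarrow> s \<longlonglongrightarrow> 0" and "i \<le> m"
  shows "(\<lambda>n. P n i) \<longlonglongrightarrow> p i"
  using assms(1)
proof (cases rule: path_conv_cases)
  case 1
  then show ?thesis using \<open>i \<le> m\<close> by simp
next
  case (2 k)
  consider "i < k" | "i = k" | "k < i" by linarith
  then show ?thesis
    using 2 Z W \<open>i \<le> m\<close> by cases auto
qed

section \<open>Hitting times and paths truncated at the boundary\<close>

lemma le_hitting_time_iff: "enat m \<le> hitting_time y X t \<omega> \<longleftrightarrow> (\<forall>j<m. t * y t < X j \<omega>)"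
  unfolding hitting_time_def le_Inf_iff by (auto simp: not_le[symmetric])

lemma less_hitting_time_iff: "enat n < hitting_time y X t \<omega> \<longleftrightarrow> (\<forall>j\<le>n. t * y t < X j \<omega>)"
  using le_hitting_time_iff[of "Suc n" y X t \<omega>] by (simp add: Suc_ile_eq less_Suc_eq_le)

text \<open>The extremal component as a function of the scaled path. Division by the scale c turns
  the barrier \<open>c * y c\<close> into \<open>\<eta> = y c\<close>; the strict inequality mirrors
  the weak one in \<open>hitting_time\<close>.\<close>

definition truncate_path :: "real \<Rightarrow> (nat \<Rightarrow> real) \<Rightarrow> nat \<Rightarrow> real" where
  "truncate_path \<eta> p i = (if \<forall>j\<le>i. \<eta> < p j then p i else 0)"

lemma scaled_extremal_component:
  assumes "0 < c"
  shows "scaled_path m c (extremal_component y X c) \<omega> = path_embed m (truncate_path (y c) (\<lambda>i\<in>{..m}. X i \<omega> / c))"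
proof -
  have "(\<forall>j\<le>i. c * y c < X j \<omega>) \<longleftrightarrow> (\<forall>j\<le>i. y c < (\<lambda>i\<in>{..m}. X i \<omega> / c) j)" if "i \<le> m" for i
    using that assms by (auto simp: field_simps)
  then show ?thesis
    by (auto simp: scaled_path_def path_embed_def truncate_path_def extremal_component_def less_hitting_time_iff fun_eq_iff)
qed

lemma truncate_path_measurable:
  "(\<lambda>p. \<lambda>i\<in>{..m}. truncate_path \<eta> p i) \<in> measurable (Pi\<^sub>M {..m} (\<lambda>_. half_line)) (Pi\<^sub>M {..m} (\<lambda>_. half_line))"
proof (rule measurable_restrict)
  fix i assume i: "i \<in> {..m}"
  have c: "(\<lambda>p. p j) \<in> measurable (Pi\<^sub>M {..m} (\<lambda>_. half_line)) (half_line :: real measure)" if "j \<le> i" for j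
    using that i by (intro measurable_component_singleton) auto
  have b: "(\<lambda>p. p j) \<in> borel_measurable (Pi\<^sub>M {..m} (\<lambda>_. half_line :: real measure))" if "j \<le> i" for j
    using c[OF that] by (rule borel_imp_half_line)
  have "{p \<in> space (Pi\<^sub>M {..m} (\<lambda>_. half_line)). \<forall>j\<in>{..i}. \<eta> < p j} \<in> sets (Pi\<^sub>M {..m} (\<lambda>_. half_line))"
    using b by (intro sets.sets_Collect_finite_All) (auto intro: borel_measurable_less)
  then have S: "{p \<in> space (Pi\<^sub>M {..m} (\<lambda>_. half_line)). \<forall>j\<le>i. \<eta> < p j} \<in> sets (Pi\<^sub>M {..m} (\<lambda>_. half_line))"
    by (simp only: Ball_def atMost_iff)
  show "(\<lambda>p. truncate_path \<eta> p i) \<in> measurable (Pi\<^sub>M {..m} (\<lambda>_. half_line)) half_line"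
    unfolding truncate_path_def
    by (rule measurable_If[OF c[OF order_refl] measurable_const S]) (simp add: space_restrict_space)
qed

text \<open>As long as the limit is positive, the coordinates eventually exceed the vanishing
  threshold and are kept. From the first zero of \<open>p\<close> on, the threshold has been hit and
  truncation gives exactly 0, so the mode \<open>W\<close> of the later coordinates is never
  consulted.\<close>

lemma truncate_path_tendsto:
  assumes "path_conv (\<lambda>s. \<forall>n. s n \<le> z n) W m P p" and z: "z \<longlonglongrightarrow> 0" and i: "i \<le> m"
  shows "(\<lambda>n. truncate_path (z n) (P n) i) \<longlonglongrightarrow> p i"
proof -
  have all: "(\<lambda>n. truncate_path (z n) (P n) i) \<longlonglongrightarrow> p i"
    if pos: "\<And>j. j \<le> i \<Longrightarrow> 0 < p j" and lim: "\<And>j. j \<le> i \<Longrightarrow> (\<lambda>n. P n j) \<longlonglongrightarrow> p j"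
  proof -
    have "\<forall>\<^sub>F n in sequentially. \<forall>j\<in>{..i}. z n < P n j"
    proof (intro eventually_ball_finite ballI)
      fix j assume j: "j \<in> {..i}"
      have "(\<lambda>n. P n j - z n) \<longlonglongrightarrow> p j - 0" using lim z j by (intro tendsto_diff) auto
      then have "\<forall>\<^sub>F n in sequentially. 0 < P n j - z n" using pos[of j] j by (intro order_tendstoD(1)) auto
      then show "\<forall>\<^sub>F n in sequentially. z n < P n j" by eventually_elim simp
    qed simp
    then have "\<forall>\<^sub>F n in sequentially. P n i = truncate_path (z n) (P n) i"
      by eventually_elim (simp add: truncate_path_def)
    from Lim_transform_eventually[OF lim[OF order_refl] this] show ?thesis .
  qed
  show ?thesis
    using assms(1)
  proof (cases rule: path_conv_cases)
    case 1
    then show ?thesis using i by (intro all) auto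
  next
    case (2 k)
    show ?thesis
    proof (cases "i < k")
      case True
      then show ?thesis using 2 by (intro all) auto
    next
      case False
      then have "truncate_path (z n) (P n) i = 0" for n
        using 2(5) by (auto simp: truncate_path_def not_le[symmetric])
      moreover have "p i = 0" using False 2(7) i by simp
      ultimately show ?thesis by simp
    qed
  qed
qed

text \<open>\<open>X0_tail\<close> is the vague convergence of the initial law with test functions
  viewed on all of [0,\<infinity>]: compact support in (0,\<infinity>] amounts to vanishing near
  0.\<close>

locale heavy_tailed_chain = prob_space M + tail_measure \<nu> G
  for M :: "'w measure" and \<nu> :: "ennreal measure" and G :: "real measure" +
  fixes K :: "real \<Rightarrow> real measure" and X :: "nat \<Rightarrow> 'w \<Rightarrow> real" and b :: "real \<Rightarrow> real"
  assumes K: "K \<in> measurable half_line (prob_algebra half_line)"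
    and KG: "attracted K G"
    and X: "markov_chain M K X"
    and b: "filterlim b at_top at_top"
    and \<nu>_pos: "\<And>d::real. 0 < d \<Longrightarrow> 0 < emeasure \<nu> {ennreal d..}"
    and X0_tail: "\<And>h :: ennreal \<Rightarrow> real. continuous_on UNIV h \<Longrightarrow> (\<And>e. 0 \<le> h e) \<Longrightarrow>
      (\<exists>d>0. \<forall>e<ennreal d. h e = 0) \<Longrightarrow>
      ((\<lambda>t. t * (\<integral>\<omega>. h (ennreal (X 0 \<omega> / b t)) \<partial>M)) \<longlongrightarrow> (\<integral>e. h e \<partial>\<nu>)) at_top"
begin

lemma X_half_line: "X n \<in> measurable M half_line"
  using X by (simp add: markov_chain_def)

lemma X_borel: "X n \<in> borel_measurable M"
  by (rule borel_imp_half_line) (rule X_half_line)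

text \<open>Passes from t tending to infinity to sequences; dropping finitely many terms makes every
  scale \<open>c n\<close> positive.\<close>

lemma tendsto_along_scales:
  fixes \<Phi> :: "real \<Rightarrow> real"
  assumes "\<And>t c. filterlim t at_top sequentially \<Longrightarrow> (\<And>n. c n = b (t n)) \<Longrightarrow>
    filterlim c at_top sequentially \<Longrightarrow> (\<And>n. 0 < c n) \<Longrightarrow> (\<lambda>n. \<Phi> (t n)) \<longlonglongrightarrow> L"
  shows "(\<Phi> \<longlongrightarrow> L) at_top"
proof (rule tendsto_at_topI_sequentially)
  fix T :: "nat \<Rightarrow> real" assume T: "filterlim T at_top sequentially"
  have bT: "filterlim (\<lambda>n. b (T n)) at_top sequentially" using b T by (rule filterlim_compose)
  then have "\<forall>\<^sub>F n in sequentially. 0 < b (T n)" by (simp add: filterlim_at_top_dense)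
  then obtain N where N: "\<And>n. n \<ge> N \<Longrightarrow> 0 < b (T n)" unfolding eventually_sequentially by blast
  have "(\<lambda>n. \<Phi> (T (n + N))) \<longlonglongrightarrow> L"
    using N
    by (intro assms[of "\<lambda>n. T (n + N)" "\<lambda>n. b (T (n + N))"] filterlim_compose[OF T filterlim_add_const_nat_at_top]
        filterlim_compose[OF bT filterlim_add_const_nat_at_top]) auto
  then show "(\<lambda>n. \<Phi> (T n)) \<longlonglongrightarrow> L" by (rule LIMSEQ_offset)
qed

lemma tendsto_start:
  fixes f :: "nat \<Rightarrow> real \<Rightarrow> real"
  assumes t: "filterlim t at_top sequentially" and c: "\<And>n. c n = b (t n)" "\<And>n. 0 < c n"
    and f: "\<And>n. f n \<in> borel_measurable half_line" "g \<in> borel_measurable half_line" "\<And>n x. \<bar>f n x\<bar> \<le> B"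
    and d: "0 < d" "\<And>n x. x < d \<Longrightarrow> f n x = 0" "\<And>x. x < d \<Longrightarrow> g x = 0"
    and fg: "\<And>w w'. (\<And>n. 0 \<le> w n) \<Longrightarrow> w \<longlonglongrightarrow> w' \<Longrightarrow> 0 < w' \<Longrightarrow> (\<lambda>n. f n (w n)) \<longlonglongrightarrow> g w'"
  shows "(\<lambda>n. t n * (\<integral>\<omega>. f n (X 0 \<omega> / c n) \<partial>M)) \<longlonglongrightarrow> (\<integral>e. g (enn2real e) \<partial>\<nu>)"
proof (rule vague_imp_tail_integral_tendsto[OF X_half_line c(2) id_\<nu> _ _ \<nu>_top _ f d fg])
  have eq: "{e \<in> space \<nu>. ennreal d \<le> e} = {ennreal d..}" if "0 < d" for d :: real
    using that by (auto simp: space_\<nu> intro: less_le_trans[of _ "ennreal d"])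
  show "emeasure \<nu> {e \<in> space \<nu>. ennreal d \<le> e} < \<infinity>" "0 < emeasure \<nu> {e \<in> space \<nu>. ennreal d \<le> e}" if "0 < d" for d :: real
    using \<nu>_compact[OF that] \<nu>_pos[OF that] by (simp_all only: eq[OF that])
  fix h :: "ennreal \<Rightarrow> real"
  assume h: "continuous_on UNIV h" "\<And>e. 0 \<le> h e" "\<exists>d>0. \<forall>e<ennreal d. h e = 0"
  show "(\<lambda>n. t n * (\<integral>\<omega>. h (ennreal (X 0 \<omega> / c n)) \<partial>M)) \<longlonglongrightarrow> (\<integral>e. h e \<partial>\<nu>)"
    unfolding c(1) by (rule filterlim_compose[OF X0_tail[OF h] t])
qed

section \<open>The modes of approach to zero under the various assumptions on the kernel\<close>

context
  fixes t c :: "nat \<Rightarrow> real"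
  assumes t: "filterlim t at_top sequentially" and ct: "\<And>n. c n = b (t n)"
    and c: "filterlim c at_top sequentially" "\<And>n. 0 < c n"
begin

lemma c_mult_at_top: "u \<longlonglongrightarrow> u' \<Longrightarrow> 0 < u' \<Longrightarrow> filterlim (\<lambda>n. c n * u n) at_top sequentially"
  using filterlim_tendsto_pos_mult_at_top[of u u' sequentially c] c(1) by (simp add: mult.commute)

lemma c_mult_nonneg: "0 \<le> u n \<Longrightarrow> 0 \<le> c n * u n"
  using c(2)[of n] by simp

text \<open>Nothing is known after the chain becomes negligible. \<open>stay\<close> holds
  nevertheless, since \<open>W\<close> being always true forces convergence along all nonnegative
  sequences, hence uniformly.\<close>

lemma scaled_chain_free_zero: "scaled_chain M G K X \<nu> t c (\<lambda>s. s \<longlonglongrightarrow> 0) (\<lambda>_. True)"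
proof (unfold_locales, goal_cases)
  case (5 f g B d)
  show ?case by (rule tendsto_start[OF t ct c(2)]) (use 5 in auto)
next
  case (6 f g B u u')
  show ?case by (rule attracted_kernel_tendsto[OF G K KG c]) (use 6 in auto)
next
  case (7 f B u L)
  show ?case
    using 7 kernel_half_line[OF K c_mult_nonneg] c(2)
    by (intro integral_tendsto_of_all_sequences[where B=B]) auto
qed (use G K X c in auto)

text \<open>The uniform boundary captures asymptotically the whole atom of \<open>G\<close> at 0,
  also from the moving starting points \<open>c n * u n\<close>. Entering zero may therefore be read
  as falling to the boundary or below.\<close>

lemma scaled_chain_below_boundary:
  assumes y: "uniform_extremal_boundary K G y"
  shows "scaled_chain M G K X \<nu> t c (\<lambda>s. \<forall>n. s n \<le> y (c n)) (\<lambda>_. True)"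
proof (unfold_locales, goal_cases)
  case (5 f g B d)
  show ?case by (rule tendsto_start[OF t ct c(2)]) (use 5 in auto)
next
  case (6 f g B u u')
  have y0: "0 \<le> y (c n)" for n
    using y c(2)[of n] by (auto simp: uniform_extremal_boundary_def extremal_boundary_def)
  have "(y \<longlongrightarrow> 0) at_top"
    using y by (simp add: uniform_extremal_boundary_def extremal_boundary_def)
  then have ylim: "(\<lambda>n. y (c n)) \<longlonglongrightarrow> 0" using c(1) by (rule filterlim_compose)
  have "(\<lambda>n. measure (K (c n * u n)) ((*) (c n) ` {0..y (c n)})) \<longlonglongrightarrow> measure G {0}"
  proof (rule tendsto_sequence_of_functions[where \<Phi>="\<lambda>t v. measure (K (t * v)) ((*) t ` {0..y t})", OF _ c(1) 6(5,4)])
    fix v :: "real \<Rightarrow> real" assume "\<forall>t. 0 \<le> v t" "(v \<longlongrightarrow> u') at_top"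
    then show "((\<lambda>t. measure (K (t * v t)) ((*) t ` {0..y t})) \<longlongrightarrow> measure G {0}) at_top"
      using y[unfolded uniform_extremal_boundary_def, THEN conjunct2, rule_format, of v u'] 6(6) by simp
  qed (use 6 in simp)
  then have "(\<lambda>n. measure (K (c n * u n)) {0..c n * y (c n)}) \<longlonglongrightarrow> measure G {0}"
    using c(2) by (simp add: image_mult_atLeastAtMost)
  then have "\<exists>z. (\<forall>n. 0 \<le> z n) \<and> z \<longlonglongrightarrow> 0 \<and> (\<lambda>n. measure (K (c n * u n)) {0..c n * z n}) \<longlonglongrightarrow> measure G {0} \<and>
        (\<forall>w. (\<forall>n. 0 \<le> w n \<and> w n \<le> z n) \<longrightarrow> (\<lambda>n. f n (w n)) \<longlonglongrightarrow> g 0)"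
    using y0 ylim 6(8) by (intro exI[of _ "\<lambda>n. y (c n)"]) auto
  then show ?case by (intro attracted_kernel_tendsto[OF G K KG c 6(1-7)] disjI2)
next
  case (7 f B u L)
  show ?case
    using 7 kernel_half_line[OF K c_mult_nonneg] c(2)
    by (intro integral_tendsto_of_all_sequences[where B=B]) auto
qed (use G K X c in auto)

text \<open>The tail chain almost surely never enters 0, so both modes can be impossible and
  \<open>stay\<close> holds vacuously.\<close>

lemma scaled_chain_never_zero:
  assumes "measure G {0} = 0"
  shows "scaled_chain M G K X \<nu> t c (\<lambda>_. False) (\<lambda>_. False)"
proof (unfold_locales, goal_cases)
  case (5 f g B d)
  show ?case by (rule tendsto_start[OF t ct c(2)]) (use 5 in auto)
next
  case (6 f g B u u')
  show ?case by (rule attracted_kernel_tendsto[OF G K KG c]) (use 6 assms in auto)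
qed (use G K X c in auto)

text \<open>Zero is entered exactly. The next law is then the fixed \<open>K 0\<close>, and later
  laws are of the form \<open>K a\<close> with an unscaled state \<open>a\<close> independent of
  \<open>n\<close>, which explains \<open>a / c n\<close> in \<open>W\<close>. In
  \<open>enter\<close> the boundary property is applied at the diverging states
  \<open>c n * u n\<close> themselves, because the threshold 0 looks the same at every
  scale.\<close>

lemma scaled_chain_exact_zero:
  assumes "extremal_boundary K G (\<lambda>_. 0)"
  shows "scaled_chain M G K X \<nu> t c (\<lambda>s. s = (\<lambda>_. 0)) (\<lambda>s. \<exists>a\<ge>0. s = (\<lambda>n. a / c n))"
proof (unfold_locales, goal_cases)
  case (5 f g B d)
  show ?case by (rule tendsto_start[OF t ct c(2)]) (use 5 in auto)
next
  case (6 f g B u u')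
  have "((\<lambda>t. measure (K t) {0}) \<longlongrightarrow> measure G {0}) at_top"
    using assms by (simp add: extremal_boundary_def)
  then have "(\<lambda>n. measure (K (c n * u n)) {0}) \<longlonglongrightarrow> measure G {0}"
    using c_mult_at_top[OF 6(5,6)] by (rule filterlim_compose)
  moreover have "(\<lambda>n. f n (w n)) \<longlonglongrightarrow> g 0" if "\<forall>n. 0 \<le> w n \<and> w n \<le> 0" for w
    using that by (intro 6(8)) (auto intro: antisym)
  ultimately have "\<exists>z. (\<forall>n. 0 \<le> z n) \<and> z \<longlonglongrightarrow> 0 \<and> (\<lambda>n. measure (K (c n * u n)) {0..c n * z n}) \<longlonglongrightarrow> measure G {0} \<and>
        (\<forall>w. (\<forall>n. 0 \<le> w n \<and> w n \<le> z n) \<longrightarrow> (\<lambda>n. f n (w n)) \<longlonglongrightarrow> g 0)"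
    by (intro exI[of _ "\<lambda>_. 0"]) auto
  then show ?case by (intro attracted_kernel_tendsto[OF G K KG c 6(1-7)] disjI2)
next
  case (7 f B u L)
  from 7(4) have "\<exists>a\<ge>0. u = (\<lambda>n. a / c n)"
  proof
    assume "u = (\<lambda>_. 0)"
    then show ?thesis by (intro exI[of _ 0]) simp
  qed
  then obtain a where a: "0 \<le> a" "u = (\<lambda>n. a / c n)" by blast
  then have "c n * u n = a" for n using c(2)[of n] by simp
  moreover have "(\<lambda>n. \<integral>x. f n (x / c n) \<partial>K a) \<longlonglongrightarrow> L"
  proof (rule integral_tendsto_fixed_law[OF kernel_half_line(1,2)[OF K a(1)] c(2) 7(1,2)])
    show "(\<lambda>n. f n (x / c n)) \<longlonglongrightarrow> L" if "0 \<le> x" for x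
      using that c(2) by (intro 7(5)) (auto simp: less_imp_le)
  qed
  ultimately show ?case by simp
qed (use G K X c in auto)

text \<open>Regularity makes negligible states lead to negligible states, so both modes are plain
  convergence to 0.\<close>

lemma scaled_chain_regular:
  assumes "regularity_condition K"
  shows "scaled_chain M G K X \<nu> t c (\<lambda>s. s \<longlonglongrightarrow> 0) (\<lambda>s. s \<longlonglongrightarrow> 0)"
proof (unfold_locales, goal_cases)
  case (5 f g B d)
  show ?case by (rule tendsto_start[OF t ct c(2)]) (use 5 in auto)
next
  case (6 f g B u u')
  show ?case by (rule attracted_kernel_tendsto[OF G K KG c]) (use 6 in auto)
next
  case (7 f B u L)
  show ?case by (rule regular_kernel_tendsto[OF K assms c]) (use 7 in auto)
qed (use G K X c in auto)

end

end

section \<open>The four vague limits\<close>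

lemma scaled_path_measurable:
  assumes "\<And>i. X i \<in> borel_measurable M"
  shows "topologically_measurable (orthant_top Q m) M (scaled_path m c X)"
  unfolding scaled_path_def[abs_def]
proof (rule topologically_measurable_orthant)
  show "(\<lambda>\<omega>. ennreal (X i \<omega> / c)) \<in> borel_measurable M" for i
    using assms[of i] by measurable
qed

context heavy_tailed_chain
begin

lemma extremal_component_measurable: "extremal_component y X t n \<in> borel_measurable M"
proof -
  have "{\<omega> \<in> space M. \<forall>j\<in>{..n}. t * y t < X j \<omega>} \<in> sets M"
    using X_borel by (intro sets.sets_Collect_finite_All) (auto intro: borel_measurable_less)
  then have "{\<omega> \<in> space M. enat n < hitting_time y X t \<omega>} \<in> sets M"
    by (simp only: less_hitting_time_iff Ball_def atMost_iff)
  then show ?thesis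
    unfolding extremal_component_def using X_borel[of n] by (intro measurable_If) auto
qed

text \<open>If the limit path first vanishes before time \<open>m\<close>, a marked coordinate tends
  to 0 and the functional is eventually 0, whatever the later coordinates do. If it vanishes only at
  time \<open>m\<close>, all coordinates converge and continuity applies.\<close>

lemma vague_limit_free_last:
  assumes m: "1 \<le> m"
  shows "vague_conv (last_free_top m)
    (\<lambda>t. scale_measure (ennreal t) (law_on (last_free_top m) M (scaled_path m (b t) X)))
    (law_on (last_free_top m) (nu_star \<nu> G m) (\<lambda>x. x)) at_top"
proof (rule vague_conv_scaled_lawI)
  show "finite_measure M" by unfold_locales
  show "topologically_measurable (last_free_top m) M (scaled_path m (b t) X)" for t
    unfolding last_free_top_eq by (rule scaled_path_measurable) (rule X_borel)
  show "radon_on (last_free_top m) (law_on (last_free_top m) (nu_star \<nu> G m) (\<lambda>x. x))"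
    using m by (rule radon_on_law_nu_star)
  fix f C assume f: "continuous_map (last_free_top m) euclideanreal f" "\<And>x. x \<in> topspace (last_free_top m) \<Longrightarrow> 0 \<le> f x"
    and C: "compactin (last_free_top m) C" "\<And>x. x \<in> topspace (last_free_top m) - C \<Longrightarrow> f x = 0"
  let ?F = "path_fun (\<lambda>i. i < m) m f"
  note f' = f[unfolded last_free_top_eq] and C' = C[unfolded last_free_top_eq]
  obtain B where B: "\<And>q. \<bar>zero_extend (last_free_top m) f q\<bar> \<le> B"
    using zero_extend_bounded[OF f(1) C] by blast
  have FB: "\<bar>?F p\<bar> \<le> B" for p using B by (simp add: path_fun_def last_free_top_eq)
  have F_meas: "?F \<in> borel_measurable (Pi\<^sub>M {..m} (\<lambda>_. half_line))"
    by (rule path_fun_measurable[OF continuous_map_borel_of[OF f'(1)]])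
  have F_vanish: "\<exists>d>0. \<forall>p. p i < d \<longrightarrow> ?F p = 0" if i: "i < m" for i
  proof -
    obtain d where "0 < d" "\<And>p. p i < d \<Longrightarrow> ?F p = 0"
      by (rule path_fun_vanishes[OF C', where i=i]) (use i in auto)
    then show ?thesis by blast
  qed
  obtain d where d: "0 < d" "\<And>p. p 0 < d \<Longrightarrow> ?F p = 0" using F_vanish[of 0] m by auto
  have main: "((\<lambda>t. t * (\<integral>\<omega>. ?F (\<lambda>i\<in>{..m}. X i \<omega> / b t) \<partial>M)) \<longlongrightarrow> tail_integral \<nu> G m ?F) at_top"
  proof (rule tendsto_along_scales)
    fix t c assume t: "filterlim t at_top sequentially" and ct: "\<And>n. c n = b (t n)"
      and c: "filterlim c at_top sequentially" "\<And>n. 0 < c n"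
    show "(\<lambda>n. t n * (\<integral>\<omega>. ?F (\<lambda>i\<in>{..m}. X i \<omega> / b (t n)) \<partial>M)) \<longlonglongrightarrow> tail_integral \<nu> G m ?F"
      unfolding ct[symmetric]
    proof (rule scaled_chain.scaled_path_integral_tendsto[OF scaled_chain_free_zero[OF t ct c] F_meas F_meas FB FB d(1) d(2) d(2)])
      fix P p assume "path_conv (\<lambda>s. s \<longlonglongrightarrow> 0) (\<lambda>_. True) m P p"
      then show "(\<lambda>n. ?F (P n)) \<longlonglongrightarrow> ?F p"
      proof (cases rule: path_conv_cases)
        case 1
        then show ?thesis by (intro path_fun_tendsto[OF f'(1) C']) auto
      next
        case (2 k)
        show ?thesis
        proof (cases "k = m")
          case True
          have "(\<lambda>n. P n i) \<longlonglongrightarrow> p i" if "i \<le> m" for i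
            using 2 that True by (cases "i = m") auto
          then show ?thesis by (intro path_fun_tendsto[OF f'(1) C'])
        next
          case False
          then have "k < m" using 2 by simp
          then obtain e where e: "0 < e" "\<And>q. q k < e \<Longrightarrow> ?F q = 0" using F_vanish by blast
          have "\<forall>\<^sub>F n in sequentially. P n k < e" using order_tendstoD(2)[OF 2(5) e(1)] .
          then have "\<forall>\<^sub>F n in sequentially. ?F (P n) = 0" by eventually_elim (rule e(2))
          moreover have "?F p = 0" using 2(2,7) e by simp
          ultimately show ?thesis by (simp add: tendsto_eventually)
        qed
      qed
    qed
  qed
  have lim_eq: "(\<integral>x. f x \<partial>law_on (last_free_top m) (nu_star \<nu> G m) (\<lambda>x. x)) = tail_integral \<nu> G m ?F"
  proof -
    note tm = topologically_measurable_nu_star[OF m]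
    have "zero_extend (last_free_top m) f \<in> borel_measurable (nu_star \<nu> G m)"
      using zero_extend_measurable[OF tm continuous_map_borel_of[OF f(1)]] by simp
    then have "zero_extend (last_free_top m) f \<in> borel_measurable (borel_of (first_pos_top m))"
      using measurable_cong_sets[OF sets_nu_star refl] by blast
    moreover have "0 \<le> zero_extend (last_free_top m) f q" for q using f(2) by (simp add: zero_extend_def)
    ultimately show ?thesis
      unfolding integral_law_on[OF tm continuous_map_borel_of[OF f(1)]]
      using integral_nu_star[of "zero_extend (last_free_top m) f" m B] B
      by (simp add: path_fun_def[abs_def] last_free_top_eq)
  qed
  from main show "((\<lambda>t. t * (\<integral>\<omega>. zero_extend (last_free_top m) f (scaled_path m (b t) X \<omega>) \<partial>M)) \<longlongrightarrow>
      (\<integral>x. f x \<partial>law_on (last_free_top m) (nu_star \<nu> G m) (\<lambda>x. x))) at_top"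
    unfolding lim_eq by (simp add: path_fun_def scaled_path_eq last_free_top_eq)
qed

lemma integral_nu_star_path_fun:
  assumes f: "continuous_map (first_pos_top m) euclideanreal f" "\<And>x. x \<in> topspace (first_pos_top m) \<Longrightarrow> 0 \<le> f x"
    and C: "compactin (first_pos_top m) C" "\<And>x. x \<in> topspace (first_pos_top m) - C \<Longrightarrow> f x = 0"
  shows "(\<integral>x. f x \<partial>nu_star \<nu> G m) = tail_integral \<nu> G m (path_fun (\<lambda>i. i = 0) m f)"
proof -
  obtain B where B: "\<And>q. \<bar>zero_extend (first_pos_top m) f q\<bar> \<le> B"
    using zero_extend_bounded[OF f(1) C] by blast
  have eq: "zero_extend (first_pos_top m) f x = f x" if "x \<in> topspace (first_pos_top m)" for x
    using that by (simp add: zero_extend_def)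
  have "zero_extend (first_pos_top m) f \<in> borel_measurable (borel_of (first_pos_top m))"
    using continuous_map_borel_of[OF f(1)] by (rule measurable_cong[THEN iffD2, rotated]) (simp add: eq)
  moreover have "0 \<le> zero_extend (first_pos_top m) f q" for q using f(2) by (simp add: zero_extend_def)
  ultimately have "(\<integral>x. zero_extend (first_pos_top m) f x \<partial>nu_star \<nu> G m) = tail_integral \<nu> G m (path_fun (\<lambda>i. i = 0) m f)"
    using integral_nu_star[of "zero_extend (first_pos_top m) f" m B] B
    by (simp add: path_fun_def[abs_def] first_pos_top_eq)
  moreover have "(\<integral>x. zero_extend (first_pos_top m) f x \<partial>nu_star \<nu> G m) = (\<integral>x. f x \<partial>nu_star \<nu> G m)"
    by (intro Bochner_Integration.integral_cong) (auto simp: space_nu_star eq)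
  ultimately show ?thesis by simp
qed

lemma vague_limit_extremal_component:
  assumes y: "uniform_extremal_boundary K G y"
  shows "vague_conv (first_pos_top m)
    (\<lambda>t. scale_measure (ennreal t) (law_on (first_pos_top m) M (scaled_path m (b t) (extremal_component y X (b t)))))
    (nu_star \<nu> G m) at_top"
proof (rule vague_conv_scaled_lawI)
  show "finite_measure M" by unfold_locales
  show "topologically_measurable (first_pos_top m) M (scaled_path m (b t) (extremal_component y X (b t)))" for t
    unfolding first_pos_top_eq by (rule scaled_path_measurable) (rule extremal_component_measurable)
  show "radon_on (first_pos_top m) (nu_star \<nu> G m)" by (rule radon_on_nu_star)
  fix f C assume f: "continuous_map (first_pos_top m) euclideanreal f" "\<And>x. x \<in> topspace (first_pos_top m) \<Longrightarrow> 0 \<le> f x"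
    and C: "compactin (first_pos_top m) C" "\<And>x. x \<in> topspace (first_pos_top m) - C \<Longrightarrow> f x = 0"
  let ?F = "path_fun (\<lambda>i. i = 0) m f" and ?T = "\<lambda>\<eta> p. \<lambda>i\<in>{..m}. truncate_path \<eta> p i"
  note f' = f[unfolded first_pos_top_eq] and C' = C[unfolded first_pos_top_eq]
  obtain B where B: "\<And>q. \<bar>zero_extend (first_pos_top m) f q\<bar> \<le> B"
    using zero_extend_bounded[OF f(1) C] by blast
  have FB: "\<bar>?F p\<bar> \<le> B" for p using B by (simp add: path_fun_def first_pos_top_eq)
  have F_meas: "?F \<in> borel_measurable (Pi\<^sub>M {..m} (\<lambda>_. half_line))"
    by (rule path_fun_measurable[OF continuous_map_borel_of[OF f'(1)]])
  have lim_eq: "(\<integral>x. f x \<partial>nu_star \<nu> G m) = tail_integral \<nu> G m ?F"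
    by (rule integral_nu_star_path_fun[OF f C])
  obtain d where d: "0 < d" "\<And>p. p 0 < d \<Longrightarrow> ?F p = 0"
    by (rule path_fun_vanishes[OF C', where i=0]) auto
  \<comment> \<open>Truncation leaves coordinate 0 unchanged or replaces it by 0, so the cutoff
    survives.\<close>
  have dT: "?F (?T \<eta> p) = 0" if "p 0 < d" for p \<eta>
    using that d(1) by (intro d(2)) (simp add: truncate_path_def)
  have y_lim: "(y \<longlongrightarrow> 0) at_top" using y by (simp add: uniform_extremal_boundary_def extremal_boundary_def)
  show "((\<lambda>t. t * (\<integral>\<omega>. zero_extend (first_pos_top m) f (scaled_path m (b t) (extremal_component y X (b t)) \<omega>) \<partial>M)) \<longlongrightarrow>
      (\<integral>x. f x \<partial>nu_star \<nu> G m)) at_top"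
    unfolding lim_eq
  proof (rule tendsto_along_scales)
    fix t c assume t: "filterlim t at_top sequentially" and ct: "\<And>n. c n = b (t n)"
      and c: "filterlim c at_top sequentially" "\<And>n. 0 < c n"
    have "(\<lambda>n. t n * (\<integral>\<omega>. ?F (?T (y (c n)) (\<lambda>i\<in>{..m}. X i \<omega> / c n)) \<partial>M)) \<longlonglongrightarrow> tail_integral \<nu> G m ?F"
    proof (rule scaled_chain.scaled_path_integral_tendsto[where F="\<lambda>n p. ?F (?T (y (c n)) p)",
          OF scaled_chain_below_boundary[OF t ct c y] measurable_compose[OF truncate_path_measurable F_meas] F_meas FB FB d(1) dT d(2)])
      fix P p assume P: "path_conv (\<lambda>s. \<forall>n. s n \<le> y (c n)) (\<lambda>_. True) m P p"
      have "(\<lambda>n. y (c n)) \<longlonglongrightarrow> 0" using y_lim c(1) by (rule filterlim_compose)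
      from truncate_path_tendsto[OF P this]
      show "(\<lambda>n. ?F (?T (y (c n)) (P n))) \<longlonglongrightarrow> ?F p"
        by (intro path_fun_tendsto[OF f'(1) C']) auto
    qed
    moreover have "zero_extend (first_pos_top m) f (scaled_path m (b (t n)) (extremal_component y X (b (t n))) \<omega>)
        = ?F (?T (y (c n)) (\<lambda>i\<in>{..m}. X i \<omega> / c n))" for n \<omega>
      unfolding ct[symmetric] scaled_extremal_component[OF c(2)] path_fun_def path_embed_restrict first_pos_top_eq ..
    ultimately show "(\<lambda>n. t n * (\<integral>\<omega>. zero_extend (first_pos_top m) f (scaled_path m (b (t n)) (extremal_component y X (b (t n))) \<omega>) \<partial>M))
        \<longlonglongrightarrow> tail_integral \<nu> G m ?F"
      by (simp only:)
  qed
qed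

lemma vague_limit_full_path:
  assumes cond: "measure G {0} = 0 \<or> extremal_boundary K G (\<lambda>_. 0) \<or> regularity_condition K"
  shows "vague_conv (first_pos_top m)
    (\<lambda>t. scale_measure (ennreal t) (law_on (first_pos_top m) M (scaled_path m (b t) X)))
    (nu_star \<nu> G m) at_top"
proof (rule vague_conv_scaled_lawI)
  show "finite_measure M" by unfold_locales
  show "topologically_measurable (first_pos_top m) M (scaled_path m (b t) X)" for t
    unfolding first_pos_top_eq by (rule scaled_path_measurable) (rule X_borel)
  show "radon_on (first_pos_top m) (nu_star \<nu> G m)" by (rule radon_on_nu_star)
  fix f C assume f: "continuous_map (first_pos_top m) euclideanreal f" "\<And>x. x \<in> topspace (first_pos_top m) \<Longrightarrow> 0 \<le> f x"
    and C: "compactin (first_pos_top m) C" "\<And>x. x \<in> topspace (first_pos_top m) - C \<Longrightarrow> f x = 0"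
  let ?F = "path_fun (\<lambda>i. i = 0) m f"
  note f' = f[unfolded first_pos_top_eq] and C' = C[unfolded first_pos_top_eq]
  obtain B where B: "\<And>q. \<bar>zero_extend (first_pos_top m) f q\<bar> \<le> B"
    using zero_extend_bounded[OF f(1) C] by blast
  have FB: "\<bar>?F p\<bar> \<le> B" for p using B by (simp add: path_fun_def first_pos_top_eq)
  have F_meas: "?F \<in> borel_measurable (Pi\<^sub>M {..m} (\<lambda>_. half_line))"
    by (rule path_fun_measurable[OF continuous_map_borel_of[OF f'(1)]])
  have lim_eq: "(\<integral>x. f x \<partial>nu_star \<nu> G m) = tail_integral \<nu> G m ?F"
    by (rule integral_nu_star_path_fun[OF f C])
  obtain d where d: "0 < d" "\<And>p. p 0 < d \<Longrightarrow> ?F p = 0"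
    by (rule path_fun_vanishes[OF C', where i=0]) auto
  have "((\<lambda>t. t * (\<integral>\<omega>. ?F (\<lambda>i\<in>{..m}. X i \<omega> / b t) \<partial>M)) \<longlongrightarrow> tail_integral \<nu> G m ?F) at_top"
  proof (rule tendsto_along_scales)
    fix t c assume t: "filterlim t at_top sequentially" and ct: "\<And>n. c n = b (t n)"
      and c: "filterlim c at_top sequentially" "\<And>n. 0 < c n"
    have "\<exists>Z W. scaled_chain M G K X \<nu> t c Z W \<and> (\<forall>s. Z s \<longrightarrow> s \<longlonglongrightarrow> 0) \<and> (\<forall>s. W s \<longrightarrow> s \<longlonglongrightarrow> 0)"
      using cond
    proof (elim disjE)
      assume "measure G {0} = 0"
      from scaled_chain_never_zero[OF t ct c this] show ?thesis by (intro exI conjI) auto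
    next
      assume "regularity_condition K"
      from scaled_chain_regular[OF t ct c this] show ?thesis by (intro exI conjI) auto
    next
      have "(\<lambda>n. a / c n) \<longlonglongrightarrow> 0" for a
        using c(1) by (intro tendsto_divide_0[OF tendsto_const] filterlim_at_top_imp_at_infinity)
      moreover assume "extremal_boundary K G (\<lambda>_. 0)"
      note scaled_chain_exact_zero[OF t ct c this]
      ultimately show ?thesis by (intro exI conjI) auto
    qed
    then obtain Z W where ZW: "scaled_chain M G K X \<nu> t c Z W" "\<And>s. Z s \<Longrightarrow> s \<longlonglongrightarrow> 0" "\<And>s. W s \<Longrightarrow> s \<longlonglongrightarrow> 0" by blast
    show "(\<lambda>n. t n * (\<integral>\<omega>. ?F (\<lambda>i\<in>{..m}. X i \<omega> / b (t n)) \<partial>M)) \<longlonglongrightarrow> tail_integral \<nu> G m ?F"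
      unfolding ct[symmetric]
      by (rule scaled_chain.scaled_path_integral_tendsto[OF ZW(1) F_meas F_meas FB FB d(1) d(2) d(2)])
        (blast intro: path_fun_tendsto[OF f'(1) C'] path_conv_tendsto ZW)+
  qed
  then show "((\<lambda>t. t * (\<integral>\<omega>. zero_extend (first_pos_top m) f (scaled_path m (b t) X \<omega>) \<partial>M)) \<longlongrightarrow>
      (\<integral>x. f x \<partial>nu_star \<nu> G m)) at_top"
    unfolding lim_eq by (simp add: path_fun_def scaled_path_eq first_pos_top_eq)
qed

text \<open>From a positive start the product is positive exactly when every factor is, and the
  factors are independent.\<close>

lemma tail_path_positive_probability:
  assumes x: "0 < x"
  shows "(\<integral>\<xi>. of_bool (0 < tail_path k x \<xi> k) \<partial>steps k) = (1 - measure G {0}) ^ k"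
proof -
  interpret G: prob_space G by (rule G_prob)
  interpret product_sigma_finite "\<lambda>_::nat. G" by standard
  have pos: "{0<..} \<in> sets G" "{0} \<in> sets G"
    unfolding G_sets by (auto simp: sets_restrict_space_iff)
  have "(\<integral>\<xi>. of_bool (0 < tail_path k x \<xi> k) \<partial>steps k) = (\<integral>\<xi>. (\<Prod>i\<in>{1..k}. indicator {0<..} (\<xi> i) :: real) \<partial>steps k)"
  proof (intro Bochner_Integration.integral_cong refl)
    fix \<xi> assume "\<xi> \<in> space (steps k)"
    then have nn: "0 \<le> \<xi> i" if "i \<in> {1..k}" for i using that by (auto simp: space_PiM G_space PiE_iff)
    have tail_k: "tail_path k x \<xi> k = x * (\<Prod>i\<in>{1..k}. \<xi> i)" by (simp add: tail_path_def)
    show "of_bool (0 < tail_path k x \<xi> k) = (\<Prod>i\<in>{1..k}. indicator {0<..} (\<xi> i) :: real)"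
    proof (cases "\<exists>i\<in>{1..k}. \<xi> i = 0")
      case True
      then obtain i where i: "i \<in> {1..k}" "\<xi> i = 0" by blast
      then have z: "(\<Prod>i\<in>{1..k}. \<xi> i) = 0" "(\<Prod>i\<in>{1..k}. indicator {0<..} (\<xi> i) :: real) = 0"
        by (intro prod_zero bexI[OF _ i(1)]; simp)+
      show ?thesis unfolding tail_k z by simp
    next
      case False
      then have p: "0 < \<xi> i" if "i \<in> {1..k}" for i using nn[OF that] that by (auto simp: less_le)
      then have "0 < (\<Prod>i\<in>{1..k}. \<xi> i)" by (intro prod_pos) auto
      moreover have "(\<Prod>i\<in>{1..k}. indicator {0<..} (\<xi> i) :: real) = 1" using p by (intro prod.neutral) auto
      ultimately show ?thesis unfolding tail_k using x by simp
    qed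
  qed
  also have "\<dots> = (\<Prod>i\<in>{1..k}. \<integral>x. indicator {0<..} x \<partial>G)"
    using pos by (intro product_integral_prod integrable_real_indicator) (auto simp: less_top[symmetric])
  also have "\<dots> = (measure G {0<..}) ^ k" using pos by simp
  also have "measure G {0<..} = 1 - measure G {0}"
  proof -
    have "space G - {0} = {0<..}" by (auto simp: G_space)
    then show ?thesis using G.prob_compl[OF pos(2)] by simp
  qed
  finally show ?thesis .
qed

text \<open>The path functional is the test function of the initial state times the indicator that
  no coordinate has reached the boundary. In the limit this becomes positivity of the tail chain at
  its last time, which contributes a power of \<open>1 - measure G {0}\<close>.\<close>

lemma vague_limit_hitting_time:
  assumes y: "uniform_extremal_boundary K G y" and m: "1 \<le> m" and radon: "radon_on pos_top \<nu>"
  shows "vague_conv pos_top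
    (\<lambda>t. scale_measure (ennreal t)
      (law_on pos_top (restrict_space M {\<omega> \<in> space M. enat m \<le> hitting_time y X (b t) \<omega>}) (\<lambda>\<omega>. ennreal (X 0 \<omega> / b t))))
    (scale_measure (ennreal ((1 - measure G {0}) ^ (m - 1))) \<nu>) at_top"
proof -
  \<comment> \<open>The event that the hitting time is at least \<open>m\<close> involves only the
    times up to \<open>m - 1 = k\<close>; this is the source of the exponent.\<close>
  obtain k where k: "m = Suc k" using m by (cases m) auto
  interpret G: prob_space G by (rule G_prob)
  let ?A = "\<lambda>t. {\<omega> \<in> space M. enat m \<le> hitting_time y X t \<omega>}" and ?r = "(1 - measure G {0}) ^ k"
  have A: "?A t \<in> sets M" for t
  proof -
    have "{\<omega> \<in> space M. \<forall>j\<in>{..<m}. t * y t < X j \<omega>} \<in> sets M"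
      using X_borel by (intro sets.sets_Collect_finite_All) (auto intro: borel_measurable_less)
    then show ?thesis by (simp only: le_hitting_time_iff Ball_def lessThan_iff)
  qed
  have X0: "(\<lambda>\<omega>. ennreal (X 0 \<omega> / b t)) \<in> borel_measurable M" for t using X_borel[of 0] by measurable
  have r: "0 \<le> ?r" using G.prob_le_1 by simp
  have "vague_conv pos_top
    (\<lambda>t. scale_measure (ennreal t) (law_on pos_top (restrict_space M (?A (b t))) (\<lambda>\<omega>. ennreal (X 0 \<omega> / b t))))
    (scale_measure (ennreal ?r) \<nu>) at_top"
  proof (rule vague_conv_scaled_lawI)
    show "finite_measure (restrict_space M (?A (b t)))" for t
      by (rule finite_measure_restrict_space[OF _ A]) unfold_locales
    show "topologically_measurable pos_top (restrict_space M (?A (b t))) (\<lambda>\<omega>. ennreal (X 0 \<omega> / b t))" for t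
      by (rule topologically_measurable_pos_top[OF measurable_restrict_space1[OF X0]])
    show "radon_on pos_top (scale_measure (ennreal ?r) \<nu>)"
      using radon by (auto simp: radon_on_def ennreal_mult_less_top)
    fix f C assume f: "continuous_map pos_top euclideanreal f" "\<And>x. x \<in> topspace pos_top \<Longrightarrow> 0 \<le> f x"
      and C: "compactin pos_top C" "\<And>x. x \<in> topspace pos_top - C \<Longrightarrow> f x = 0"
    let ?f = "zero_extend pos_top f"
    \<comment> \<open>In \<open>?F'\<close> positivity at time \<open>k\<close> is enough, because 0
      is absorbing for the tail chain.\<close>
    let ?F = "\<lambda>\<eta> p. ?f (ennreal (p 0)) * of_bool (\<forall>i\<le>k. \<eta> < p i)"
      and ?F' = "\<lambda>p. ?f (ennreal (p 0)) * of_bool (0 < p k)"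
    obtain B where B: "\<And>e. \<bar>?f e\<bar> \<le> B" using zero_extend_bounded[OF f(1) C] by blast
    have B0: "0 \<le> B" using B[of 0] by simp
    have FB: "\<bar>?F \<eta> p\<bar> \<le> B" "\<bar>?F' p\<bar> \<le> B" for \<eta> p using B[of "ennreal (p 0)"] B0 by auto
    obtain d where d: "0 < d" "\<And>e. e \<in> C \<Longrightarrow> ennreal d \<le> e" using compact_pos_bounded_away[OF C(1)] by blast
    have f0: "?f (ennreal x) = 0" if "x < d" for x
    proof -
      have "ennreal x < ennreal d" using that d(1) by (rule ennreal_lessI[rotated])
      then have "ennreal x \<notin> C" using d(2) by (auto simp: not_le[symmetric])
      then show ?thesis using C(2) by (auto simp: zero_extend_def)
    qed
    have f_meas: "?f \<in> borel_measurable borel"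
      using zero_extend_measurable[OF topologically_measurable_pos_top[OF measurable_ident] continuous_map_borel_of[OF f(1)]] by simp
    have comp: "(\<lambda>p. p i) \<in> borel_measurable (Pi\<^sub>M {..k} (\<lambda>_. half_line :: real measure))" if "i \<le> k" for i
      using that by (intro borel_imp_half_line measurable_component_singleton) simp
    have f_comp: "(\<lambda>p. ?f (ennreal (p 0))) \<in> borel_measurable (Pi\<^sub>M {..k} (\<lambda>_. half_line :: real measure))"
      by (rule measurable_compose[OF measurable_compose[OF comp[of 0] measurable_ennreal] f_meas]) simp
    have bool_meas: "(\<lambda>p. of_bool (Q p) :: real) \<in> borel_measurable N" if "{p \<in> space N. Q p} \<in> sets N" for Q and N :: "(nat \<Rightarrow> real) measure"
      unfolding of_bool_def using that by (intro measurable_If) auto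
    have F_meas: "?F \<eta> \<in> borel_measurable (Pi\<^sub>M {..k} (\<lambda>_. half_line))" for \<eta>
    proof (intro borel_measurable_times f_comp bool_meas)
      have "{p \<in> space (Pi\<^sub>M {..k} (\<lambda>_. half_line)). \<forall>j\<in>{..k}. \<eta> < p j} \<in> sets (Pi\<^sub>M {..k} (\<lambda>_. half_line))"
        using comp by (intro sets.sets_Collect_finite_All) (auto intro: borel_measurable_less)
      then show "{p \<in> space (Pi\<^sub>M {..k} (\<lambda>_. half_line)). \<forall>j\<le>k. \<eta> < p j} \<in> sets (Pi\<^sub>M {..k} (\<lambda>_. half_line))"
        by (simp only: Ball_def atMost_iff)
    qed
    have F'_meas: "?F' \<in> borel_measurable (Pi\<^sub>M {..k} (\<lambda>_. half_line))"
      by (intro borel_measurable_times f_comp bool_meas borel_measurable_less borel_measurable_const comp order_refl)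
    have F0: "?F \<eta> p = 0" "?F' p = 0" if "p 0 < d" for \<eta> p using f0[OF that] by simp_all
    have y_lim: "(y \<longlongrightarrow> 0) at_top" using y by (simp add: uniform_extremal_boundary_def extremal_boundary_def)
    have f_lim: "((\<lambda>n. ?f (ennreal (w n))) \<longlongrightarrow> ?f (ennreal w')) F" if "(w \<longlongrightarrow> w') F" for w w' and F :: "nat filter"
      using zero_extend_tendsto[OF Hausdorff_ennreal _ f(1)[unfolded pos_top_def] C[unfolded pos_top_def], of "\<lambda>n. ennreal (w n)" "ennreal w'" F]
        that by (simp add: pos_top_def)
    have limit: "tail_integral \<nu> G k ?F' = (\<integral>e. f e \<partial>scale_measure (ennreal ?r) \<nu>)"
    proof -
      let ?K = "\<integral>\<xi>. ?F' (tail_path k 0 \<xi>) \<partial>steps k"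
      have f_\<nu>: "f \<in> borel_measurable \<nu>"
        using continuous_map_borel_of[OF f(1)] measurable_cong_sets[OF sets_\<nu> refl] by blast
      have "{e \<in> space \<nu>. e < top} \<in> sets \<nu>"
        using measurable_sets[OF id_\<nu>, of "{..<top}"] by (simp add: vimage_def Int_def conj_commute)
      then have I_meas: "(\<lambda>e. if e < top then ?r * f e else ?K) \<in> borel_measurable \<nu>"
        using f_\<nu> by (intro measurable_If) auto
      have "(\<integral>\<xi>. ?F' (tail_path k (enn2real e) \<xi>) \<partial>steps k) = (if e < top then ?r * f e else ?K)" if e: "e \<in> space \<nu>" for e
      proof (cases "e < top")
        case True
        then have "0 < enn2real e" using e by (simp add: space_\<nu> enn2real_positive_iff)
        then show ?thesis
          using True e tail_path_positive_probability[of "enn2real e" k]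
          by (simp add: ennreal_enn2real tail_path_def zero_extend_def space_\<nu>)
      next
        case False
        then show ?thesis by (simp add: less_top[symmetric])
      qed
      then have "tail_integral \<nu> G k ?F' = (\<integral>e. (if e < top then ?r * f e else ?K) \<partial>\<nu>)"
        unfolding tail_integral_def by (intro Bochner_Integration.integral_cong refl)
      also have "\<dots> = (\<integral>e. ?r * f e \<partial>\<nu>)"
        using \<nu>_top f_\<nu> by (intro Bochner_Integration.integral_cong_AE[OF I_meas]) (auto elim: eventually_mono)
      finally have "tail_integral \<nu> G k ?F' = (\<integral>e. ?r * f e \<partial>\<nu>)" .
      then show ?thesis
        using f(2) r f_\<nu> by (subst integral_scale_measure_nonneg) (auto simp: space_\<nu>)
    qed
    show "((\<lambda>t. t * (\<integral>\<omega>. ?f (ennreal (X 0 \<omega> / b t)) \<partial>restrict_space M (?A (b t)))) \<longlongrightarrow> (\<integral>e. f e \<partial>scale_measure (ennreal ?r) \<nu>)) at_top"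
      unfolding limit[symmetric]
    proof (rule tendsto_along_scales)
      fix t c assume t: "filterlim t at_top sequentially" and ct: "\<And>n. c n = b (t n)"
        and c: "filterlim c at_top sequentially" "\<And>n. 0 < c n"
      have "(\<lambda>n. t n * (\<integral>\<omega>. ?F (y (c n)) (\<lambda>i\<in>{..k}. X i \<omega> / c n) \<partial>M)) \<longlonglongrightarrow> tail_integral \<nu> G k ?F'"
      proof (rule scaled_chain.scaled_path_integral_tendsto[where F="\<lambda>n. ?F (y (c n))",
            OF scaled_chain_below_boundary[OF t ct c y] F_meas F'_meas FB d(1) F0])
        fix P p assume P: "path_conv (\<lambda>s. \<forall>n. s n \<le> y (c n)) (\<lambda>_. True) k P p"
        have yc: "(\<lambda>n. y (c n)) \<longlonglongrightarrow> 0" using y_lim c(1) by (rule filterlim_compose)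
        show "(\<lambda>n. ?F (y (c n)) (P n)) \<longlonglongrightarrow> ?F' p"
          using P
        proof (cases rule: path_conv_cases)
          case 1
          have "\<forall>\<^sub>F n in sequentially. \<forall>j\<in>{..k}. y (c n) < P n j"
          proof (intro eventually_ball_finite ballI)
            fix j assume j: "j \<in> {..k}"
            have "(\<lambda>n. P n j - y (c n)) \<longlonglongrightarrow> p j - 0" using 1 yc j by (intro tendsto_diff) auto
            then have "\<forall>\<^sub>F n in sequentially. 0 < P n j - y (c n)" using 1 j by (intro order_tendstoD(1)) auto
            then show "\<forall>\<^sub>F n in sequentially. y (c n) < P n j" by eventually_elim simp
          qed simp
          then have "\<forall>\<^sub>F n in sequentially. ?f (ennreal (P n 0)) = ?F (y (c n)) (P n)"
            by eventually_elim simp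
          from Lim_transform_eventually[OF f_lim[OF 1(2)] this] show ?thesis using 1 by simp
        next
          case (2 i)
          \<comment> \<open>The coordinate \<open>i\<close> at which the limit vanishes lies at or
            below the boundary, so the indicator is 0 for every \<open>n\<close>.\<close>
          then have z: "?F (y (c n)) (P n) = 0" for n by (auto simp: not_less[symmetric])
          have z': "?F' p = 0" using 2 by simp
          show ?thesis unfolding z z' by (rule tendsto_const)
        qed
      qed
      moreover have "(\<integral>\<omega>. ?f (ennreal (X 0 \<omega> / b (t n))) \<partial>restrict_space M (?A (b (t n)))) = (\<integral>\<omega>. ?F (y (c n)) (\<lambda>i\<in>{..k}. X i \<omega> / c n) \<partial>M)" for n
      proof -
        have "(\<integral>\<omega>. ?f (ennreal (X 0 \<omega> / c n)) \<partial>restrict_space M (?A (c n))) = (\<integral>\<omega>. indicator (?A (c n)) \<omega> *\<^sub>R ?f (ennreal (X 0 \<omega> / c n)) \<partial>M)"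
          using A[of "c n"] by (intro integral_restrict_space) auto
        also have "\<dots> = (\<integral>\<omega>. ?F (y (c n)) (\<lambda>i\<in>{..k}. X i \<omega> / c n) \<partial>M)"
        proof (intro Bochner_Integration.integral_cong refl)
          fix \<omega> assume \<omega>: "\<omega> \<in> space M"
          have "\<omega> \<in> ?A (c n) \<longleftrightarrow> (\<forall>i\<le>k. y (c n) < X i \<omega> / c n)"
            using c(2)[of n] \<omega> by (auto simp: le_hitting_time_iff k less_Suc_eq_le field_simps)
          then show "indicator (?A (c n)) \<omega> *\<^sub>R ?f (ennreal (X 0 \<omega> / c n)) = ?F (y (c n)) (\<lambda>i\<in>{..k}. X i \<omega> / c n)"
            by (simp add: indicator_def)
        qed
        finally show ?thesis by (simp only: ct)
      qed
      ultimately show "(\<lambda>n. t n * (\<integral>\<omega>. ?f (ennreal (X 0 \<omega> / b (t n))) \<partial>restrict_space M (?A (b (t n))))) \<longlonglongrightarrow> tail_integral \<nu> G k ?F'"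
        by (simp only:)
    qed
  qed
  then show ?thesis by (simp add: k)
qed

end

theorem proposition5p1:
  fixes G H :: "real measure"
    and K :: "real \<Rightarrow> real measure"
    and M :: "'w measure"
    and X :: "nat \<Rightarrow> 'w \<Rightarrow> real"
    and y b :: "real \<Rightarrow> real"
    and \<alpha> :: real
    and \<nu> :: "ennreal measure"
    and m :: nat
  assumes G: "G \<in> space (prob_algebra half_line)"
    and K: "K \<in> measurable half_line (prob_algebra half_line)"
    and K_attracted: "attracted K G"
    and M: "prob_space M"
    and X: "markov_chain M K X"
    and y: "uniform_extremal_boundary K G y"
    and H: "H \<in> space (prob_algebra half_line)"
    and X0: "distr M half_line (X 0) = H"
    and b: "filterlim b at_top at_top"
    and \<alpha>: "0 < \<alpha>"
    and sets_\<nu>: "sets \<nu> = sets (borel_of pos_top)"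
    and \<nu>: "\<And>x::real. 0 < x \<Longrightarrow> emeasure \<nu> {ennreal x<..} = ennreal (x powr (- \<alpha>))"
    and H_tail: "vague_conv pos_top
        (\<lambda>t. scale_measure (ennreal t) (law_on pos_top H (\<lambda>x. ennreal (x / b t)))) \<nu> at_top"
    and m: "1 \<le> m"
  shows
    "vague_conv (last_free_top m)
       (\<lambda>t. scale_measure (ennreal t) (law_on (last_free_top m) M (scaled_path m (b t) X)))
       (law_on (last_free_top m) (nu_star \<nu> G m) (\<lambda>x. x)) at_top
   \<and> vague_conv (first_pos_top m)
       (\<lambda>t. scale_measure (ennreal t)
              (law_on (first_pos_top m) M (scaled_path m (b t) (extremal_component y X (b t)))))
       (nu_star \<nu> G m) at_top
   \<and> (measure G {0} = 0 \<or> extremal_boundary K G (\<lambda>_. 0) \<or> regularity_condition K \<longrightarrow>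
       vague_conv (first_pos_top m)
         (\<lambda>t. scale_measure (ennreal t) (law_on (first_pos_top m) M (scaled_path m (b t) X)))
         (nu_star \<nu> G m) at_top)
   \<and> vague_conv pos_top
       (\<lambda>t. scale_measure (ennreal t)
              (law_on pos_top
                 (restrict_space M {\<omega> \<in> space M. enat m \<le> hitting_time y X (b t) \<omega>})
                 (\<lambda>\<omega>. ennreal (X 0 \<omega> / b t))))
       (scale_measure (ennreal ((1 - measure G {0}) ^ (m - 1))) \<nu>) at_top"
proof -
  interpret M: prob_space M by (rule M)
  have H_sets: "sets H = sets half_line" using H by (auto simp: space_prob_algebra)
  have X_meas: "X 0 \<in> measurable M half_line" using X by (simp add: markov_chain_def)
  have radon: "radon_on pos_top \<nu>" using H_tail by (simp add: vague_conv_def)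
  have compact_above: "compactin pos_top {ennreal d..}" if "0 < d" for d
    unfolding pos_top_def using that
    by (auto simp: compactin_subtopology compact_eq_closed intro: less_le_trans[of _ "ennreal d"])
  interpret tail_measure \<nu> G
  proof
    show "sets \<nu> = sets (borel_of pos_top)" by (rule sets_\<nu>)
    show "emeasure \<nu> {ennreal d..} < \<infinity>" if "0 < d" for d :: real
      using radon compact_above[OF that] by (simp add: radon_on_def)
    show "AE e in \<nu>. e < top"
    \<comment> \<open>The point infinity lies in every (x,\<infinity>], whose mass x powr
      (-\<alpha>) tends to 0 as x grows because \<alpha> is positive.\<close>
    proof (rule AE_I)
      have open_above: "{ennreal x<..} \<in> sets \<nu>" for x
        unfolding sets_\<nu> by (rule openin_borel_of) (auto simp: pos_top_def openin_subtopology intro!: exI[of _ "{ennreal x<..}"] le_less_trans[of 0 "ennreal x"])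
      have "emeasure \<nu> {top} \<le> ennreal (x powr (- \<alpha>))" if "0 < x" for x :: real
        unfolding \<nu>[OF that, symmetric] by (intro emeasure_mono open_above) auto
      moreover have "((\<lambda>x::real. ennreal (x powr (- \<alpha>))) \<longlongrightarrow> ennreal 0) at_top"
        using tendsto_neg_powr[OF _ filterlim_ident, of "- \<alpha>"] \<alpha> by (intro tendsto_ennrealI) auto
      ultimately have "emeasure \<nu> {top} \<le> ennreal 0"
        by (intro tendsto_lowerbound[of _ "ennreal 0" at_top]) (auto intro: eventually_mono[OF eventually_gt_at_top[of 0]])
      then show "emeasure \<nu> {top} = 0" by simp
      have below: "{0<..<top} \<in> sets \<nu>"
        unfolding sets_\<nu>
        by (rule openin_borel_of) (auto simp: pos_top_def openin_subtopology intro!: exI[of _ "{0<..<top}"])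
      have "space \<nu> = {0<..}" using sets_eq_imp_space_eq[OF sets_\<nu>] by simp
      then have "{top} = space \<nu> - {0<..<top}"
        using top.not_eq_extremum[where 'a=ennreal] by (intro set_eqI) force
      then show "{top} \<in> sets \<nu>" using sets.compl_sets[OF below] by (simp only:)
      show "{e \<in> space \<nu>. \<not> e < top} \<subseteq> {top}"
        using top.not_eq_extremum[where 'a=ennreal] by blast
    qed
    show "G \<in> space (prob_algebra half_line)" by (rule G)
  qed
  interpret heavy_tailed_chain M \<nu> G K X b
  proof
    show "0 < emeasure \<nu> {ennreal d..}" if "0 < d" for d :: real
    proof -
      have "{ennreal d..} \<subseteq> space \<nu>" using that by (auto simp: space_\<nu> intro: less_le_trans[of _ "ennreal d"])
      then have "{ennreal d..} \<in> sets \<nu>"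
        using measurable_sets[OF id_\<nu>, of "{ennreal d..}"] by (simp add: Int_absorb2)
      then have "emeasure \<nu> {ennreal d<..} \<le> emeasure \<nu> {ennreal d..}" by (intro emeasure_mono) auto
      moreover have "0 < emeasure \<nu> {ennreal d<..}" using \<nu>[OF that] that by simp
      ultimately show ?thesis by (rule less_le_trans[rotated])
    qed
    fix h :: "ennreal \<Rightarrow> real"
    assume h: "continuous_on UNIV h" "\<And>e. 0 \<le> h e" "\<exists>d>0. \<forall>e<ennreal d. h e = 0"
    obtain d where d: "0 < d" "\<And>e. e < ennreal d \<Longrightarrow> h e = 0" using h(3) by blast
    have h_cont: "continuous_map pos_top euclideanreal h"
      using h(1) by (auto simp: pos_top_def intro: continuous_on_subset)
    have tm: "topologically_measurable pos_top H (\<lambda>x. ennreal (x / b t))" for t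
      by (intro topologically_measurable_pos_top half_line_measurable[OF H_sets]) measurable
    have "((\<lambda>t. \<integral>x. h x \<partial>scale_measure (ennreal t) (law_on pos_top H (\<lambda>x. ennreal (x / b t)))) \<longlongrightarrow> (\<integral>x. h x \<partial>\<nu>)) at_top"
    proof (rule H_tail[unfolded vague_conv_def, THEN conjunct2, THEN conjunct2, rule_format], intro conjI ballI)
      show "\<exists>C. compactin pos_top C \<and> (\<forall>x\<in>topspace pos_top - C. h x = 0)"
        using compact_above[OF d(1)] d(2) by (intro exI[of _ "{ennreal d..}"]) (auto simp: not_le)
    qed (rule h_cont h(2))+
    moreover have "\<forall>\<^sub>F t in at_top. (\<integral>x. h x \<partial>scale_measure (ennreal t) (law_on pos_top H (\<lambda>x. ennreal (x / b t))))
        = t * (\<integral>\<omega>. h (ennreal (X 0 \<omega> / b t)) \<partial>M)"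
      using eventually_ge_at_top[of 0]
    proof eventually_elim
      case (elim t)
      \<comment> \<open>\<open>h\<close> vanishes near 0, in particular at the only point outside
        (0,\<infinity>], so it is its own zero extension.\<close>
      have "zero_extend pos_top h e = h e" for e
        using d(2)[of 0] d(1) by (cases "e = 0") (auto simp: zero_extend_def)
      then have "(\<integral>x. h x \<partial>scale_measure (ennreal t) (law_on pos_top H (\<lambda>x. ennreal (x / b t)))) = t * (\<integral>x. h (ennreal (x / b t)) \<partial>H)"
        using integral_scaled_law_on[OF tm continuous_map_borel_of[OF h_cont] h(2) elim] by simp
      moreover have "(\<integral>x. h (ennreal (x / b t)) \<partial>H) = (\<integral>\<omega>. h (ennreal (X 0 \<omega> / b t)) \<partial>M)"
      proof -
        have "(\<lambda>x. ennreal (x / b t)) \<in> borel_measurable half_line" by measurable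
        then show ?thesis unfolding X0[symmetric]
          by (intro integral_distr X_meas measurable_compose[OF _ borel_measurable_continuous_onI[OF h(1)]])
      qed
      ultimately show ?case by simp
    qed
    ultimately show "((\<lambda>t. t * (\<integral>\<omega>. h (ennreal (X 0 \<omega> / b t)) \<partial>M)) \<longlongrightarrow> (\<integral>e. h e \<partial>\<nu>)) at_top"
      by (rule Lim_transform_eventually)
  qed (fact K K_attracted X b)+
  show ?thesis
    using vague_limit_free_last[OF m] vague_limit_extremal_component[OF y] vague_limit_full_path
      vague_limit_hitting_time[OF y m radon] by blast
qed

end
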